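(* Let $p\ge 3$ be an integer, $\sigma\ge p+1$, $\lambda\ge 3$ and $C_0>0$. Then there is a constant $C>0$, which may depend on $p,\sigma,\lambda,C_0$ but is independent of $\varepsilon$ and $N$, such that the following holds. Let $0<\varepsilon\le 1$, let $N\ge 4$ be an integer divisible by $4$ with $\sigma\varepsilon\ln N\le \tfrac14$, and let $f\in L_2(\Omega)$ be such that the solution $u$ of the boundary value problem $$\varepsilon^4u^{(4)}+4u=f\ \text{ in }\Omega=(0,1),\qquad u(\xi)=u'(\xi)=0,\ \xi\in\{0,1\},$$ admits a layer decomposition of order $K=p+3$ with constant $C_0$. Let $(u_h,v_h)\in V_h$ be the finite element solution on the Shishkin mesh with parameters $N,\sigma,\varepsilon$, i.e. $\mathcal{B}\bigl((u_h,v_h),(u_*,v_* )\bigr)=\mathcal{F}\bigl((u_*,v_* )\bigr)$ for all $(u_*,v_* )\in V_h$. Then $$\|u-u_h\|+\|\varepsilon^{3/2}u''-v_h\|\le C\left\{(\ln N)^{p+1}+|\lambda-4|\min\left\{\varepsilon^{3/2}N^2,\varepsilon^{-1/2}\right\}\right\}N^{-(p+1)}.$$ Moreover, if $\lambda=4$ or $\varepsilon^{3/2}\le N^{-2}$, then $$\|u-u_h\|+\|\varepsilon^{3/2}u''-v_h\|\le C\left(N^{-1}\ln N\right)^{p+1}.$$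
   Context: $\Omega=(0,1)$; $\langle\cdot,\cdot\rangle$ and $\|\cdot\|$ are the $L_2(\Omega)$ inner product and norm. $V:=H_0^2(\Omega)\times H^2(\Omega)$, where $H^2_0(\Omega)$ is the space of $w\in H^2(\Omega)$ with $w=w'=0$ at $0$ and $1$. Bilinear form and functional (for given $\lambda>0$, $\varepsilon$, $f$): $$\mathcal{B}\bigl((u,v),(u_*,v_* )\bigr):=\lambda\langle v-\varepsilon^{3/2}u'',v_*-\varepsilon^{3/2}u_*''\rangle+\langle\varepsilon^{5/2}v''+4u,\varepsilon^{3/2}v_*''+4u_*\rangle,\qquad \mathcal{F}\bigl((u_*,v_* )\bigr):=\langle f,\varepsilon^{3/2}v_*''+4u_*\rangle .$$ Layer decomposition of order $K$ with constant $C_0$: there are functions $u_{\mathrm{reg}},u_{\mathrm{bl},0},u_{\mathrm{bl},1}\in C^K([0,1])$ with $u=u_{\mathrm{bl},0}+u_{\mathrm{reg}}+u_{\mathrm{bl},1}$ on $[0,1]$ such that for all $x\in[0,1]$ and $\kappa=0,1,\dots,K$ $$|u_{\mathrm{reg}}^{(\kappa)}(x)|\le C_0,\quad |u_{\mathrm{bl},0}^{(\kappa)}(x)|\le C_0\varepsilon^{-\kappa}e^{-x/\varepsilon},\quad |u_{\mathrm{bl},1}^{(\kappa)}(x)|\le C_0\varepsilon^{-\kappa}e^{-(1-x)/\varepsilon},$$ and $\varepsilon^4u_{\mathrm{reg}}^{(4)}+4u_{\mathrm{reg}}=f$, $\varepsilon^4u_{\mathrm{bl},i}^{(4)}+4u_{\mathrm{bl},i}=0$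 ($i=0,1$) in $\Omega$. Shishkin mesh: with transition point $\tau:=\sigma\varepsilon\ln N$ (the case $\sigma\varepsilon\ln N\le\frac14$), the intervals $[0,\tau]$ and $[1-\tau,1]$ are each divided uniformly into $N/4$ subintervals and $[\tau,1-\tau]$ is divided uniformly into $N/2$ subintervals; this gives a partition $\omega: 0=x_0<x_1<\dots<x_N=1$. Finite element space: $\mathcal{S}_p^1(\omega):=\{s\in C^1[0,1]: s|_{(x_{i-1},x_i)}\text{ is a polynomial of degree at most } p,\ i=1,\dots,N\}$ and $V_h:=\bigl(\mathcal{S}_p^1(\omega)\times\mathcal{S}_p^1(\omega)\bigr)\cap V$. *)

theory Defs
  imports "HOL-Analysis.Analysis" "HOL-Computational_Algebra.Polynomial"
begin

text \<open>Functions on the unit interval are total functions on the reals; values outside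
  \<open>[0,1]\<close> are never inspected. Elements of \<open>L\<^sub>2\<close> and of Sobolev spaces are
  represented by arbitrary members of their almost-everywhere equivalence class.\<close>

abbreviation Omega :: "real set" where
  "Omega \<equiv> {0<..<1}"

definition L2 :: "(real \<Rightarrow> real) set" where
  "L2 = {w. w \<in> borel_measurable (lebesgue_on Omega) \<and>
            integrable (lebesgue_on Omega) (\<lambda>x. (w x)\<^sup>2)}"

definition L2_inner :: "(real \<Rightarrow> real) \<Rightarrow> (real \<Rightarrow> real) \<Rightarrow> real" where
  "L2_inner w z = (\<integral>x. w x * z x \<partial>lebesgue_on Omega)"

definition L2_norm :: "(real \<Rightarrow> real) \<Rightarrow> real" where
  "L2_norm w = sqrt (L2_inner w w)"

definition test_function :: "(real \<Rightarrow> real) \<Rightarrow> bool" where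
  "test_function \<phi> \<longleftrightarrow>
     (\<forall>k x. (deriv ^^ k) \<phi> field_differentiable (at x)) \<and> closure {x. \<phi> x \<noteq> 0} \<subseteq> Omega"

definition has_weak_deriv :: "nat \<Rightarrow> (real \<Rightarrow> real) \<Rightarrow> (real \<Rightarrow> real) \<Rightarrow> bool" where
  "has_weak_deriv k w g \<longleftrightarrow> w \<in> L2 \<and> g \<in> L2 \<and>
     (\<forall>\<phi>. test_function \<phi> \<longrightarrow> L2_inner w ((deriv ^^ k) \<phi>) = (-1) ^ k * L2_inner g \<phi>)"

definition Sobolev :: "nat \<Rightarrow> (real \<Rightarrow> real) set" where
  "Sobolev m = {w. \<forall>k\<le>m. \<exists>g. has_weak_deriv k w g}"

text \<open>Weak derivatives are unique up to null sets, so the choice below does not influence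
  \<open>L\<^sub>2\<close> inner products, norms, or statements that hold almost everywhere.\<close>

definition weak_deriv :: "nat \<Rightarrow> (real \<Rightarrow> real) \<Rightarrow> real \<Rightarrow> real" where
  "weak_deriv k w = (SOME g. has_weak_deriv k w g)"

text \<open>Classical derivatives on the closed interval are one-sided at the end points.\<close>

definition D01 :: "(real \<Rightarrow> real) \<Rightarrow> real \<Rightarrow> real" where
  "D01 w x = vector_derivative w (at x within {0..1})"

definition C_closed :: "nat \<Rightarrow> (real \<Rightarrow> real) set" where
  "C_closed K = {w. (\<forall>k<K. \<forall>x\<in>{0..1}. (D01 ^^ k) w differentiable (at x within {0..1})) \<and>
                    (\<forall>k\<le>K. continuous_on {0..1} ((D01 ^^ k) w))}"

text \<open>The boundary values of an \<open>H\<^sup>2\<close> function are those of its representative in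
  \<open>C\<^sup>1([0,1])\<close>.\<close>

definition Sobolev2_0 :: "(real \<Rightarrow> real) set" where
  "Sobolev2_0 = {w \<in> Sobolev 2. \<exists>c \<in> C_closed 1. (AE x in lebesgue_on Omega. w x = c x) \<and>
      (\<forall>\<xi>\<in>{0, 1}. c \<xi> = 0 \<and> D01 c \<xi> = 0)}"

definition V :: "((real \<Rightarrow> real) \<times> (real \<Rightarrow> real)) set" where
  "V = Sobolev2_0 \<times> Sobolev 2"

definition bilin ::
  "real \<Rightarrow> real \<Rightarrow> (real \<Rightarrow> real) \<times> (real \<Rightarrow> real) \<Rightarrow> (real \<Rightarrow> real) \<times> (real \<Rightarrow> real) \<Rightarrow> real" where
  "bilin lam eps = (\<lambda>(u, v) (us, vs).
     lam * L2_inner (\<lambda>x. v x - eps powr (3/2) * weak_deriv 2 u x)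
                    (\<lambda>x. vs x - eps powr (3/2) * weak_deriv 2 us x)
     + L2_inner (\<lambda>x. eps powr (5/2) * weak_deriv 2 v x + 4 * u x)
                (\<lambda>x. eps powr (3/2) * weak_deriv 2 vs x + 4 * us x))"

definition load :: "real \<Rightarrow> (real \<Rightarrow> real) \<Rightarrow> (real \<Rightarrow> real) \<times> (real \<Rightarrow> real) \<Rightarrow> real" where
  "load eps f = (\<lambda>(us, vs). L2_inner f (\<lambda>x. eps powr (3/2) * weak_deriv 2 vs x + 4 * us x))"

definition bvp_solution :: "real \<Rightarrow> (real \<Rightarrow> real) \<Rightarrow> (real \<Rightarrow> real) \<Rightarrow> bool" where
  "bvp_solution eps f u \<longleftrightarrow> u \<in> Sobolev 4 \<and> u \<in> Sobolev2_0 \<and>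
     (AE x in lebesgue_on Omega. eps ^ 4 * weak_deriv 4 u x + 4 * u x = f x)"

definition layer_decomposition ::
  "nat \<Rightarrow> real \<Rightarrow> real \<Rightarrow> (real \<Rightarrow> real) \<Rightarrow> (real \<Rightarrow> real) \<Rightarrow> bool" where
  "layer_decomposition K C0 eps f u \<longleftrightarrow>
     (\<exists>ureg \<in> C_closed K. \<exists>ubl0 \<in> C_closed K. \<exists>ubl1 \<in> C_closed K.
        (\<forall>x\<in>{0..1}. u x = ubl0 x + ureg x + ubl1 x) \<and>
        (\<forall>x\<in>{0..1}. \<forall>k\<le>K.
           \<bar>(D01 ^^ k) ureg x\<bar> \<le> C0 \<and>
           \<bar>(D01 ^^ k) ubl0 x\<bar> \<le> C0 * eps powi (- int k) * exp (- x / eps) \<and>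
           \<bar>(D01 ^^ k) ubl1 x\<bar> \<le> C0 * eps powi (- int k) * exp (- (1 - x) / eps)) \<and>
        (AE x in lebesgue_on Omega. eps ^ 4 * (D01 ^^ 4) ureg x + 4 * ureg x = f x) \<and>
        (\<forall>x\<in>Omega. eps ^ 4 * (D01 ^^ 4) ubl0 x + 4 * ubl0 x = 0) \<and>
        (\<forall>x\<in>Omega. eps ^ 4 * (D01 ^^ 4) ubl1 x + 4 * ubl1 x = 0))"

text \<open>Node number \<open>i\<close> of the Shishkin mesh, for \<open>i \<le> N\<close> and \<open>N\<close> divisible by 4.\<close>

definition shishkin :: "real \<Rightarrow> real \<Rightarrow> nat \<Rightarrow> nat \<Rightarrow> real" where
  "shishkin \<sigma> eps N i =
     (let \<tau> = \<sigma> * eps * ln (real N); n = real N / 4 in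
      if i \<le> N div 4 then real i * (\<tau> / n)
      else if i \<le> 3 * (N div 4) then \<tau> + (real i - n) * ((1 - 2 * \<tau>) / (2 * n))
      else (1 - \<tau>) + (real i - 3 * n) * (\<tau> / n))"

definition spline_space :: "nat \<Rightarrow> nat \<Rightarrow> (nat \<Rightarrow> real) \<Rightarrow> (real \<Rightarrow> real) set" where
  "spline_space p N xs = {s \<in> C_closed 1.
     \<forall>i\<in>{1..N}. \<exists>q. degree q \<le> p \<and> (\<forall>x\<in>{xs (i - 1)<..<xs i}. s x = poly q x)}"

definition Vh :: "nat \<Rightarrow> nat \<Rightarrow> (nat \<Rightarrow> real) \<Rightarrow> ((real \<Rightarrow> real) \<times> (real \<Rightarrow> real)) set" where
  "Vh p N xs = (spline_space p N xs \<times> spline_space p N xs) \<inter> V"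

definition fe_solution ::
  "nat \<Rightarrow> nat \<Rightarrow> (nat \<Rightarrow> real) \<Rightarrow> real \<Rightarrow> real \<Rightarrow> (real \<Rightarrow> real) \<Rightarrow>
   (real \<Rightarrow> real) \<times> (real \<Rightarrow> real) \<Rightarrow> bool" where
  "fe_solution p N xs lam eps f w \<longleftrightarrow>
     w \<in> Vh p N xs \<and> (\<forall>z \<in> Vh p N xs. bilin lam eps w z = load eps f z)"

end

theory Submission
  imports Defs
begin

text \<open>
Write \<open>E = eps powr (3/2)\<close> and \<open>v = E u''\<close>. The pair \<open>(u, v)\<close> solves the variational equation, so its error
against the finite element solution is Galerkin orthogonal to the trial space. Integration by parts turns
both mixed terms \<open>\<langle>u, v''\<rangle>\<close> and \<open>\<langle>u'', v\<rangle>\<close> into one cross term, and for \<open>lam \<ge> 3\<close> Young's inequality absorbs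
that term: the bilinear form dominates \<open>\<parallel>v\<parallel>\<^sup>2 + E\<^sup>2 \<parallel>u''\<parallel>\<^sup>2 + eps\<^sup>4 \<parallel>v''\<parallel>\<^sup>2 + \<parallel>u\<parallel>\<^sup>2\<close>. With approximation errors
\<open>a\<close> of \<open>u\<close> and \<open>b\<close> of \<open>v\<close>, the discrete error is then controlled by \<open>\<parallel>a\<parallel>\<close>, \<open>\<parallel>b\<parallel>\<close> and the three pairings
\<open>\<langle>a'', c''\<rangle>\<close>, \<open>\<langle>b'', d''\<rangle>\<close>, \<open>\<langle>a, d''\<rangle>\<close> with splines \<open>c, d\<close> (\<open>energy_estimate\<close>).

Taken in norm, \<open>a''\<close> and \<open>b''\<close> are two orders too large. The spline interpolant is therefore chosen such that its
second derivative is, on each element, the \<open>L\<^sub>2\<close> projection of the second derivative of the function onto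
polynomials of degree \<open>p - 2\<close>. Testing with constants and linear functions shows that this interpolant
matches values and slopes at the nodes, so the pieces form a \<open>C\<^sup>1\<close> spline, the two pairings of second
derivatives vanish, and the error is of order \<open>p + 1\<close> in \<open>L\<^sub>2\<close> (\<open>hermite_moment_interpolant\<close>).

This works for the regular part on the whole mesh, and for the layer parts inside the fine regions only: at the
transition point a layer part has a slope of size \<open>1/eps\<close>, which interpolation on a coarse element
would amplify. There the layer parts are replaced by zero, and a cubic that lives on the entire
fine region brings the interpolant to zero (\<open>layer_adapted_spline\<close>). Such a cubic is at least as wide as the layer,
so in \<open>L\<^sub>2\<close> its second derivative is of the order of that of the layer part beyond the transition point, which is
small by the choice of \<open>\<sigma>\<close> (\<open>layer_part_approximation\<close>). Confined to a single fine element of width \<open>h\<close>, the correction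
would be larger by a power of \<open>eps/h\<close> as soon as \<open>h < eps\<close>.

The pairing \<open>E \<langle>a, d''\<rangle>\<close> occurs with the factor \<open>lam - 4\<close>. Bounding \<open>\<parallel>d''\<parallel>\<close> by the energy norm costs \<open>eps powr (-1/2)\<close>;
alternatively, an inverse inequality on the coarse elements costs \<open>E N\<^sup>2\<close>, while layer parts and fine regions are harmless
(\<open>regular_part_approximation\<close>). This is the minimum in the error bound.

In order to compute with the weak derivatives of splines they are identified with piecewise
classical ones, which rests on the uniqueness of weak derivatives (\<open>weak_deriv_unique\<close>).
\<close>

section \<open>Bump functions and uniqueness of weak derivatives\<close>

text \<open>The functions \<open>q(1/x) exp(-1/x)\<close>, extended by zero to \<open>x \<le> 0\<close>. Carrying the polynomial \<open>q\<close> along makes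
the family closed under differentiation, so that all its members are smooth.\<close>

definition flat_fun :: "real poly \<Rightarrow> real \<Rightarrow> real" where
  "flat_fun q x = (if x > 0 then poly q (1 / x) * exp (- (1 / x)) else 0)"

lemma poly_exp_decay:
  fixes q :: "real poly"
  shows "((\<lambda>y. poly q y * exp (- y)) \<longlongrightarrow> 0) at_top"
proof -
  have "((\<lambda>y. \<Sum>i\<le>degree q. coeff q i * (y ^ i / exp y)) \<longlongrightarrow> (\<Sum>i\<le>degree q. coeff q i * 0)) at_top"
    by (intro tendsto_intros tendsto_power_div_exp_0)
  moreover have "(\<lambda>y. \<Sum>i\<le>degree q. coeff q i * (y ^ i / exp y)) = (\<lambda>y. poly q y * exp (- y))"
    by (simp add: fun_eq_iff poly_altdef sum_distrib_right exp_minus divide_inverse mult.assoc)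
  ultimately show ?thesis by simp
qed

lemma flat_fun_tendsto_0: "(flat_fun q \<longlongrightarrow> 0) (at 0)"
proof -
  have "(flat_fun q \<longlongrightarrow> 0) (at_right 0)"
  proof -
    have "((\<lambda>x::real. poly q (inverse x) * exp (- inverse x)) \<longlongrightarrow> 0) (at_right 0)"
      using filterlim_compose[OF poly_exp_decay filterlim_inverse_at_top_right] by simp
    moreover have "\<forall>\<^sub>F x in at_right 0. poly q (inverse x) * exp (- inverse x) = flat_fun q x"
      using eventually_at_right_less[of "0::real"]
      by eventually_elim (simp add: flat_fun_def inverse_eq_divide)
    ultimately show ?thesis using tendsto_cong by fastforce
  qed
  moreover have "(flat_fun q \<longlongrightarrow> 0) (at_left 0)"
  proof -
    have "\<forall>\<^sub>F x in at_left 0. 0 = flat_fun q x"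
      by (simp add: eventually_at_filter flat_fun_def)
    then show ?thesis using tendsto_cong[of "\<lambda>_. 0"] by fastforce
  qed
  ultimately show ?thesis by (simp add: filterlim_split_at)
qed

definition flat_deriv :: "real poly \<Rightarrow> real poly" where
  "flat_deriv q = [:0, 0, 1:] * (q - pderiv q)"

text \<open>At the origin the difference quotient is again a flat function, with \<open>q\<close> multiplied by the variable.\<close>

lemma DERIV_flat_fun: "(flat_fun q has_real_derivative flat_fun (flat_deriv q) x) (at x)"
proof -
  consider "x > 0" | "x < 0" | "x = 0" by linarith
  then show ?thesis
  proof cases
    case 1
    have "((\<lambda>x. poly q (1 / x) * exp (- (1 / x))) has_real_derivative flat_fun (flat_deriv q) x) (at x)"
      using 1 by (auto intro!: derivative_eq_intros poly_DERIV DERIV_chain2[where f="poly q"]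
          simp: flat_fun_def flat_deriv_def field_simps power2_eq_square)
    then show ?thesis
      by (rule has_field_derivative_transform_within_open[of _ _ _ "{0<..}"])
         (use 1 in \<open>auto simp: flat_fun_def\<close>)
  next
    case 2
    have "((\<lambda>x. 0) has_real_derivative flat_fun (flat_deriv q) x) (at x)"
      using 2 by (auto simp: flat_fun_def)
    then show ?thesis
      by (rule has_field_derivative_transform_within_open[of _ _ _ "{..<0}"])
         (use 2 in \<open>auto simp: flat_fun_def\<close>)
  next
    case 3
    have "(flat_fun q (0 + h) - flat_fun q 0) / h = flat_fun ([:0, 1:] * q) h" for h
      by (auto simp: flat_fun_def)
    then have "((\<lambda>h. (flat_fun q (0 + h) - flat_fun q 0) / h) \<longlongrightarrow> 0) (at 0)"
      using flat_fun_tendsto_0 by presburger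
    moreover have "flat_fun (flat_deriv q) 0 = 0" by (simp add: flat_fun_def)
    ultimately show ?thesis using 3 by (simp add: DERIV_def)
  qed
qed

text \<open>Sums of products of two flat functions, one vanishing left of \<open>c\<close> and one right of \<open>d\<close>: a set of functions that contains a
derivative of each of its members, which are therefore smooth.\<close>

inductive_set bump_family :: "real \<Rightarrow> real \<Rightarrow> real \<Rightarrow> (real \<Rightarrow> real) set"
  for c d n :: real where
  base: "(\<lambda>x. k * (flat_fun q (n * (x - c)) * flat_fun r (n * (d - x)))) \<in> bump_family c d n"
| sum: "g \<in> bump_family c d n \<Longrightarrow> h \<in> bump_family c d n \<Longrightarrow> (\<lambda>x. g x + h x) \<in> bump_family c d n"

lemma bump_family_deriv:
  assumes "g \<in> bump_family c d n"
  shows "\<exists>g' \<in> bump_family c d n. \<forall>x. (g has_real_derivative g' x) (at x)"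
  using assms
proof induction
  case (base k q r)
  let ?g = "\<lambda>x. (k * n) * (flat_fun (flat_deriv q) (n * (x - c)) * flat_fun r (n * (d - x)))
    + (- k * n) * (flat_fun q (n * (x - c)) * flat_fun (flat_deriv r) (n * (d - x)))"
  have "?g \<in> bump_family c d n"
    by (intro bump_family.intros)
  moreover have "((\<lambda>x. k * (flat_fun q (n * (x - c)) * flat_fun r (n * (d - x))))
      has_real_derivative ?g x) (at x)" for x
    by (auto intro!: derivative_eq_intros DERIV_chain2[OF DERIV_flat_fun] simp: algebra_simps)
  ultimately show ?case by (intro bexI[of _ ?g] allI)
next
  case (sum g h)
  then obtain g' h' where "g' \<in> bump_family c d n" "\<forall>x. (g has_real_derivative g' x) (at x)"
     "h' \<in> bump_family c d n" "\<forall>x. (h has_real_derivative h' x) (at x)" by auto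
  then show ?case
    by (intro bexI[of _ "\<lambda>x. g' x + h' x"]) (auto intro: bump_family.intros DERIV_add)
qed

lemma bump_family_smooth:
  assumes "g \<in> bump_family c d n"
  shows "(deriv ^^ k) g \<in> bump_family c d n"
proof (induction k)
  case (Suc k)
  from bump_family_deriv[OF Suc] obtain g' where
    g': "g' \<in> bump_family c d n" "\<forall>x. ((deriv ^^ k) g has_real_derivative g' x) (at x)" by auto
  then have "(deriv ^^ Suc k) g = g'" by (auto simp: fun_eq_iff DERIV_imp_deriv)
  with g' show ?case by simp
qed (use assms in simp)

text \<open>For large \<open>n\<close> these bumps approximate the indicator function of the interval from \<open>c\<close> to \<open>d\<close>, boundedly and everywhere.\<close>

definition bump :: "real \<Rightarrow> real \<Rightarrow> real \<Rightarrow> real \<Rightarrow> real" where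
  "bump c d n x = flat_fun 1 (n * (x - c)) * flat_fun 1 (n * (d - x))"

lemma bump_eq:
  assumes "n > 0"
  shows "bump c d n x =
    (if c < x \<and> x < d then exp (- (1 / (x - c) + 1 / (d - x)) / n) else 0)"
proof -
  have "- (1 / (n * (x - c))) + - (1 / (n * (d - x))) = - (1 / (x - c) + 1 / (d - x)) / n"
    by (simp add: diff_divide_distrib mult.commute)
  then have "exp (- (1 / (n * (x - c)))) * exp (- (1 / (n * (d - x)))) =
      exp (- (1 / (x - c) + 1 / (d - x)) / n)"
    by (metis exp_add)
  then show ?thesis
    using assms by (auto simp: bump_def flat_fun_def zero_less_mult_iff)
qed

lemma test_function_bump:
  assumes "0 < c" "c < d" "d < 1" "n > 0"
  shows "test_function (bump c d n)"
  unfolding test_function_def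
proof safe
  fix k x
  have "bump c d n \<in> bump_family c d n"
    using bump_family.base[of 1 1 n c 1 d] by (simp add: bump_def[abs_def])
  from bump_family_deriv[OF bump_family_smooth[OF this]]
  show "(deriv ^^ k) (bump c d n) field_differentiable at x"
    by (force simp: field_differentiable_def)
next
  fix x assume x: "x \<in> closure {x. bump c d n x \<noteq> 0}"
  have "closure {x. bump c d n x \<noteq> 0} \<subseteq> {c..d}"
    by (rule closure_minimal) (auto simp: bump_eq assms split: if_splits)
  with x show "x \<in> Omega" using assms by auto
qed

lemma L2_mult_integrable:
  assumes "w \<in> L2" "z \<in> L2"
  shows "integrable (lebesgue_on Omega) (\<lambda>x. w x * z x)"
proof (rule Bochner_Integration.integrable_bound)
  show "integrable (lebesgue_on Omega) (\<lambda>x. (w x)\<^sup>2 + (z x)\<^sup>2)"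
    using assms by (auto simp: L2_def)
  show "(\<lambda>x. w x * z x) \<in> borel_measurable (lebesgue_on Omega)"
    using assms by (auto simp: L2_def)
  have "\<bar>a * b\<bar> \<le> a\<^sup>2 + b\<^sup>2" for a b :: real
  proof -
    have "2 * (a * b) \<le> a\<^sup>2 + b\<^sup>2" "- (2 * (a * b)) \<le> a\<^sup>2 + b\<^sup>2"
      using sum_squares_bound[of a b] sum_squares_bound[of a "-b"] by simp_all
    then show ?thesis using zero_le_power2[of a] zero_le_power2[of b] by linarith
  qed
  then show "AE x in lebesgue_on Omega. norm (w x * z x) \<le> norm ((w x)\<^sup>2 + (z x)\<^sup>2)"
    by auto
qed

text \<open>Lebesgue's differentiation theorem: almost everywhere a function is the limit of its means over shrinking intervals.\<close>

lemma AE_zero_if_integrals_zero: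
  fixes g :: "real \<Rightarrow> real"
  assumes g: "integrable (lebesgue_on Omega) g"
    and zero: "\<And>c d. 0 < c \<Longrightarrow> c < d \<Longrightarrow> d < 1 \<Longrightarrow> integral {c..d} g = 0"
  shows "AE x in lebesgue_on Omega. g x = 0"
proof -
  define f where "f = (\<lambda>x. if x \<in> Omega then g x else 0)"
  have "g integrable_on Omega"
    using g by (simp add: integrable_on_lebesgue_on)
  then have fU: "f integrable_on UNIV"
    unfolding f_def by (rule integrable_restrict_UNIV[THEN iffD2])
  then have "f integrable_on cbox a b" for a b
    using integrable_on_subcbox by blast
  then obtain N where N: "negligible N"
    "\<And>x e. \<lbrakk>x \<notin> N; 0 < e\<rbrakk> \<Longrightarrow> \<exists>d>0. \<forall>h. 0 < h \<and> h < d \<longrightarrow>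
             norm (integral (cbox x (x + h *\<^sub>R One)) f /\<^sub>R h ^ DIM(real) - f x) < e"
    using integrable_ccontinuous_explicit[of f] by metis
  have *: "g x = 0" if x: "x \<in> Omega" "x \<notin> N" for x
  proof -
    have "\<bar>g x\<bar> < e" if e: "e > 0" for e
    proof -
      obtain d where d: "d > 0" "\<forall>h. 0 < h \<and> h < d \<longrightarrow>
             norm (integral (cbox x (x + h *\<^sub>R One)) f /\<^sub>R h ^ DIM(real) - f x) < e"
        using N(2)[OF x(2) e] by auto
      \<comment> \<open>Half of the smaller bound keeps the interval inside \<open>Omega\<close>.\<close>
      define h where "h = min d (1 - x) / 2"
      have h: "0 < h" "h < d" "x + h < 1" using d x by (auto simp: h_def min_def field_simps)
      have "integral {x..x+h} f = integral {x..x+h} g"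
        by (rule integral_cong) (use x h in \<open>auto simp: f_def\<close>)
      also have "\<dots> = 0" using zero x h by auto
      finally show ?thesis using d(2) h x by (auto simp: f_def)
    qed
    then show ?thesis by (metis abs_le_zero_iff less_irrefl not_le zero_less_abs_iff)
  qed
  have "N \<in> null_sets lebesgue" using N(1) by (simp add: negligible_iff_null_sets)
  then have "AE x in lebesgue. x \<notin> N" by (rule AE_not_in)
  then have "AE x in lebesgue. x \<in> Omega \<longrightarrow> g x = 0"
    by eventually_elim (use * in auto)
  then show ?thesis by (simp add: AE_restrict_space_iff)
qed

text \<open>The functions of the error analysis have bounded representatives. Unlike \<open>L2\<close>, this class is closed
under products, so every integral over a product of them exists.\<close>

definition bounded_meas :: "(real \<Rightarrow> real) set" where
  "bounded_meas = {f. f \<in> borel_measurable (lebesgue_on Omega) \<and> (\<exists>M. \<forall>x\<in>Omega. \<bar>f x\<bar> \<le> M)}"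

lemma bounded_meas_integrable:
  assumes "f \<in> bounded_meas"
  shows "integrable (lebesgue_on Omega) f"
proof -
  have "finite_measure (lebesgue_on Omega)"
    by (rule finite_measure_lebesgue_on) auto
  moreover obtain M where "\<forall>x\<in>Omega. \<bar>f x\<bar> \<le> M" using assms by (auto simp: bounded_meas_def)
  then have "AE x in lebesgue_on Omega. norm (f x) \<le> M" by (intro AE_I2) auto
  ultimately show ?thesis
    using assms by (intro finite_measure.integrable_const_bound) (auto simp: bounded_meas_def)
qed

lemma bounded_meas_const [simp]: "(\<lambda>x. k) \<in> bounded_meas"
  by (auto simp: bounded_meas_def)

lemma bounded_meas_add:
  assumes "f \<in> bounded_meas" "g \<in> bounded_meas"
  shows "(\<lambda>x. f x + g x) \<in> bounded_meas"
proof -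
  obtain M M' where "\<forall>x\<in>Omega. \<bar>f x\<bar> \<le> M" "\<forall>x\<in>Omega. \<bar>g x\<bar> \<le> M'"
    using assms by (auto simp: bounded_meas_def)
  then have "\<forall>x\<in>Omega. \<bar>f x + g x\<bar> \<le> M + M'"
    by (meson abs_triangle_ineq add_mono order_trans)
  then show ?thesis using assms by (auto simp: bounded_meas_def)
qed

lemma bounded_meas_mult:
  assumes "f \<in> bounded_meas" "g \<in> bounded_meas"
  shows "(\<lambda>x. f x * g x) \<in> bounded_meas"
proof -
  obtain M M' where "\<forall>x\<in>Omega. \<bar>f x\<bar> \<le> M" "\<forall>x\<in>Omega. \<bar>g x\<bar> \<le> M'"
    using assms by (auto simp: bounded_meas_def)
  then have "\<forall>x\<in>Omega. \<bar>f x * g x\<bar> \<le> M * M'"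
    unfolding abs_mult by (meson abs_ge_zero mult_mono order_trans)
  then show ?thesis using assms by (auto simp: bounded_meas_def)
qed

lemma bounded_meas_cmult: "f \<in> bounded_meas \<Longrightarrow> (\<lambda>x. k * f x) \<in> bounded_meas"
  by (rule bounded_meas_mult) auto

lemma bounded_meas_diff:
  assumes "f \<in> bounded_meas" "g \<in> bounded_meas"
  shows "(\<lambda>x. f x - g x) \<in> bounded_meas"
  using bounded_meas_add[OF assms(1) bounded_meas_cmult[OF assms(2), of "-1"]] by simp

lemma bounded_meas_continuous:
  assumes "continuous_on {0..1} f"
  shows "f \<in> bounded_meas"
proof -
  have "compact (f ` {0..1})" using assms by (intro compact_continuous_image) auto
  then obtain M where "\<forall>y\<in>f ` {0..1}. \<bar>y\<bar> \<le> M"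
    unfolding real_norm_def[symmetric] by (meson compact_imp_bounded bounded_iff)
  moreover have "f \<in> borel_measurable (lebesgue_on Omega)"
    by (rule continuous_imp_measurable_on_sets_lebesgue)
       (auto intro: continuous_on_subset[OF assms])
  ultimately show ?thesis by (auto simp: bounded_meas_def intro!: exI[of _ M])
qed

lemma bounded_meas_L2: "f \<in> bounded_meas \<Longrightarrow> f \<in> L2"
  unfolding L2_def power2_eq_square
  by (auto intro!: bounded_meas_integrable bounded_meas_mult) (simp add: bounded_meas_def)

lemmas bounded_meas_intros =
  bounded_meas_const bounded_meas_add bounded_meas_diff bounded_meas_mult

text \<open>Bumps converge boundedly to indicator functions, so by dominated convergence the integral over every interval vanishes.\<close>

lemma fundamental_lemma_L2:
  assumes g: "g \<in> L2" and ortho: "\<And>\<phi>. test_function \<phi> \<Longrightarrow> L2_inner g \<phi> = 0"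
  shows "AE x in lebesgue_on Omega. g x = 0"
proof (rule AE_zero_if_integrals_zero)
  have "(\<lambda>x. 1) \<in> L2" by (rule bounded_meas_L2) simp
  from L2_mult_integrable[OF g this]
  show int: "integrable (lebesgue_on Omega) g" by simp
  fix c d :: real assume cd: "0 < c" "c < d" "d < 1"
  let ?b = "\<lambda>n. bump c d (real (Suc n))"
  have lim: "(\<lambda>n. ?b n x) \<longlonglongrightarrow> indicator {c<..<d} x" for x
  proof (cases "c < x \<and> x < d")
    case True
    have "(\<lambda>n. exp (- (1 / (x - c) + 1 / (d - x)) / real (Suc n))) \<longlonglongrightarrow> exp 0"
      by (rule tendsto_exp[OF LIMSEQ_Suc[OF lim_const_over_n]])
    then show ?thesis using True by (simp add: bump_eq del: of_nat_Suc)
  qed (auto simp: bump_eq simp del: of_nat_Suc)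
  have meas: "?b n \<in> borel_measurable (lebesgue_on Omega)" for n
  proof -
    have "test_function (?b n)" using cd by (intro test_function_bump) auto
    then have "\<forall>x. ?b n field_differentiable at x"
      unfolding test_function_def by (metis funpow_0)
    then have "continuous_on {0..1} (?b n)"
      by (meson continuous_at_imp_continuous_on field_differentiable_imp_continuous_at)
    then show ?thesis using bounded_meas_continuous by (auto simp: bounded_meas_def)
  qed
  have "(\<lambda>n. \<integral>x. g x * ?b n x \<partial>lebesgue_on Omega) \<longlonglongrightarrow> (\<integral>x. g x * indicator {c<..<d} x \<partial>lebesgue_on Omega)"
  proof (rule integral_dominated_convergence[where w="\<lambda>x. \<bar>g x\<bar>"])
    have [measurable]: "g \<in> borel_measurable (lebesgue_on Omega)" using g by (simp add: L2_def)
    have [measurable]: "{c<..<d} \<in> sets lebesgue" by simp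
    have "indicat_real {c<..<d} \<in> borel_measurable (lebesgue_on Omega)"
      by (intro measurable_restrict_space1 borel_measurable_indicator) simp
    then show "(\<lambda>x. g x * indicator {c<..<d} x) \<in> borel_measurable (lebesgue_on Omega)"
      by measurable
    show "(\<lambda>x. g x * ?b n x) \<in> borel_measurable (lebesgue_on Omega)" for n
      using meas[of n] by measurable
    show "integrable (lebesgue_on Omega) (\<lambda>x. \<bar>g x\<bar>)" using int by auto
    show "AE x in lebesgue_on Omega. (\<lambda>n. g x * ?b n x) \<longlonglongrightarrow> g x * indicator {c<..<d} x"
      using lim by (intro AE_I2 tendsto_intros)
    have "\<bar>?b n x\<bar> \<le> 1" for n x
    proof -
      have "- (1 / (x - c) + 1 / (d - x)) / real (Suc n) \<le> 0" if "c < x" "x < d"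
      proof (rule divide_nonpos_nonneg)
        have "0 \<le> 1 / (x - c)" "0 \<le> 1 / (d - x)" using that by simp_all
        then show "- (1 / (x - c) + 1 / (d - x)) \<le> 0" by linarith
      qed simp
      then show ?thesis
        by (simp add: bump_eq del: of_nat_Suc)
    qed
    then show "AE x in lebesgue_on Omega. norm (g x * ?b n x) \<le> \<bar>g x\<bar>" for n
      by (intro AE_I2) (auto simp: abs_mult mult_left_le)
  qed
  moreover have "(\<integral>x. g x * ?b n x \<partial>lebesgue_on Omega) = 0" for n
    using ortho[OF test_function_bump, of c d "real (Suc n)"] cd by (simp add: L2_inner_def)
  ultimately have "(\<integral>x. g x * indicator {c<..<d} x \<partial>lebesgue_on Omega) = 0"
    by (simp add: LIMSEQ_const_iff)
  moreover have "integrable (lebesgue_on Omega) (\<lambda>x. g x * indicator {c<..<d} x)"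
  proof (rule Bochner_Integration.integrable_bound[OF int])
    have "indicat_real {c<..<d} \<in> borel_measurable (lebesgue_on Omega)"
      by (intro measurable_restrict_space1 borel_measurable_indicator) simp
    then show "(\<lambda>x. g x * indicator {c<..<d} x) \<in> borel_measurable (lebesgue_on Omega)"
      using g by (auto simp: L2_def)
  qed (auto simp: indicator_def)
  ultimately have "integral Omega (\<lambda>x. g x * indicator {c<..<d} x) = 0"
    using lebesgue_integral_eq_integral by force
  moreover have "(\<lambda>x. g x * indicator {c<..<d} x) = (\<lambda>x. if x \<in> {c<..<d} then g x else 0)"
    by (auto simp: indicator_def)
  ultimately have "integral Omega (\<lambda>x. if x \<in> {c<..<d} then g x else 0) = 0"
    by (simp only:)
  then have "integral (Omega \<inter> {c<..<d}) g = 0"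
    by (simp only: integral_restrict_Int Int_commute)
  moreover have "Omega \<inter> {c<..<d} = {c<..<d}" using cd by auto
  ultimately show "integral {c..d} g = 0"
    by (simp add: integral_open_interval_real)
qed

lemma L2_diff:
  assumes "f \<in> L2" "g \<in> L2"
  shows "(\<lambda>x. f x - g x) \<in> L2"
proof -
  have "(\<lambda>x. (f x - g x)\<^sup>2) = (\<lambda>x. (f x)\<^sup>2 + (g x)\<^sup>2 - 2 * (f x * g x))"
    by (auto simp: power2_diff algebra_simps)
  then show ?thesis
    using assms L2_mult_integrable[OF assms] by (auto simp: L2_def)
qed

lemma test_function_bounded_meas:
  assumes "test_function \<phi>"
  shows "(deriv ^^ k) \<phi> \<in> bounded_meas"
proof -
  have "\<forall>x. (deriv ^^ k) \<phi> field_differentiable at x"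
    using assms by (simp add: test_function_def)
  then show ?thesis
    by (meson bounded_meas_continuous continuous_at_imp_continuous_on field_differentiable_imp_continuous_at)
qed

lemma weak_deriv_unique:
  assumes "has_weak_deriv k w g" "has_weak_deriv k w h"
  shows "AE x in lebesgue_on Omega. g x = h x"
proof -
  have L: "g \<in> L2" "h \<in> L2" using assms by (auto simp: has_weak_deriv_def)
  have "AE x in lebesgue_on Omega. g x - h x = 0"
  proof (rule fundamental_lemma_L2)
    show "(\<lambda>x. g x - h x) \<in> L2" using L by (rule L2_diff)
    fix \<phi> assume \<phi>: "test_function \<phi>"
    then have \<phi>L: "\<phi> \<in> L2" using test_function_bounded_meas[OF \<phi>, of 0] bounded_meas_L2 by simp
    have "L2_inner (\<lambda>x. g x - h x) \<phi> = L2_inner g \<phi> - L2_inner h \<phi>"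
      unfolding L2_inner_def left_diff_distrib
      using L2_mult_integrable L \<phi>L by (intro Bochner_Integration.integral_diff) auto
    moreover have "(-1) ^ k * L2_inner g \<phi> = (-1) ^ k * L2_inner h \<phi>"
      using assms \<phi> unfolding has_weak_deriv_def by metis
    ultimately show "L2_inner (\<lambda>x. g x - h x) \<phi> = 0" by simp
  qed
  then show ?thesis by eventually_elim simp
qed

lemma weak_deriv_AE_eq:
  assumes "has_weak_deriv k w g"
  shows "AE x in lebesgue_on Omega. weak_deriv k w x = g x"
  using weak_deriv_unique[OF _ assms] someI[of "has_weak_deriv k w", OF assms]
  unfolding weak_deriv_def by blast

section \<open>Polynomial approximation on one interval\<close>

lemma discriminant_nonpos:
  fixes A B C :: real
  assumes "\<And>t. A + 2 * t * B + t\<^sup>2 * C \<ge> 0" "C \<ge> 0"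
  shows "B\<^sup>2 \<le> A * C"
proof (cases "C = 0")
  case True
  have "B = 0"
  proof (rule ccontr)
    assume "B \<noteq> 0"
    \<comment> \<open>At this \<open>t\<close> the left-hand side is \<open>-1\<close>.\<close>
    with assms(1)[of "- (A + 1) / (2 * B)"] True show False by (simp add: field_simps)
  qed
  then show ?thesis using True by simp
next
  case False
  then have C: "C > 0" using assms(2) by simp
  have "A + 2 * (- B / C) * B + (- B / C)\<^sup>2 * C = (A * C - B\<^sup>2) / C"
    using C by (simp add: field_simps power2_eq_square)
  \<comment> \<open>The minimiser of the quadratic polynomial.\<close>
  with assms(1)[of "- B / C"] C show ?thesis by (simp add: zero_le_divide_iff)
qed

lemma integral_Cauchy_Schwarz:
  fixes f g :: "real \<Rightarrow> real"
  assumes "(\<lambda>x. (f x)\<^sup>2) integrable_on S" "(\<lambda>x. f x * g x) integrable_on S"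
    "(\<lambda>x. (g x)\<^sup>2) integrable_on S"
  shows "(integral S (\<lambda>x. f x * g x))\<^sup>2 \<le> integral S (\<lambda>x. (f x)\<^sup>2) * integral S (\<lambda>x. (g x)\<^sup>2)"
proof (rule discriminant_nonpos)
  fix t :: real
  have "((\<lambda>x. (f x)\<^sup>2 + (2 * t) * (f x * g x) + t\<^sup>2 * (g x)\<^sup>2) has_integral
      (integral S (\<lambda>x. (f x)\<^sup>2) + (2 * t) * integral S (\<lambda>x. f x * g x) + t\<^sup>2 * integral S (\<lambda>x. (g x)\<^sup>2))) S"
    using assms by (intro has_integral_add has_integral_mult_right integrable_integral)
  moreover have "(f x)\<^sup>2 + (2 * t) * (f x * g x) + t\<^sup>2 * (g x)\<^sup>2 = (f x + t * g x)\<^sup>2" for x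
    by (simp add: power2_sum power_mult_distrib algebra_simps)
  ultimately show "integral S (\<lambda>x. (f x)\<^sup>2) + 2 * t * integral S (\<lambda>x. f x * g x) + t\<^sup>2 * integral S (\<lambda>x. (g x)\<^sup>2) \<ge> 0"
    by (metis (no_types, lifting) has_integral_nonneg zero_le_power2)
qed (auto intro!: integral_nonneg assms)

text \<open>Each point value of \<open>e\<close> is the integral of \<open>e'\<close> from the end where \<open>e\<close> vanishes; apply the Cauchy--Schwarz inequality.\<close>

lemma Poincare:
  fixes e e' :: "real \<Rightarrow> real"
  assumes ab: "a \<le> b" and e: "\<And>x. x \<in> {a..b} \<Longrightarrow> (e has_real_derivative e' x) (at x within {a..b})"
    and e': "continuous_on {a..b} e'" and "e a = 0"
  shows "integral {a..b} (\<lambda>x. (e x)\<^sup>2) \<le> (b - a)\<^sup>2 * integral {a..b} (\<lambda>x. (e' x)\<^sup>2)"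
proof -
  define I where "I = integral {a..b} (\<lambda>x. (e' x)\<^sup>2)"
  have int: "(\<lambda>x. (e' x)\<^sup>2) integrable_on {a..b}"
    by (intro integrable_continuous_real continuous_intros e')
  have I0: "I \<ge> 0" unfolding I_def by (rule integral_nonneg[OF int]) auto
  have le: "(e x)\<^sup>2 \<le> (b - a) * I" if x: "x \<in> {a..b}" for x
  proof -
    have sub: "{a..x} \<subseteq> {a..b}" using x by auto
    have "(e' has_integral (e x - e a)) {a..x}"
      using x by (intro fundamental_theorem_of_calculus)
        (auto simp: has_real_derivative_iff_has_vector_derivative[symmetric] intro!: DERIV_subset[OF e sub])
    then have "e x = integral {a..x} (\<lambda>t. e' t * 1)" using \<open>e a = 0\<close> by (simp add: integral_unique)
    also have "\<dots>\<^sup>2 \<le> integral {a..x} (\<lambda>x. (e' x)\<^sup>2) * integral {a..x} (\<lambda>x. 1\<^sup>2)"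
      by (intro integral_Cauchy_Schwarz integrable_continuous_real continuous_intros continuous_on_subset[OF e' sub])
    also have "\<dots> = (x - a) * integral {a..x} (\<lambda>x. (e' x)\<^sup>2)" using x by simp
    also have "\<dots> \<le> (b - a) * I"
    proof (rule mult_mono)
      show "integral {a..x} (\<lambda>x. (e' x)\<^sup>2) \<le> I"
        unfolding I_def by (rule integral_subset_le[OF sub _ int])
          (auto intro!: integrable_continuous_real continuous_intros continuous_on_subset[OF e' sub])
      show "0 \<le> integral {a..x} (\<lambda>x. (e' x)\<^sup>2)"
        by (auto intro!: integral_nonneg integrable_continuous_real continuous_intros continuous_on_subset[OF e' sub])
    qed (use x in auto)
    finally show ?thesis .
  qed
  have "continuous_on {a..b} e" using e DERIV_continuous_on by blast
  then have "integral {a..b} (\<lambda>x. (e x)\<^sup>2) \<le> integral {a..b} (\<lambda>x. (b - a) * I)"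
    by (intro integral_le integrable_continuous_real continuous_intros le)
  also have "\<dots> = (b - a)\<^sup>2 * I" using ab by (simp add: power2_eq_square)
  finally show ?thesis by (simp add: I_def)
qed

text \<open>The clause for \<open>r = 0\<close> is what keeps the degree bound of the Taylor polynomial sharp in \<open>poly_approximation\<close>.\<close>

lemma poly_antiderivative:
  fixes r :: "real poly"
  obtains R where "pderiv R = r" "degree R \<le> Suc (degree r)" "poly R a = c" "r = 0 \<Longrightarrow> degree R = 0"
proof -
  define R where "R = (\<Sum>i\<le>degree r. monom (coeff r i / real (Suc i)) (Suc i))"
  have "pderiv R = (\<Sum>i\<le>degree r. monom (coeff r i) i)"
    unfolding R_def by (simp add: higher_pderiv_sum[of "Suc 0", simplified] pderiv_monom del: of_nat_Suc)
  then have 1: "pderiv R = r" by (simp add: poly_as_sum_of_monoms)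
  have 2: "degree R \<le> Suc (degree r)"
    unfolding R_def by (intro degree_sum_le) (auto intro: order_trans[OF degree_monom_le])
  show ?thesis
  proof (rule that[of "R + [:c - poly R a:]"])
    show "pderiv (R + [:c - poly R a:]) = r" using 1 by (simp add: pderiv_add)
    show "degree (R + [:c - poly R a:]) \<le> Suc (degree r)" using 2 by (intro degree_add_le) auto
    show "degree (R + [:c - poly R a:]) = 0" if "r = 0"
      using that by (simp add: R_def)
  qed simp
qed

lemma integral_poly_affine:
  fixes P :: "real poly"
  assumes "a \<le> b"
  shows "integral {a..b} (poly P) = (b - a) * integral {0..1} (\<lambda>t. poly P (a + (b - a) * t))"
proof -
  obtain R where R: "pderiv R = P" using poly_antiderivative by metis
  have "(poly P has_integral (poly R b - poly R a)) {a..b}"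
    using assms R by (intro fundamental_theorem_of_calculus)
      (auto simp: has_real_derivative_iff_has_vector_derivative[symmetric] intro: has_field_derivative_at_within)
  moreover have "((\<lambda>t. (b - a) * poly P (a + (b - a) * t)) has_integral
      (poly R (a + (b - a) * 1) - poly R (a + (b - a) * 0))) {0..1}"
    using R by (intro fundamental_theorem_of_calculus)
      (auto simp: has_real_derivative_iff_has_vector_derivative[symmetric]
        intro!: derivative_eq_intros DERIV_chain2[OF poly_DERIV])
  ultimately show ?thesis by (simp add: integral_unique flip: integral_mult_right)
qed

lemma poly_square_integral_pos:
  fixes e :: "real poly"
  assumes "a < b" "e \<noteq> 0"
  shows "integral {a..b} (\<lambda>x. (poly e x)\<^sup>2) > 0"
proof (rule ccontr)
  assume neg: "\<not> ?thesis"
  have int: "(\<lambda>x. (poly e x)\<^sup>2) integrable_on {a..b}"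
    by (intro integrable_continuous_real continuous_intros)
  have "integral {a..b} (\<lambda>x. (poly e x)\<^sup>2) \<ge> 0" by (rule integral_nonneg[OF int]) auto
  with neg have "((\<lambda>x. (poly e x)\<^sup>2) has_integral 0) (cbox a b)"
    using int integrable_integral by fastforce
  then have "(poly e x)\<^sup>2 = 0" if "x \<in> {a..b}" for x
    using assms that by (intro has_integral_0_cbox_imp_0[of a b "\<lambda>x. (poly e x)\<^sup>2"]) (auto intro!: continuous_intros)
  then have "{a..b} \<subseteq> {x. poly e x = 0}" by auto
  then have "finite {a..b}" using poly_roots_finite[OF assms(2)] finite_subset by blast
  then show False using assms(1) infinite_Icc by blast
qed

lemma poly_cut_degree:
  fixes s e :: "real poly"
  assumes "degree s \<le> Suc n" "degree e \<le> Suc n" "coeff e (Suc n) = 1"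
  shows "degree (s - smult (coeff s (Suc n)) e) \<le> n"
proof (rule degree_le, safe)
  fix i assume i: "n < i"
  show "coeff (s - smult (coeff s (Suc n)) e) i = 0"
  proof (cases "i = Suc n")
    case False
    with i have "degree s < i" "degree e < i" using assms by auto
    then show ?thesis by (simp add: coeff_eq_0)
  qed (use assms in simp)
qed

text \<open>Gram--Schmidt: subtract from the next monomial its projection onto the polynomials of degree at most \<open>n\<close>.\<close>

lemma orthogonal_monic_step:
  fixes a b :: real
  assumes "a < b"
    and proj: "\<And>g. continuous_on {a..b} g \<Longrightarrow>
       \<exists>r::real poly. degree r \<le> n \<and> (\<forall>s. degree s \<le> n \<longrightarrow> integral {a..b} (\<lambda>x. (g x - poly r x) * poly s x) = 0)"
  shows "\<exists>e::real poly. degree e = Suc n \<and> coeff e (Suc n) = 1 \<and>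
    integral {a..b} (\<lambda>x. (poly e x)\<^sup>2) > 0 \<and>
    (\<forall>s. degree s \<le> n \<longrightarrow> integral {a..b} (\<lambda>x. poly e x * poly s x) = 0)"
proof -
  obtain m :: "real poly" where m: "degree m \<le> n"
    "\<And>s. degree s \<le> n \<Longrightarrow> integral {a..b} (\<lambda>x. (poly (monom 1 (Suc n)) x - poly m x) * poly s x) = 0"
    using proj[of "poly (monom 1 (Suc n))"] by (auto simp: continuous_on_poly)
  let ?e = "monom 1 (Suc n) - m"
  have c: "coeff ?e (Suc n) = 1" using m(1) by (simp add: coeff_eq_0)
  have "degree ?e \<le> Suc n" using m(1) by (intro degree_diff_le) (auto simp: degree_monom_le)
  moreover have "Suc n \<le> degree ?e" using c by (intro le_degree) simp
  moreover have "?e \<noteq> 0" using c by fastforce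
  ultimately have "degree ?e = Suc n" "integral {a..b} (\<lambda>x. (poly ?e x)\<^sup>2) > 0"
    using poly_square_integral_pos[OF assms(1)] le_antisym by blast+
  then show ?thesis
  proof (intro exI[of _ ?e] conjI allI impI)
    fix s :: "real poly" assume "degree s \<le> n"
    from m(2)[OF this] show "integral {a..b} (\<lambda>x. poly ?e x * poly s x) = 0" by (simp only: poly_diff)
  qed (use c in auto)
qed

text \<open>Induction on the degree: the projection onto degree \<open>n + 1\<close> adds the component along the monic polynomial of degree \<open>n + 1\<close>
that is orthogonal to all lower ones.\<close>

lemma poly_L2_projection:
  fixes a b :: real
  assumes ab: "a < b" and "continuous_on {a..b} g"
  shows "\<exists>r::real poly. degree r \<le> n \<and>
    (\<forall>s. degree s \<le> n \<longrightarrow> integral {a..b} (\<lambda>x. (g x - poly r x) * poly s x) = 0)"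
  using assms(2)
proof (induction n arbitrary: g)
  case 0
  let ?r = "[:integral {a..b} g / (b - a):]"
  have "integral {a..b} (\<lambda>x. (g x - poly ?r x) * poly s x) = 0" if "degree s \<le> 0" for s
  proof -
    from that have "degree s = 0" by simp
    then obtain c where s: "s = [:c:]" by (rule degree_eq_zeroE)
    have "integral {a..b} (\<lambda>x. (g x - poly ?r x) * c) = (integral {a..b} g - integral {a..b} (\<lambda>x. integral {a..b} g / (b - a))) * c"
      using 0 by (simp add: Henstock_Kurzweil_Integration.integral_diff integrable_continuous_real)
    also have "\<dots> = 0" using ab by simp
    finally show ?thesis using s by simp
  qed
  then show ?case by (intro exI[of _ ?r]) auto
next
  case (Suc n)
  obtain r where r: "degree r \<le> n"
    "\<And>s. degree s \<le> n \<Longrightarrow> integral {a..b} (\<lambda>x. (g x - poly r x) * poly s x) = 0"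
    using Suc.IH[OF Suc.prems] by auto
  obtain e :: "real poly" where e: "degree e = Suc n" "coeff e (Suc n) = 1"
    "integral {a..b} (\<lambda>x. (poly e x)\<^sup>2) > 0"
    "\<And>s. degree s \<le> n \<Longrightarrow> integral {a..b} (\<lambda>x. poly e x * poly s x) = 0"
    using orthogonal_monic_step[OF ab Suc.IH] by blast
  define k where "k = integral {a..b} (\<lambda>x. (g x - poly r x) * poly e x) / integral {a..b} (\<lambda>x. (poly e x)\<^sup>2)"
  let ?r = "r + smult k e"
  have "integral {a..b} (\<lambda>x. (g x - poly ?r x) * poly s x) = 0" if s: "degree s \<le> Suc n" for s
  proof -
    define s0 where "s0 = s - smult (coeff s (Suc n)) e"
    have s0: "degree s0 \<le> n" unfolding s0_def using poly_cut_degree s e by simp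
    let ?c = "coeff s (Suc n)"
    have cont: "continuous_on {a..b} (\<lambda>x. g x - poly r x)" using Suc.prems by (intro continuous_intros)
    have eq: "(g x - poly ?r x) * poly s x = ((g x - poly r x) * poly s0 x - k * (poly e x * poly s0 x))
        + ?c * ((g x - poly r x) * poly e x - k * (poly e x)\<^sup>2)" for x
      by (simp add: s0_def algebra_simps power2_eq_square)
    have "((\<lambda>x. (g x - poly ?r x) * poly s x) has_integral
      ((integral {a..b} (\<lambda>x. (g x - poly r x) * poly s0 x) - k * integral {a..b} (\<lambda>x. poly e x * poly s0 x))
        + ?c * (integral {a..b} (\<lambda>x. (g x - poly r x) * poly e x) - k * integral {a..b} (\<lambda>x. (poly e x)\<^sup>2)))) {a..b}"
      unfolding eq
      by (intro has_integral_add has_integral_diff has_integral_mult_right integrable_integral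
          integrable_continuous_real continuous_intros Suc.prems)
    then have "integral {a..b} (\<lambda>x. (g x - poly ?r x) * poly s x) =
       ((integral {a..b} (\<lambda>x. (g x - poly r x) * poly s0 x) - k * integral {a..b} (\<lambda>x. poly e x * poly s0 x))
        + ?c * (integral {a..b} (\<lambda>x. (g x - poly r x) * poly e x) - k * integral {a..b} (\<lambda>x. (poly e x)\<^sup>2)))"
      by (rule integral_unique)
    also have "\<dots> = 0" using r(2)[OF s0] e(4)[OF s0] e(3) by (simp add: k_def)
    finally show ?thesis .
  qed
  moreover have "degree ?r \<le> Suc n" using r e by (intro degree_add_le) auto
  ultimately show ?case by blast
qed

text \<open>\<open>G k\<close> is the \<open>k\<close>-th derivative of \<open>G 0\<close>, one-sided at the end points.\<close>

definition deriv_chain :: "real \<Rightarrow> real \<Rightarrow> nat \<Rightarrow> (nat \<Rightarrow> real \<Rightarrow> real) \<Rightarrow> bool" where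
  "deriv_chain a b m G \<longleftrightarrow>
    (\<forall>k<m. \<forall>x\<in>{a..b}. (G k has_real_derivative G (Suc k) x) (at x within {a..b})) \<and>
    (\<forall>k\<le>m. continuous_on {a..b} (G k))"

text \<open>The Taylor polynomial at the left end. Its error and all derivatives of the error below order \<open>m\<close> vanish there, so the Poincare
inequality applies \<open>m\<close> times; no constant other than a power of the length appears.\<close>

lemma poly_approximation:
  assumes "a \<le> b" "deriv_chain a b m G"
  shows "\<exists>r::real poly. degree r \<le> m - 1 \<and> (m = 0 \<longrightarrow> r = 0) \<and>
    integral {a..b} (\<lambda>x. (G 0 x - poly r x)\<^sup>2) \<le> ((b - a) ^ m)\<^sup>2 * integral {a..b} (\<lambda>x. (G m x)\<^sup>2)"
  using assms(2)
proof (induction m arbitrary: G)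
  case (Suc m)
  have "deriv_chain a b m (\<lambda>k. G (Suc k))"
    using Suc.prems by (auto simp: deriv_chain_def)
  from Suc.IH[OF this] obtain r where r: "degree r \<le> m - 1" "m = 0 \<longrightarrow> r = 0"
    "integral {a..b} (\<lambda>x. (G (Suc 0) x - poly r x)\<^sup>2) \<le> ((b - a) ^ m)\<^sup>2 * integral {a..b} (\<lambda>x. (G (Suc m) x)\<^sup>2)"
    by auto
  obtain R where R: "pderiv R = r" "degree R \<le> Suc (degree r)" "poly R a = G 0 a" "r = 0 \<Longrightarrow> degree R = 0"
    using poly_antiderivative by metis
  have "integral {a..b} (\<lambda>x. (G 0 x - poly R x)\<^sup>2) \<le> (b - a)\<^sup>2 * integral {a..b} (\<lambda>x. (G (Suc 0) x - poly r x)\<^sup>2)"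
  proof (rule Poincare[OF assms(1)])
    show "((\<lambda>x. G 0 x - poly R x) has_real_derivative (G (Suc 0) x - poly r x)) (at x within {a..b})" if "x \<in> {a..b}" for x
      using Suc.prems that R(1)[symmetric]
      by (auto simp: deriv_chain_def intro!: DERIV_diff has_field_derivative_at_within[OF poly_DERIV])
    show "continuous_on {a..b} (\<lambda>x. G (Suc 0) x - poly r x)"
      using Suc.prems by (auto simp: deriv_chain_def intro!: continuous_intros)
  qed (simp add: R)
  also have "\<dots> \<le> (b - a)\<^sup>2 * (((b - a) ^ m)\<^sup>2 * integral {a..b} (\<lambda>x. (G (Suc m) x)\<^sup>2))"
    by (rule mult_left_mono[OF r(3)]) auto
  finally have "integral {a..b} (\<lambda>x. (G 0 x - poly R x)\<^sup>2) \<le> ((b - a) ^ Suc m)\<^sup>2 * integral {a..b} (\<lambda>x. (G (Suc m) x)\<^sup>2)"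
    by (simp add: power_mult_distrib mult.assoc)
  moreover have "degree R \<le> Suc m - 1"
    using r R by (cases m) auto
  ultimately show ?case by (intro exI[of _ R]) auto
qed (auto intro: exI[of _ 0])

text \<open>The moment condition on the second derivative is the property that the interpolation
is designed for: it removes the error in the second derivative from the energy argument.\<close>

definition local_interpolant :: "nat \<Rightarrow> real \<Rightarrow> real \<Rightarrow> (nat \<Rightarrow> real \<Rightarrow> real) \<Rightarrow> real poly \<Rightarrow> bool" where
  "local_interpolant p a b G q \<longleftrightarrow> degree q \<le> p \<and>
    (\<forall>y\<in>{a, b}. poly q y = G 0 y \<and> poly (pderiv q) y = G 1 y) \<and>
    (\<forall>s. degree s \<le> p - 2 \<longrightarrow>
       integral {a..b} (\<lambda>x. (G 2 x - poly (pderiv (pderiv q)) x) * poly s x) = 0) \<and>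
    integral {a..b} (\<lambda>x. (G 0 x - poly q x)\<^sup>2) \<le> ((b - a) ^ (p + 1))\<^sup>2 * integral {a..b} (\<lambda>x. (G (p + 1) x)\<^sup>2)"

text \<open>Integrate the projection \<open>r\<close> of \<open>G 2\<close> twice, with the values of \<open>G 1\<close> and \<open>G 0\<close> at the left end. Orthogonality of \<open>G 2 - r\<close>
to \<open>1\<close> and to \<open>b - x\<close> gives the matching slope and value at the right end; both test functions are admissible
because \<open>p \<ge> 3\<close>. The error estimate uses the Poincare inequality twice and the best approximation
property of \<open>r\<close> against a Taylor polynomial.\<close>

lemma hermite_moment_interpolant:
  assumes ab: "a < b" and p: "p \<ge> 3" and G: "deriv_chain a b (p + 1) G"
  shows "\<exists>q. local_interpolant p a b G q"
proof -
  have cG: "continuous_on {a..b} (G k)" if "k \<le> p + 1" for k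
    using G that by (auto simp: deriv_chain_def)
  have dG: "(G k has_real_derivative G (Suc k) x) (at x within {a..b})" if "k \<le> p" "x \<in> {a..b}" for k x
    using G that by (auto simp: deriv_chain_def)
  have cG2: "continuous_on {a..b} (G 2)" using p by (intro cG) auto
  obtain r where r: "degree r \<le> p - 2"
    "\<And>s. degree s \<le> p - 2 \<Longrightarrow> integral {a..b} (\<lambda>x. (G 2 x - poly r x) * poly s x) = 0"
    using poly_L2_projection[OF ab cG2] by blast
  obtain R where R: "pderiv R = r" "degree R \<le> Suc (degree r)" "poly R a = G 1 a"
    using poly_antiderivative by metis
  obtain q where q: "pderiv q = R" "degree q \<le> Suc (degree R)" "poly q a = G 0 a"
    using poly_antiderivative by metis
  have dq: "(poly q has_real_derivative poly R x) (at x within {a..b})" for x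
    using q(1) by (metis has_field_derivative_at_within poly_DERIV)
  have dR: "(poly R has_real_derivative poly r x) (at x within {a..b})" for x
    using R(1) by (metis has_field_derivative_at_within poly_DERIV)
  have d0: "((\<lambda>x. G 0 x - poly q x) has_real_derivative (G 1 x - poly R x)) (at x within {a..b})"
    if "x \<in> {a..b}" for x using dG[of 0] that dq by (auto intro!: DERIV_diff)
  have d1: "((\<lambda>x. G 1 x - poly R x) has_real_derivative (G 2 x - poly r x)) (at x within {a..b})"
    if "x \<in> {a..b}" for x using dG[of 1] that dR p by (auto intro!: DERIV_diff simp: numeral_2_eq_2)
  have "((\<lambda>x. G 2 x - poly r x) has_integral ((G 1 b - poly R b) - (G 1 a - poly R a))) {a..b}"
    using ab d1 by (intro fundamental_theorem_of_calculus)
       (auto simp: has_real_derivative_iff_has_vector_derivative[symmetric])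
  moreover have "integral {a..b} (\<lambda>x. (G 2 x - poly r x) * poly 1 x) = 0" by (rule r(2)) simp
  ultimately have Rb: "poly R b = G 1 b" using R(3) by (simp add: integral_unique)
  \<comment> \<open>An antiderivative of \<open>(G 2 - r)(b - x)\<close>.\<close>
  have dH: "((\<lambda>x. (G 1 x - poly R x) * (b - x) + (G 0 x - poly q x)) has_real_derivative
      ((G 2 x - poly r x) * (b - x) + (-1) * (G 1 x - poly R x)) + (G 1 x - poly R x)) (at x within {a..b})"
    if "x \<in> {a..b}" for x
    by (intro DERIV_add DERIV_mult d1 d0 that) (auto intro!: derivative_eq_intros)
  have "((\<lambda>x. (G 2 x - poly r x) * poly [:b, -1:] x) has_integral
     (((G 1 b - poly R b) * (b - b) + (G 0 b - poly q b)) - ((G 1 a - poly R a) * (b - a) + (G 0 a - poly q a)))) {a..b}"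
    using ab by (intro fundamental_theorem_of_calculus)
       (use dH in \<open>auto simp: has_real_derivative_iff_has_vector_derivative[symmetric]\<close>)
  moreover have "integral {a..b} (\<lambda>x. (G 2 x - poly r x) * poly [:b, -1:] x) = 0"
    by (rule r(2)) (use p in auto)
  ultimately have qb: "poly q b = G 0 b" using R(3) q(3) by (simp add: integral_unique)
  have "deriv_chain a b (p - 1) (\<lambda>k. G (k + 2))"
    using G p by (auto simp: deriv_chain_def)
  from poly_approximation[OF less_imp_le[OF ab] this] obtain t :: "real poly" where
    t: "degree t \<le> p - 2" "integral {a..b} (\<lambda>x. (G 2 x - poly t x)\<^sup>2) \<le>
        ((b - a) ^ (p - 1))\<^sup>2 * integral {a..b} (\<lambda>x. (G (p + 1) x)\<^sup>2)"
    using p by (auto simp: numeral_2_eq_2 eval_nat_numeral)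
  have best: "integral {a..b} (\<lambda>x. (G 2 x - poly r x)\<^sup>2) \<le> integral {a..b} (\<lambda>x. (G 2 x - poly t x)\<^sup>2)"
  proof -
    have dt: "degree (r - t) \<le> p - 2" using r(1) t(1) by (intro degree_diff_le)
    have eq: "(G 2 x - poly t x)\<^sup>2 = (G 2 x - poly r x)\<^sup>2 + 2 * ((G 2 x - poly r x) * poly (r - t) x) + (poly (r - t) x)\<^sup>2" for x
      by (simp add: power2_eq_square algebra_simps)
    have "((\<lambda>x. (G 2 x - poly t x)\<^sup>2) has_integral
      (integral {a..b} (\<lambda>x. (G 2 x - poly r x)\<^sup>2) + 2 * integral {a..b} (\<lambda>x. (G 2 x - poly r x) * poly (r - t) x)
       + integral {a..b} (\<lambda>x. (poly (r - t) x)\<^sup>2))) {a..b}"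
      unfolding eq by (intro has_integral_add has_integral_mult_right integrable_integral
          integrable_continuous_real continuous_intros cG2)
    moreover have "integral {a..b} (\<lambda>x. (poly (r - t) x)\<^sup>2) \<ge> 0"
      by (intro integral_nonneg integrable_continuous_real continuous_intros) auto
    ultimately show ?thesis using r(2)[OF dt] by (simp add: integral_unique)
  qed
  have "integral {a..b} (\<lambda>x. (G 0 x - poly q x)\<^sup>2) \<le> (b - a)\<^sup>2 * integral {a..b} (\<lambda>x. (G 1 x - poly R x)\<^sup>2)"
    using ab p by (intro Poincare d0 continuous_intros cG) (auto simp: q)
  also have "\<dots> \<le> (b - a)\<^sup>2 * ((b - a)\<^sup>2 * integral {a..b} (\<lambda>x. (G 2 x - poly r x)\<^sup>2))"
    using ab p by (intro mult_left_mono Poincare d1 continuous_intros cG2) (auto simp: R)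
  also have "\<dots> \<le> (b - a)\<^sup>2 * ((b - a)\<^sup>2 * (((b - a) ^ (p - 1))\<^sup>2 * integral {a..b} (\<lambda>x. (G (p + 1) x)\<^sup>2)))"
    using order_trans[OF best t(2)] by (intro mult_left_mono) auto
  also have "\<dots> = ((b - a) ^ (p + 1))\<^sup>2 * integral {a..b} (\<lambda>x. (G (p + 1) x)\<^sup>2)"
  proof -
    have "(b - a)\<^sup>2 * (b - a) ^ (p - 1) = (b - a) ^ (p + 1)"
      using p by (simp flip: power_add)
    then have "((b - a) ^ (p + 1))\<^sup>2 = ((b - a)\<^sup>2)\<^sup>2 * ((b - a) ^ (p - 1))\<^sup>2"
      by (metis power_mult_distrib)
    then show ?thesis by (simp only: power2_eq_square mult.assoc)
  qed
  finally have est: "integral {a..b} (\<lambda>x. (G 0 x - poly q x)\<^sup>2) \<le> ((b - a) ^ (p + 1))\<^sup>2 * integral {a..b} (\<lambda>x. (G (p + 1) x)\<^sup>2)" .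
  have "degree q \<le> p" using q(2) R(2) r(1) p by linarith
  then have "local_interpolant p a b G q"
    unfolding local_interpolant_def using est q R Rb qb r(2) by auto
  then show ?thesis ..
qed

text \<open>Induction on the degree. Split off the orthogonal monic polynomial of top degree: both summands are then bounded by the norm of
the whole polynomial, by Pythagoras.\<close>

lemma inverse_inequality_unit:
  "\<exists>C\<ge>0. \<forall>q::real poly. degree q \<le> n \<longrightarrow>
     integral {0..1} (\<lambda>x. (poly (pderiv (pderiv q)) x)\<^sup>2) \<le> C * integral {0..1} (\<lambda>x. (poly q x)\<^sup>2)"
proof (induction n)
  case 0
  have "pderiv (pderiv q) = 0" if "degree q \<le> 0" for q :: "real poly"
    using that by (metis degree_eq_zeroE le_zero_eq pderiv_0 pderiv_singleton)
  then show ?case by (intro exI[of _ 0]) auto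
next
  case (Suc n)
  then obtain C where C: "C \<ge> 0" "\<And>q::real poly. degree q \<le> n \<Longrightarrow>
     integral {0..1} (\<lambda>x. (poly (pderiv (pderiv q)) x)\<^sup>2) \<le> C * integral {0..1} (\<lambda>x. (poly q x)\<^sup>2)"
    by auto
  obtain e :: "real poly" where e: "degree e = Suc n" "coeff e (Suc n) = 1"
    "integral {0..1} (\<lambda>x. (poly e x)\<^sup>2) > 0"
    "\<And>s. degree s \<le> n \<Longrightarrow> integral {0..1} (\<lambda>x. poly e x * poly s x) = 0"
    using orthogonal_monic_step[OF _ poly_L2_projection, of 0 1] by auto
  define A where "A = integral {0..1} (\<lambda>x. (poly e x)\<^sup>2)"
  define B where "B = integral {0..1} (\<lambda>x. (poly (pderiv (pderiv e)) x)\<^sup>2)"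
  have B0: "B \<ge> 0" unfolding B_def
    by (intro integral_nonneg integrable_continuous_real continuous_intros) auto
  let ?C = "2 * C + 2 * (B / A)"
  have A0: "A > 0" using e by (simp add: A_def)
  have "integral {0..1} (\<lambda>x. (poly (pderiv (pderiv q)) x)\<^sup>2) \<le> ?C * integral {0..1} (\<lambda>x. (poly q x)\<^sup>2)"
    if q: "degree q \<le> Suc n" for q :: "real poly"
  proof -
    define c where "c = coeff q (Suc n)"
    define s where "s = q - smult c e"
    have s: "degree s \<le> n" unfolding s_def c_def using poly_cut_degree q e by simp
    have q_eq: "q = s + smult c e" by (simp add: s_def)
    define S where "S = integral {0..1} (\<lambda>x. (poly s x)\<^sup>2)"
    have S0: "S \<ge> 0" unfolding S_def
      by (intro integral_nonneg integrable_continuous_real continuous_intros) auto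
    have "((\<lambda>x. (poly s x)\<^sup>2 + (2 * c) * (poly e x * poly s x) + c\<^sup>2 * (poly e x)\<^sup>2) has_integral
        (S + (2 * c) * integral {0..1} (\<lambda>x. poly e x * poly s x) + c\<^sup>2 * A)) {0..1}"
      unfolding S_def A_def
      by (intro has_integral_add has_integral_mult_right integrable_integral
          integrable_continuous_real continuous_intros)
    moreover have "(\<lambda>x. (poly q x)\<^sup>2) = (\<lambda>x. (poly s x)\<^sup>2 + (2 * c) * (poly e x * poly s x) + c\<^sup>2 * (poly e x)\<^sup>2)"
      by (auto simp: q_eq power2_eq_square algebra_simps)
    ultimately have Q: "integral {0..1} (\<lambda>x. (poly q x)\<^sup>2) = S + c\<^sup>2 * A"
      using e(4)[OF s] by (simp add: integral_unique)
    have "integral {0..1} (\<lambda>x. (poly (pderiv (pderiv q)) x)\<^sup>2) \<le>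
      integral {0..1} (\<lambda>x. 2 * (poly (pderiv (pderiv s)) x)\<^sup>2 + (2 * c\<^sup>2) * (poly (pderiv (pderiv e)) x)\<^sup>2)"
    proof (intro integral_le integrable_continuous_real continuous_intros)
      fix x
      have "(u + c * v)\<^sup>2 \<le> 2 * u\<^sup>2 + (2 * c\<^sup>2) * v\<^sup>2" for u v :: real
        using zero_le_power2[of "u - c * v"] by (simp add: power2_eq_square algebra_simps)
      then show "(poly (pderiv (pderiv q)) x)\<^sup>2 \<le> 2 * (poly (pderiv (pderiv s)) x)\<^sup>2 + (2 * c\<^sup>2) * (poly (pderiv (pderiv e)) x)\<^sup>2"
        by (simp add: q_eq pderiv_add pderiv_smult)
    qed
    also have "\<dots> = 2 * integral {0..1} (\<lambda>x. (poly (pderiv (pderiv s)) x)\<^sup>2) + (2 * c\<^sup>2) * B"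
      unfolding B_def
      by (intro integral_unique has_integral_add has_integral_mult_right integrable_integral
          integrable_continuous_real continuous_intros)
    also have "\<dots> \<le> 2 * (C * S) + (2 * c\<^sup>2) * B"
      using C(2)[OF s] by (simp add: S_def)
    also have "\<dots> \<le> ?C * (S + c\<^sup>2 * A)"
    proof -
      have "?C * (S + c\<^sup>2 * A) = 2 * (C * S) + (2 * c\<^sup>2) * B + (2 * C * (c\<^sup>2 * A) + 2 * (B / A) * S)"
        using A0 by (simp add: field_simps)
      moreover have "2 * C * (c\<^sup>2 * A) + 2 * (B / A) * S \<ge> 0"
        using C(1) A0 B0 S0 by auto
      ultimately show ?thesis by linarith
    qed
    finally show ?thesis by (simp add: Q)
  qed
  then show ?case using C(1) A0 B0 by (intro exI[of _ ?C]) auto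
qed

text \<open>The fourth power of the length is the scaling of the squared second derivative, so one constant serves all intervals.\<close>

definition inverse_constant :: "nat \<Rightarrow> real \<Rightarrow> bool" where
  "inverse_constant n C \<longleftrightarrow> C \<ge> 0 \<and> (\<forall>(q::real poly) a b. degree q \<le> n \<and> a < b \<longrightarrow>
     (b - a) ^ 4 * integral {a..b} (\<lambda>x. (poly (pderiv (pderiv q)) x)\<^sup>2) \<le> C * integral {a..b} (\<lambda>x. (poly q x)\<^sup>2))"

lemma inverse_inequality: "\<exists>C. inverse_constant n C"
proof -
  obtain C where C: "C \<ge> 0" "\<And>q::real poly. degree q \<le> n \<Longrightarrow>
     integral {0..1} (\<lambda>x. (poly (pderiv (pderiv q)) x)\<^sup>2) \<le> C * integral {0..1} (\<lambda>x. (poly q x)\<^sup>2)"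
    using inverse_inequality_unit by blast
  have "(b - a) ^ 4 * integral {a..b} (\<lambda>x. (poly (pderiv (pderiv q)) x)\<^sup>2) \<le> C * integral {a..b} (\<lambda>x. (poly q x)\<^sup>2)"
    if q: "degree q \<le> n" and ab: "a < b" for q :: "real poly" and a b
  proof -
    let ?h = "b - a"
    define Q where "Q = pcompose q [:a, ?h:]"
    have Q: "degree Q \<le> n" using q ab by (simp add: Q_def degree_pcompose)
    have Qx: "poly Q t = poly q (a + ?h * t)" for t by (simp add: Q_def poly_pcompose mult.commute)
    have Q2: "poly (pderiv (pderiv Q)) t = ?h\<^sup>2 * poly (pderiv (pderiv q)) (a + ?h * t)" for t
      by (simp add: Q_def pderiv_pcompose pderiv_smult pderiv_mult pderiv_pCons poly_pcompose power2_eq_square mult_ac)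
    have scale: "integral {a..b} (\<lambda>x. (poly P x)\<^sup>2) = ?h * integral {0..1} (\<lambda>t. (poly P (a + ?h * t))\<^sup>2)" for P :: "real poly"
    proof -
      have "poly (P\<^sup>2) = (\<lambda>x. (poly P x)\<^sup>2)" by (simp add: fun_eq_iff poly_power)
      then show ?thesis using integral_poly_affine[of a b "P\<^sup>2"] ab by simp
    qed
    have "?h ^ 4 * integral {a..b} (\<lambda>x. (poly (pderiv (pderiv q)) x)\<^sup>2) = ?h * integral {0..1} (\<lambda>x. (poly (pderiv (pderiv Q)) x)\<^sup>2)"
      by (simp add: scale Q2 power_mult_distrib mult.left_commute flip: power_mult integral_mult_right)
    also have "\<dots> \<le> ?h * (C * integral {0..1} (\<lambda>x. (poly Q x)\<^sup>2))"
      using C(2)[OF Q] ab by (intro mult_left_mono) auto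
    also have "\<dots> = C * integral {a..b} (\<lambda>x. (poly q x)\<^sup>2)"
      by (simp add: scale Qx)
    finally show ?thesis .
  qed
  then show ?thesis using C(1) unfolding inverse_constant_def by blast
qed

section \<open>The inner product on bounded functions and Green's identity\<close>

lemma bounded_meas_integrable_on:
  assumes "f \<in> bounded_meas" "0 \<le> a" "b \<le> 1"
  shows "f integrable_on {a..b}"
proof -
  have "f integrable_on Omega"
    using bounded_meas_integrable[OF assms(1)] by (simp add: integrable_on_lebesgue_on)
  then have "f integrable_on {0..1}" by (simp add: integrable_on_Icc_iff_Ioo)
  then show ?thesis using assms by (meson atLeastatMost_subset_iff integrable_subinterval_real)
qed

text \<open>Estimates on elements are carried out with the integral over closed intervals: it splits at the nodes, and its
fundamental theorem of calculus tolerates the nodes as exceptional points.\<close>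

lemma integral_bounded_meas:
  assumes "f \<in> bounded_meas"
  shows "(\<integral>x. f x \<partial>lebesgue_on Omega) = integral {0..1} f"
  using lebesgue_integral_eq_integral[OF bounded_meas_integrable[OF assms]]
  by (simp add: integral_open_interval_real)

lemma L2_inner_eq_integral:
  "f \<in> bounded_meas \<Longrightarrow> g \<in> bounded_meas \<Longrightarrow> L2_inner f g = integral {0..1} (\<lambda>x. f x * g x)"
  unfolding L2_inner_def by (intro integral_bounded_meas bounded_meas_mult)

lemma L2_inner_cong_AE:
  assumes "AE x in lebesgue_on Omega. f x = f' x" "AE x in lebesgue_on Omega. g x = g' x"
    and "f \<in> L2 \<or> f \<in> bounded_meas" "g \<in> L2 \<or> g \<in> bounded_meas"
    "f' \<in> L2 \<or> f' \<in> bounded_meas" "g' \<in> L2 \<or> g' \<in> bounded_meas"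
  shows "L2_inner f g = L2_inner f' g'"
  unfolding L2_inner_def
proof (rule integral_cong_AE)
  have "f \<in> L2" "g \<in> L2" "f' \<in> L2" "g' \<in> L2" using assms bounded_meas_L2 by auto
  then show "(\<lambda>x. f x * g x) \<in> borel_measurable (lebesgue_on Omega)"
    "(\<lambda>x. f' x * g' x) \<in> borel_measurable (lebesgue_on Omega)"
    using L2_mult_integrable borel_measurable_integrable by blast+
  show "AE x in lebesgue_on Omega. f x * g x = f' x * g' x"
    using assms(1,2) by eventually_elim simp
qed

lemma L2_inner_commute: "L2_inner f g = L2_inner g f"
  by (simp add: L2_inner_def mult.commute)

lemma L2_inner_add_left:
  assumes "f \<in> bounded_meas" "g \<in> bounded_meas" "h \<in> bounded_meas"
  shows "L2_inner (\<lambda>x. f x + g x) h = L2_inner f h + L2_inner g h"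
  unfolding L2_inner_def distrib_right
  by (intro Bochner_Integration.integral_add bounded_meas_integrable bounded_meas_mult assms)

lemma L2_inner_diff_left:
  assumes "f \<in> bounded_meas" "g \<in> bounded_meas" "h \<in> bounded_meas"
  shows "L2_inner (\<lambda>x. f x - g x) h = L2_inner f h - L2_inner g h"
  unfolding L2_inner_def left_diff_distrib
  by (intro Bochner_Integration.integral_diff bounded_meas_integrable bounded_meas_mult assms)

lemma L2_inner_cmult_left: "L2_inner (\<lambda>x. k * f x) h = k * L2_inner f h"
  by (simp add: L2_inner_def mult.assoc)

lemma L2_inner_cmult_right: "L2_inner h (\<lambda>x. k * f x) = k * L2_inner h f"
  by (simp add: L2_inner_def mult.left_commute)

lemma L2_inner_add_right:
  assumes "f \<in> bounded_meas" "g \<in> bounded_meas" "h \<in> bounded_meas"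
  shows "L2_inner h (\<lambda>x. f x + g x) = L2_inner h f + L2_inner h g"
  using L2_inner_add_left[OF assms] by (simp add: L2_inner_commute)

lemma L2_inner_diff_right:
  assumes "f \<in> bounded_meas" "g \<in> bounded_meas" "h \<in> bounded_meas"
  shows "L2_inner h (\<lambda>x. f x - g x) = L2_inner h f - L2_inner h g"
  using L2_inner_diff_left[OF assms] by (simp add: L2_inner_commute)

lemmas L2_inner_linear = L2_inner_add_left L2_inner_diff_left L2_inner_cmult_left
  L2_inner_add_right L2_inner_diff_right L2_inner_cmult_right

lemma L2_inner_self_nonneg: "L2_inner f f \<ge> 0"
  by (simp add: L2_inner_def)

lemma L2_norm_nonneg: "L2_norm f \<ge> 0"
  by (simp add: L2_norm_def L2_inner_self_nonneg)

lemma L2_norm_square: "(L2_norm f)\<^sup>2 = L2_inner f f"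
  by (simp add: L2_norm_def L2_inner_self_nonneg)

lemma L2_Cauchy_Schwarz:
  assumes "f \<in> bounded_meas" "g \<in> bounded_meas"
  shows "\<bar>L2_inner f g\<bar> \<le> L2_norm f * L2_norm g"
proof -
  have "(L2_inner f g)\<^sup>2 \<le> L2_inner f f * L2_inner g g"
  proof (rule discriminant_nonpos)
    fix t
    have "L2_inner (\<lambda>x. f x + t * g x) (\<lambda>x. f x + t * g x) =
       L2_inner f f + 2 * t * L2_inner f g + t\<^sup>2 * L2_inner g g"
      using assms by (simp add: L2_inner_linear bounded_meas_intros bounded_meas_cmult
          L2_inner_commute[of g f] power2_eq_square algebra_simps)
    then show "L2_inner f f + 2 * t * L2_inner f g + t\<^sup>2 * L2_inner g g \<ge> 0"
      by (metis L2_inner_self_nonneg)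
  qed (rule L2_inner_self_nonneg)
  then have "(L2_inner f g)\<^sup>2 \<le> (L2_norm f * L2_norm g)\<^sup>2"
    by (simp add: power_mult_distrib L2_norm_square)
  then show ?thesis
    by (intro abs_le_square_iff[THEN iffD2, of _ "L2_norm f * L2_norm g", simplified abs_mult abs_of_nonneg[OF L2_norm_nonneg]])
qed

lemma L2_norm_triangle:
  assumes "f \<in> bounded_meas" "g \<in> bounded_meas"
  shows "L2_norm (\<lambda>x. f x + g x) \<le> L2_norm f + L2_norm g"
proof (rule power2_le_imp_le)
  have "(L2_norm (\<lambda>x. f x + g x))\<^sup>2 = L2_inner f f + 2 * L2_inner f g + L2_inner g g"
    using assms by (simp add: L2_norm_square L2_inner_linear bounded_meas_intros L2_inner_commute[of g f])
  also have "\<dots> \<le> (L2_norm f + L2_norm g)\<^sup>2"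
    using L2_Cauchy_Schwarz[OF assms] by (simp add: power2_sum L2_norm_square)
  finally show "(L2_norm (\<lambda>x. f x + g x))\<^sup>2 \<le> (L2_norm f + L2_norm g)\<^sup>2" .
qed (simp add: L2_norm_nonneg)

text \<open>\<open>s\<close> is continuously differentiable with derivative \<open>s1\<close>, and twice differentiable apart from finitely many points; \<open>s2\<close> may
be arbitrary at those. This covers splines, smooth functions, and their differences.\<close>

definition pw_C2 :: "(real \<Rightarrow> real) \<Rightarrow> (real \<Rightarrow> real) \<Rightarrow> (real \<Rightarrow> real) \<Rightarrow> bool" where
  "pw_C2 s s1 s2 \<longleftrightarrow> continuous_on {0..1} s \<and> continuous_on {0..1} s1 \<and> s2 \<in> bounded_meas \<and>
    (\<exists>S. finite S \<and> (\<forall>x\<in>Omega - S. (s has_real_derivative s1 x) (at x) \<and> (s1 has_real_derivative s2 x) (at x)))"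

lemma pw_C2_bounded_meas:
  assumes "pw_C2 s s1 s2"
  shows "s \<in> bounded_meas" "s1 \<in> bounded_meas" "s2 \<in> bounded_meas"
  using assms by (auto simp: pw_C2_def bounded_meas_continuous)

lemma pw_C2_lincomb:
  assumes "pw_C2 s s1 s2" "pw_C2 t t1 t2"
  shows "pw_C2 (\<lambda>x. j * s x + k * t x) (\<lambda>x. j * s1 x + k * t1 x) (\<lambda>x. j * s2 x + k * t2 x)"
proof -
  obtain S T where "finite S" "finite T"
    "\<forall>x\<in>Omega - S. (s has_real_derivative s1 x) (at x) \<and> (s1 has_real_derivative s2 x) (at x)"
    "\<forall>x\<in>Omega - T. (t has_real_derivative t1 x) (at x) \<and> (t1 has_real_derivative t2 x) (at x)"
    using assms by (auto simp: pw_C2_def)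
  then have "finite (S \<union> T)" "\<forall>x\<in>Omega - (S \<union> T).
     ((\<lambda>x. j * s x + k * t x) has_real_derivative (j * s1 x + k * t1 x)) (at x) \<and>
     ((\<lambda>x. j * s1 x + k * t1 x) has_real_derivative (j * s2 x + k * t2 x)) (at x)"
    by (auto intro!: DERIV_add DERIV_cmult)
  then show ?thesis
    using assms unfolding pw_C2_def
    by (auto intro!: continuous_intros bounded_meas_add bounded_meas_cmult)
qed

lemma pw_C2_add:
  "pw_C2 s s1 s2 \<Longrightarrow> pw_C2 t t1 t2 \<Longrightarrow> pw_C2 (\<lambda>x. s x + t x) (\<lambda>x. s1 x + t1 x) (\<lambda>x. s2 x + t2 x)"
  using pw_C2_lincomb[of s s1 s2 t t1 t2 1 1] by simp

lemma pw_C2_diff: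
  "pw_C2 s s1 s2 \<Longrightarrow> pw_C2 t t1 t2 \<Longrightarrow> pw_C2 (\<lambda>x. s x - t x) (\<lambda>x. s1 x - t1 x) (\<lambda>x. s2 x - t2 x)"
  using pw_C2_lincomb[of s s1 s2 t t1 t2 1 "-1"] by simp

text \<open>The fundamental theorem of calculus for \<open>s1 c - s c1\<close>, which is continuous across the exceptional points.\<close>

lemma Green_identity:
  assumes s: "pw_C2 s s1 s2" and c: "pw_C2 c c1 c2"
    and bc: "\<forall>\<xi>\<in>{0, 1}. c \<xi> = 0 \<and> c1 \<xi> = 0"
  shows "L2_inner s2 c = L2_inner s c2"
proof -
  obtain S T where ST: "finite S" "finite T"
    "\<forall>x\<in>Omega - S. (s has_real_derivative s1 x) (at x) \<and> (s1 has_real_derivative s2 x) (at x)"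
    "\<forall>x\<in>Omega - T. (c has_real_derivative c1 x) (at x) \<and> (c1 has_real_derivative c2 x) (at x)"
    using s c by (auto simp: pw_C2_def)
  have "((\<lambda>x. s2 x * c x - s x * c2 x) has_integral
     ((s1 1 * c 1 - s 1 * c1 1) - (s1 0 * c 0 - s 0 * c1 0))) {0..1}"
  proof (rule fundamental_theorem_of_calculus_interior_strong[of "S \<union> T"])
    fix x assume x: "x \<in> {0<..<1} - (S \<union> T)"
    have "((\<lambda>x. s1 x * c x - s x * c1 x) has_real_derivative
        ((s2 x * c x + c1 x * s1 x) - (s1 x * c1 x + c2 x * s x))) (at x)"
      using ST x by (intro DERIV_diff DERIV_mult) auto
    then show "((\<lambda>x. s1 x * c x - s x * c1 x) has_vector_derivative (s2 x * c x - s x * c2 x)) (at x)"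
      by (simp add: has_real_derivative_iff_has_vector_derivative mult.commute)
  qed (use s c ST in \<open>auto simp: pw_C2_def intro!: continuous_intros\<close>)
  then have "integral {0..1} (\<lambda>x. s2 x * c x - s x * c2 x) = 0"
    using bc by (simp add: integral_unique)
  moreover have "integral {0..1} (\<lambda>x. s2 x * c x - s x * c2 x) = L2_inner s2 c - L2_inner s c2"
    using pw_C2_bounded_meas[OF s] pw_C2_bounded_meas[OF c]
    by (simp add: L2_inner_eq_integral Henstock_Kurzweil_Integration.integral_diff
        bounded_meas_integrable_on bounded_meas_mult)
  ultimately show ?thesis by simp
qed

lemma test_function_deriv:
  assumes "test_function \<phi>"
  shows "((deriv ^^ k) \<phi> has_real_derivative (deriv ^^ Suc k) \<phi> x) (at x)"
  using assms by (simp add: test_function_def DERIV_deriv_iff_field_differentiable)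

lemma test_function_zero:
  assumes \<phi>: "test_function \<phi>" and "x \<notin> Omega"
  shows "(deriv ^^ k) \<phi> x = 0"
proof -
  let ?O = "- closure {x. \<phi> x \<noteq> 0}"
  have "\<forall>x\<in>?O. (deriv ^^ k) \<phi> x = 0"
  proof (induction k)
    case 0
    then show ?case using closure_subset[of "{x. \<phi> x \<noteq> 0}"] by auto
  next
    case (Suc k)
    show ?case
    proof
      fix x assume x: "x \<in> ?O"
      have "((\<lambda>x. 0) has_real_derivative 0) (at x)" by simp
      then have "((deriv ^^ k) \<phi> has_real_derivative 0) (at x)"
        by (rule has_field_derivative_transform_within_open[of _ _ _ ?O]) (use x Suc in auto)
      then show "(deriv ^^ Suc k) \<phi> x = 0" by (simp add: DERIV_imp_deriv)
    qed
  qed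
  then show ?thesis using assms by (auto simp: test_function_def)
qed

lemma test_function_pw_C2:
  assumes "test_function \<phi>"
  shows "pw_C2 ((deriv ^^ k) \<phi>) ((deriv ^^ Suc k) \<phi>) ((deriv ^^ Suc (Suc k)) \<phi>)"
proof -
  have "continuous_on {0..1} ((deriv ^^ k) \<phi>)" for k
    using test_function_deriv[OF assms] by (meson DERIV_isCont continuous_at_imp_continuous_on)
  then show ?thesis
    unfolding pw_C2_def using test_function_deriv[OF assms] test_function_bounded_meas[OF assms]
    by (intro conjI exI[of _ "{}"]) (simp_all only: finite.emptyI ball_simps, simp_all only: simp_thms Ball_def)
qed

lemma has_weak_deriv_0: "w \<in> L2 \<Longrightarrow> has_weak_deriv 0 w w"
  by (simp add: has_weak_deriv_def)

lemma pw_C2_weak_deriv1: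
  assumes s: "pw_C2 s s1 s2"
  shows "has_weak_deriv 1 s s1"
  unfolding has_weak_deriv_def
proof (intro conjI allI impI)
  show "s \<in> L2" "s1 \<in> L2" using s by (auto intro: bounded_meas_L2 pw_C2_bounded_meas)
  fix \<phi> assume \<phi>: "test_function \<phi>"
  obtain S where S: "finite S" "\<forall>x\<in>Omega - S. (s has_real_derivative s1 x) (at x)"
    using s by (auto simp: pw_C2_def)
  have t: "pw_C2 \<phi> (deriv \<phi>) (deriv (deriv \<phi>))" using test_function_pw_C2[OF \<phi>, of 0] by simp
  have "((\<lambda>x. s1 x * \<phi> x + deriv \<phi> x * s x) has_integral (s 1 * \<phi> 1 - s 0 * \<phi> 0)) {0..1}"
  proof (rule fundamental_theorem_of_calculus_interior_strong[of S])
    fix x assume x: "x \<in> {0<..<1} - S"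
    have "((\<lambda>x. s x * \<phi> x) has_real_derivative (s1 x * \<phi> x + deriv \<phi> x * s x)) (at x)"
      using S x test_function_deriv[OF \<phi>, of 0] by (intro DERIV_mult) auto
    then show "((\<lambda>x. s x * \<phi> x) has_vector_derivative (s1 x * \<phi> x + deriv \<phi> x * s x)) (at x)"
      by (simp add: has_real_derivative_iff_has_vector_derivative)
  qed (use s t S in \<open>auto simp: pw_C2_def intro!: continuous_intros\<close>)
  then have "integral {0..1} (\<lambda>x. s1 x * \<phi> x + deriv \<phi> x * s x) = 0"
    using test_function_zero[OF \<phi>, of _ 0] by (simp add: integral_unique)
  moreover have "integral {0..1} (\<lambda>x. s1 x * \<phi> x + deriv \<phi> x * s x) = L2_inner s1 \<phi> + L2_inner (deriv \<phi>) s"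
    using pw_C2_bounded_meas[OF s] pw_C2_bounded_meas[OF t]
    by (simp add: L2_inner_eq_integral Henstock_Kurzweil_Integration.integral_add
        bounded_meas_integrable_on bounded_meas_mult)
  ultimately show "L2_inner s ((deriv ^^ 1) \<phi>) = (- 1) ^ 1 * L2_inner s1 \<phi>"
    by (simp add: L2_inner_commute)
qed

lemma pw_C2_weak_deriv2:
  assumes s: "pw_C2 s s1 s2"
  shows "has_weak_deriv 2 s s2"
  unfolding has_weak_deriv_def
proof (intro conjI allI impI)
  show "s \<in> L2" "s2 \<in> L2" using s by (auto intro: bounded_meas_L2 pw_C2_bounded_meas)
  fix \<phi> assume \<phi>: "test_function \<phi>"
  have t: "pw_C2 \<phi> (deriv \<phi>) (deriv (deriv \<phi>))" using test_function_pw_C2[OF \<phi>, of 0] by simp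
  have "L2_inner s2 \<phi> = L2_inner s (deriv (deriv \<phi>))"
    using test_function_zero[OF \<phi>, of _ 0] test_function_zero[OF \<phi>, of _ 1]
    by (intro Green_identity[OF s t]) auto
  then show "L2_inner s ((deriv ^^ 2) \<phi>) = (- 1) ^ 2 * L2_inner s2 \<phi>"
    by (simp add: numeral_2_eq_2)
qed

lemma pw_C2_Sobolev2:
  assumes "pw_C2 s s1 s2"
  shows "s \<in> Sobolev 2"
  unfolding Sobolev_def
proof (intro CollectI allI impI)
  fix k :: nat assume "k \<le> 2"
  then consider "k = 0" | "k = 1" | "k = 2" by linarith
  then show "\<exists>g. has_weak_deriv k s g"
    using has_weak_deriv_0 bounded_meas_L2 pw_C2_bounded_meas(1)[OF assms]
      pw_C2_weak_deriv1[OF assms] pw_C2_weak_deriv2[OF assms] by cases blast+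
qed

lemma deriv_chain_pw_C2:
  assumes G: "deriv_chain 0 1 m G" and k: "Suc (Suc k) \<le> m"
  shows "pw_C2 (G k) (G (Suc k)) (G (Suc (Suc k)))"
proof -
  have "continuous_on {0..1} (G j)" if "j \<le> m" for j using G that by (simp add: deriv_chain_def)
  moreover have "(G j has_real_derivative G (Suc j) x) (at x)" if "j < m" "x \<in> Omega" for j x
  proof -
    have "(G j has_real_derivative G (Suc j) x) (at x within {0..1})"
      using G that by (auto simp: deriv_chain_def)
    then show ?thesis using that by (simp add: at_within_Icc_at)
  qed
  ultimately show ?thesis
    using k unfolding pw_C2_def
    by (intro conjI exI[of _ "{}"]) (auto intro: bounded_meas_continuous)
qed

text \<open>Green's identity against the test function, twice.\<close>

lemma deriv_chain_weak_deriv4: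
  assumes G: "deriv_chain 0 1 m G" and m: "4 \<le> m"
  shows "has_weak_deriv 4 (G 0) (G 4)"
  unfolding has_weak_deriv_def
proof (intro conjI allI impI)
  have "G k \<in> bounded_meas" if "k \<le> m" for k
    using G that by (auto simp: deriv_chain_def bounded_meas_continuous)
  then show "G 0 \<in> L2" "G 4 \<in> L2" using m by (auto intro: bounded_meas_L2)
  fix \<phi> assume \<phi>: "test_function \<phi>"
  have z: "\<forall>\<xi>\<in>{0,1}. (deriv ^^ k) \<phi> \<xi> = 0 \<and> (deriv ^^ Suc k) \<phi> \<xi> = 0" for k
    using test_function_zero[OF \<phi>, of _ k] test_function_zero[OF \<phi>, of _ "Suc k"] by auto
  have "L2_inner (G (Suc (Suc (Suc (Suc 0))))) ((deriv ^^ 0) \<phi>) = L2_inner (G (Suc (Suc 0))) ((deriv ^^ Suc (Suc 0)) \<phi>)"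
    using m by (intro Green_identity[OF deriv_chain_pw_C2[OF G] test_function_pw_C2[OF \<phi>]] z) auto
  also have "\<dots> = L2_inner (G 0) ((deriv ^^ Suc (Suc (Suc (Suc 0)))) \<phi>)"
    using m by (intro Green_identity[OF deriv_chain_pw_C2[OF G] test_function_pw_C2[OF \<phi>]] z) auto
  finally show "L2_inner (G 0) ((deriv ^^ 4) \<phi>) = (- 1) ^ 4 * L2_inner (G 4) \<phi>"
    by (simp add: eval_nat_numeral)
qed

lemma has_weak_deriv_cong:
  assumes "has_weak_deriv k w g" "\<And>x. x \<in> {0..1} \<Longrightarrow> w x = w' x"
  shows "has_weak_deriv k w' g"
proof -
  have *: "\<And>x. x \<in> Omega \<Longrightarrow> w x = w' x" using assms(2) by auto
  have "L2_inner w' \<psi> = L2_inner w \<psi>" for \<psi>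
    unfolding L2_inner_def by (rule Bochner_Integration.integral_cong) (use * in auto)
  moreover have "w' \<in> L2"
  proof -
    have "w' \<in> borel_measurable (lebesgue_on Omega) \<longleftrightarrow> w \<in> borel_measurable (lebesgue_on Omega)"
      by (rule measurable_cong) (use * in auto)
    moreover have "integrable (lebesgue_on Omega) (\<lambda>x. (w' x)\<^sup>2) \<longleftrightarrow> integrable (lebesgue_on Omega) (\<lambda>x. (w x)\<^sup>2)"
      by (rule Bochner_Integration.integrable_cong) (use * in auto)
    ultimately show ?thesis using assms(1) by (simp add: has_weak_deriv_def L2_def)
  qed
  ultimately show ?thesis using assms(1) by (simp add: has_weak_deriv_def)
qed

lemma D01_eq:
  assumes "(w has_real_derivative d) (at x within {0..1})" "x \<in> {0..1}"
  shows "D01 w x = d"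
  unfolding D01_def using assms
  by (intro vector_derivative_within_closed_interval)
     (auto simp: has_real_derivative_iff_has_vector_derivative)

lemma C_closed_deriv_chain:
  assumes "w \<in> C_closed K"
  shows "deriv_chain 0 1 K (\<lambda>k. (D01 ^^ k) w)"
  unfolding deriv_chain_def
proof (intro conjI allI impI ballI)
  fix k x assume k: "k < K" and x: "x \<in> {0..1::real}"
  then have "(D01 ^^ k) w differentiable (at x within {0..1})"
    using assms by (simp add: C_closed_def)
  moreover have "(D01 ^^ Suc k) w x = vector_derivative ((D01 ^^ k) w) (at x within {0..1})"
    by (simp add: D01_def)
  ultimately show "((D01 ^^ k) w has_real_derivative (D01 ^^ Suc k) w x) (at x within {0..1})"
    by (simp only: has_real_derivative_iff_has_vector_derivative vector_derivative_works)
next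
  fix k assume "k \<le> K"
  then show "continuous_on {0..1} ((D01 ^^ k) w)" using assms by (simp add: C_closed_def)
qed

lemma C_closed_1I:
  assumes "continuous_on {0..1} w" "continuous_on {0..1} w1"
    "\<And>x. x \<in> {0..1} \<Longrightarrow> (w has_real_derivative w1 x) (at x within {0..1})"
  shows "w \<in> C_closed 1" "\<And>x. x \<in> {0..1} \<Longrightarrow> D01 w x = w1 x"
proof -
  show D: "D01 w x = w1 x" if "x \<in> {0..1}" for x using D01_eq assms that by blast
  then have "continuous_on {0..1} (D01 w)" using continuous_on_eq[OF assms(2)] by simp
  moreover have "w differentiable (at x within {0..1})" if "x \<in> {0..1}" for x
    using assms(3)[OF that] has_real_derivative_iff_has_vector_derivative
      differentiableI_vector by blast
  ultimately show "w \<in> C_closed 1"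
    using assms(1) by (auto simp: C_closed_def le_Suc_eq)
qed

text \<open>Used to compare a continuous function with the representative in which \<open>Sobolev2_0\<close> prescribes boundary values.\<close>

lemma continuous_AE_eq:
  fixes f g :: "real \<Rightarrow> real"
  assumes f: "continuous_on {0..1} f" and g: "continuous_on {0..1} g"
    and ae: "AE x in lebesgue_on Omega. f x = g x" and x: "x \<in> {0..1}"
  shows "f x = g x"
proof -
  have "integral {0..1} (\<lambda>x. (f x - g x)\<^sup>2) = (\<integral>x. (f x - g x)\<^sup>2 \<partial>lebesgue_on Omega)"
    by (intro integral_bounded_meas[symmetric] bounded_meas_continuous continuous_intros f g)
  also have "\<dots> = (\<integral>x. 0 \<partial>lebesgue_on Omega)"
  proof (rule integral_cong_AE)
    show "(\<lambda>x. (f x - g x)\<^sup>2) \<in> borel_measurable (lebesgue_on Omega)"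
    proof -
      have "(\<lambda>x. (f x - g x)\<^sup>2) \<in> bounded_meas"
        by (intro bounded_meas_continuous continuous_intros f g)
      then show ?thesis by (simp add: bounded_meas_def)
    qed
    show "AE x in lebesgue_on Omega. (f x - g x)\<^sup>2 = 0" using ae by eventually_elim simp
  qed simp
  finally have "integral {0..1} (\<lambda>x. (f x - g x)\<^sup>2) = 0" by simp
  moreover have "(\<lambda>x. (f x - g x)\<^sup>2) integrable_on {0..1}"
    by (intro integrable_continuous_real continuous_intros f g)
  ultimately have "((\<lambda>x. (f x - g x)\<^sup>2) has_integral 0) (cbox 0 1)"
    using integrable_integral by fastforce
  then have "(f x - g x)\<^sup>2 = 0"
    using x f g by (intro has_integral_0_cbox_imp_0[of 0 1 "\<lambda>x. (f x - g x)\<^sup>2"]) (auto intro!: continuous_intros)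
  then show ?thesis by simp
qed

lemma Sobolev2_0_boundary:
  assumes "w \<in> Sobolev2_0" and c: "continuous_on {0..1} w"
    and d: "\<And>x. x \<in> {0..1} \<Longrightarrow> (w has_real_derivative w1 x) (at x within {0..1})"
    and \<xi>: "\<xi> \<in> {0, 1}"
  shows "w \<xi> = 0" "w1 \<xi> = 0"
proof -
  obtain c where c: "c \<in> C_closed 1" "AE x in lebesgue_on Omega. w x = c x" "c \<xi> = 0" "D01 c \<xi> = 0"
    using assms(1) \<xi> unfolding Sobolev2_0_def by auto
  have "deriv_chain 0 1 1 (\<lambda>k. (D01 ^^ k) c)" using C_closed_deriv_chain c(1) .
  then have cc: "continuous_on {0..1} c" and cd: "\<And>x. x \<in> {0..1} \<Longrightarrow> (c has_real_derivative D01 c x) (at x within {0..1})"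
    by (auto simp: deriv_chain_def dest: spec[of _ 0])
  have eq: "w x = c x" if "x \<in> {0..1}" for x
    using continuous_AE_eq[OF assms(2) cc c(2) that] .
  have x01: "\<xi> \<in> {0..1}" using \<xi> by auto
  show "w \<xi> = 0" using eq[OF x01] c by simp
  have "(w has_real_derivative D01 c \<xi>) (at \<xi> within {0..1})"
    by (rule has_field_derivative_transform_within[OF cd[OF x01] zero_less_one x01]) (use eq in auto)
  then have "D01 w \<xi> = D01 c \<xi>" using D01_eq x01 by blast
  moreover have "D01 w \<xi> = w1 \<xi>" using D01_eq d x01 by blast
  ultimately show "w1 \<xi> = 0" using c by simp
qed

section \<open>Splines on a mesh\<close>

definition mesh :: "nat \<Rightarrow> (nat \<Rightarrow> real) \<Rightarrow> bool" where
  "mesh N xs \<longleftrightarrow> xs 0 = 0 \<and> xs N = 1 \<and> (\<forall>i<N. xs i < xs (Suc i))"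

lemma mesh_less:
  assumes "mesh N xs" "i < j" "j \<le> N"
  shows "xs i < xs j"
  using assms(2,3)
proof (induction j)
  case (Suc j)
  then have "xs j < xs (Suc j)" using assms(1) by (simp add: mesh_def)
  moreover have "i = j \<or> xs i < xs j" using Suc by fastforce
  ultimately show ?case by auto
qed simp

lemma mesh_le: "mesh N xs \<Longrightarrow> i \<le> j \<Longrightarrow> j \<le> N \<Longrightarrow> xs i \<le> xs j"
  using mesh_less by (metis le_less order_refl)

lemma mesh_in_unit:
  assumes "mesh N xs" "i \<le> N"
  shows "0 \<le> xs i" "xs i \<le> 1"
  using mesh_le[OF assms(1), of 0 i] mesh_le[OF assms(1), of i N] assms by (auto simp: mesh_def)

lemma mesh_pos: "mesh N xs \<Longrightarrow> N > 0"
  by (auto simp: mesh_def intro: ccontr)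

lemma integral_cong_open:
  fixes f g :: "real \<Rightarrow> real"
  assumes "\<And>x. x \<in> {a<..<b} \<Longrightarrow> f x = g x"
  shows "integral {a..b} f = integral {a..b} g"
  unfolding integral_open_interval_real by (rule integral_cong) (use assms in auto)

lemma integral_mesh_sum:
  assumes "mesh N xs" "f \<in> bounded_meas" "m \<le> n" "n \<le> N"
  shows "integral {xs m..xs n} f = (\<Sum>i\<in>{Suc m..n}. integral {xs (i - 1)..xs i} f)"
  using assms(3,4)
proof (induction n rule: dec_induct)
  case (step n)
  have "integral {xs m..xs n} f + integral {xs n..xs (Suc n)} f = integral {xs m..xs (Suc n)} f"
    using step mesh_in_unit[OF assms(1)] mesh_le[OF assms(1)]
    by (intro Henstock_Kurzweil_Integration.integral_combine bounded_meas_integrable_on assms) auto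
  with step show ?case by simp
qed simp

lemma truncated_poly_continuous:
  fixes R :: "real poly"
  assumes "poly R c = 0"
  shows "continuous_on A (\<lambda>x. if c < x then poly R x else 0)"
proof -
  have "(\<lambda>x. if c < x then poly R x else 0) = (\<lambda>x. poly R (max c x))"
    using assms by (auto simp: max_def)
  moreover have "continuous_on A (\<lambda>x. poly R (max c x))" by (intro continuous_intros)
  ultimately show ?thesis by (simp only:)
qed

text \<open>With a double zero at \<open>c\<close>, truncation does not destroy differentiability: the difference quotient of the truncated polynomial at \<open>c\<close>
is dominated by that of the polynomial.\<close>

lemma DERIV_truncated_poly:
  fixes R :: "real poly"
  assumes "poly R c = 0" "poly (pderiv R) c = 0"
  shows "((\<lambda>x. if c < x then poly R x else 0) has_real_derivative
    (if c < x then poly (pderiv R) x else 0)) (at x)"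
proof -
  consider "x < c" | "c < x" | "x = c" by linarith
  then show ?thesis
  proof cases
    case 1
    have "((\<lambda>x. 0) has_real_derivative 0) (at x)" by simp
    then have "((\<lambda>x. if c < x then poly R x else 0) has_real_derivative 0) (at x)"
      by (rule has_field_derivative_transform_within_open[of _ _ _ "{..<c}"]) (use 1 in auto)
    then show ?thesis using 1 by simp
  next
    case 2
    have "(poly R has_real_derivative poly (pderiv R) x) (at x)" by simp
    then have "((\<lambda>x. if c < x then poly R x else 0) has_real_derivative poly (pderiv R) x) (at x)"
      by (rule has_field_derivative_transform_within_open[of _ _ _ "{c<..}"]) (use 2 in auto)
    then show ?thesis using 2 by simp
  next
    case 3
    let ?t = "\<lambda>x. if c < x then poly R x else 0"
    have "(poly R has_real_derivative 0) (at c)" using poly_DERIV[of R c] assms by simp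
    then have "((\<lambda>h. (poly R (c + h) - poly R c) / h) \<longlongrightarrow> 0) (at 0)" by (simp add: DERIV_def)
    from tendsto_norm_zero[OF this] have "((\<lambda>h. norm ((poly R (c + h) - poly R c) / h)) \<longlongrightarrow> 0) (at 0)" .
    moreover have "\<forall>\<^sub>F h in at 0. norm ((?t (c + h) - ?t c) / h) \<le> norm ((poly R (c + h) - poly R c) / h)"
    proof (intro always_eventually allI)
      fix h
      have "?t (c + h) - ?t c = (if 0 < h then poly R (c + h) - poly R c else 0)"
        using assms by auto
      then show "norm ((?t (c + h) - ?t c) / h) \<le> norm ((poly R (c + h) - poly R c) / h)"
        by (cases "0 < h") (simp_all only: if_True if_False div_0 norm_zero norm_ge_zero order_refl)
    qed
    ultimately have "((\<lambda>h. (?t (c + h) - ?t c) / h) \<longlongrightarrow> 0) (at 0)"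
      by (rule Lim_null_comparison[rotated])
    then show ?thesis using 3 by (simp add: DERIV_def)
  qed
qed

text \<open>A spline \<open>s\<close> with its derivatives \<open>s1\<close>, \<open>s2\<close> and its pieces \<open>Q\<close>. The element number \<open>i\<close> is the interval between the nodes
\<open>i - 1\<close> and \<open>i\<close>; at the nodes \<open>s2\<close> is left open.\<close>

definition spline_triple ::
  "nat \<Rightarrow> nat \<Rightarrow> (nat \<Rightarrow> real) \<Rightarrow> (nat \<Rightarrow> real poly) \<Rightarrow> (real \<Rightarrow> real) \<Rightarrow> (real \<Rightarrow> real) \<Rightarrow> (real \<Rightarrow> real) \<Rightarrow> bool" where
  "spline_triple p N xs Q s s1 s2 \<longleftrightarrow> pw_C2 s s1 s2 \<and>
    (\<forall>x\<in>{0..1}. (s has_real_derivative s1 x) (at x within {0..1})) \<and>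
    (\<forall>i\<in>{1..N}. degree (Q i) \<le> p \<and>
      (\<forall>x\<in>{xs (i - 1)<..<xs i}. s x = poly (Q i) x \<and> s2 x = poly (pderiv (pderiv (Q i))) x))"

lemma spline_triple_exists:
  fixes Q :: "nat \<Rightarrow> real poly"
  assumes s: "s \<in> C_closed 1" and mesh: "mesh N xs"
    and deg: "\<And>i. i \<in> {1..N} \<Longrightarrow> degree (Q i) \<le> p"
    and Qs: "\<And>i x. i \<in> {1..N} \<Longrightarrow> x \<in> {xs (i - 1)<..<xs i} \<Longrightarrow> s x = poly (Q i) x"
  shows "\<exists>s2. spline_triple p N xs Q s (D01 s) s2"
proof -
  define s2 where "s2 = (\<lambda>x. \<Sum>i\<in>{1..N}. indicat_real {xs (i - 1)<..<xs i} x * poly (pderiv (pderiv (Q i))) x)"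
  have s2: "s2 x = poly (pderiv (pderiv (Q i))) x" if i: "i \<in> {1..N}" and x: "x \<in> {xs (i - 1)<..<xs i}" for i x
  proof -
    have "x \<notin> {xs (j - 1)<..<xs j}" if j: "j \<in> {1..N}" "j \<noteq> i" for j
    proof (cases "j < i")
      case True
      then have "xs j \<le> xs (i - 1)" using i by (intro mesh_le[OF mesh]) auto
      then show ?thesis using x by auto
    next
      case False
      then have "xs i \<le> xs (j - 1)" using j by (intro mesh_le[OF mesh]) auto
      then show ?thesis using x by auto
    qed
    then have "s2 x = (\<Sum>j\<in>{1..N}. if j = i then poly (pderiv (pderiv (Q i))) x else 0)"
      unfolding s2_def using x by (intro sum.cong) (auto simp: indicator_def)
    then show ?thesis using i by simp
  qed
  have bm: "(\<lambda>x. indicat_real {a<..<b} x * poly P x) \<in> bounded_meas" for a b P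
  proof (rule bounded_meas_mult)
    have "indicat_real {a<..<b} \<in> borel_measurable (lebesgue_on Omega)"
      by (intro measurable_restrict_space1 borel_measurable_indicator) simp
    then show "indicat_real {a<..<b} \<in> bounded_meas"
      by (auto simp: bounded_meas_def indicator_def intro!: exI[of _ 1])
  qed (intro bounded_meas_continuous continuous_intros)
  have "s2 \<in> bounded_meas"
    unfolding s2_def
  proof (induction N)
    case (Suc n)
    then show ?case using bm by (simp add: bounded_meas_add)
  qed simp
  moreover from C_closed_deriv_chain[OF s]
  have cs: "continuous_on {0..1} s" "continuous_on {0..1} (D01 s)"
    and ds: "\<forall>x\<in>{0..1}. (s has_real_derivative D01 s x) (at x within {0..1})"
    by (auto simp: deriv_chain_def dest: spec[of _ 0] spec[of _ 1])
  moreover have "(s has_real_derivative D01 s x) (at x) \<and> (D01 s has_real_derivative s2 x) (at x)"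
    if x: "x \<in> Omega - xs ` {0..N}" for x
  proof -
    define i where "i = (LEAST i. x < xs i)"
    have "x < xs N" using x mesh by (auto simp: mesh_def)
    then have xi: "x < xs i" and iN: "i \<le> N" unfolding i_def by (rule LeastI, rule Least_le)
    have i0: "i \<noteq> 0" using xi x mesh by (auto simp: mesh_def intro!: notI)
    then have "\<not> x < xs (i - 1)" unfolding i_def using not_less_Least[of "i - 1" "\<lambda>i. x < xs i"] i_def by auto
    moreover have "x \<noteq> xs (i - 1)" using x iN by auto
    ultimately have xi': "x \<in> {xs (i - 1)<..<xs i}" using xi by auto
    have iN': "i \<in> {1..N}" using i0 iN by auto
    have i1: "i - 1 \<le> N" using iN by simp
    have d: "(s has_real_derivative poly (pderiv (Q i)) y) (at y)" if "y \<in> {xs (i - 1)<..<xs i}" for y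
      by (rule has_field_derivative_transform_within_open[OF poly_DERIV[of "Q i"], of "{xs (i - 1)<..<xs i}"])
         (use that Qs[OF iN'] in auto)
    have D: "D01 s y = poly (pderiv (Q i)) y" if "y \<in> {xs (i - 1)<..<xs i}" for y
    proof (rule D01_eq)
      show "(s has_real_derivative poly (pderiv (Q i)) y) (at y within {0..1})"
        using d[OF that] has_field_derivative_at_within by blast
      show "y \<in> {0..1}" using that mesh_in_unit(1)[OF mesh i1] mesh_in_unit(2)[OF mesh iN] by auto
    qed
    have "(D01 s has_real_derivative poly (pderiv (pderiv (Q i))) x) (at x)"
      by (rule has_field_derivative_transform_within_open[OF poly_DERIV[of "pderiv (Q i)"], of "{xs (i - 1)<..<xs i}"])
         (use xi' D in auto)
    then show ?thesis using d[OF xi'] D[OF xi'] s2[OF iN' xi'] by simp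
  qed
  ultimately have "pw_C2 s (D01 s) s2"
    unfolding pw_C2_def by (intro conjI exI[of _ "xs ` {0..N}"]) auto
  then show ?thesis using deg Qs s2 ds unfolding spline_triple_def by blast
qed

lemma spline_space_triple:
  assumes "s \<in> spline_space p N xs" "mesh N xs"
  shows "\<exists>Q s2. spline_triple p N xs Q s (D01 s) s2"
proof -
  have "\<forall>i\<in>{1..N}. \<exists>q. degree q \<le> p \<and> (\<forall>x\<in>{xs (i - 1)<..<xs i}. s x = poly q x)"
    using assms(1) by (simp add: spline_space_def)
  from bchoice[OF this] obtain Q where
    "\<forall>i\<in>{1..N}. degree (Q i) \<le> p \<and> (\<forall>x\<in>{xs (i - 1)<..<xs i}. s x = poly (Q i) x)" by blast
  then show ?thesis
    using spline_triple_exists[of s N xs Q p] assms by (auto simp: spline_space_def)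
qed

lemma spline_triple_C_closed:
  assumes "spline_triple p N xs Q s s1 s2"
  shows "s \<in> C_closed 1" "\<And>x. x \<in> {0..1} \<Longrightarrow> D01 s x = s1 x"
  using C_closed_1I[of s s1] assms by (auto simp: spline_triple_def pw_C2_def)

lemma spline_triple_space:
  assumes "spline_triple p N xs Q s s1 s2"
  shows "s \<in> spline_space p N xs"
  using assms spline_triple_C_closed(1)[OF assms]
  unfolding spline_space_def spline_triple_def by blast

lemma spline_triple_diff:
  assumes "spline_triple p N xs Q s s1 s2" "spline_triple p N xs R t t1 t2"
  shows "spline_triple p N xs (\<lambda>i. Q i - R i) (\<lambda>x. s x - t x) (\<lambda>x. s1 x - t1 x) (\<lambda>x. s2 x - t2 x)"
  using assms unfolding spline_triple_def
  by (auto intro!: pw_C2_diff DERIV_diff degree_diff_le simp: pderiv_diff)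

lemma spline_triple_add:
  assumes "spline_triple p N xs Q s s1 s2" "spline_triple p N xs R t t1 t2"
  shows "spline_triple p N xs (\<lambda>i. Q i + R i) (\<lambda>x. s x + t x) (\<lambda>x. s1 x + t1 x) (\<lambda>x. s2 x + t2 x)"
  using assms unfolding spline_triple_def
  by (auto intro!: pw_C2_add DERIV_add degree_add_le simp: pderiv_add)

text \<open>The spline is written as its first piece plus truncated jumps between consecutive pieces. The matching conditions say that each
jump has a double zero at its node, so the sum is differentiable on the whole line, and on each element it telescopes.\<close>

lemma glue_polys:
  fixes Q :: "nat \<Rightarrow> real poly"
  assumes mesh: "mesh N xs" and deg: "\<And>i. i \<in> {1..N} \<Longrightarrow> degree (Q i) \<le> p"
    and match: "\<And>i. 1 \<le> i \<Longrightarrow> i < N \<Longrightarrow> poly (Q i) (xs i) = poly (Q (Suc i)) (xs i)"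
      "\<And>i. 1 \<le> i \<Longrightarrow> i < N \<Longrightarrow> poly (pderiv (Q i)) (xs i) = poly (pderiv (Q (Suc i))) (xs i)"
  obtains s s1 s2 where "spline_triple p N xs Q s s1 s2"
    "s 0 = poly (Q 1) 0" "s1 0 = poly (pderiv (Q 1)) 0"
    "s 1 = poly (Q N) 1" "s1 1 = poly (pderiv (Q N)) 1"
proof -
  define T where "T = (\<lambda>Q x. poly (Q 1) x + (\<Sum>k\<in>{1..<N}. if xs k < x then poly (Q (Suc k) - Q k) x else 0))"
  define s where "s = T Q"
  define s1 where "s1 = T (\<lambda>i. pderiv (Q i))"
  have T_eq: "T Q x = poly (Q i) x" if i: "i \<in> {1..N}" and x: "x \<le> xs i" "i = 1 \<or> xs (i - 1) < x"
    for Q :: "nat \<Rightarrow> real poly" and i x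
  proof -
    have "(\<Sum>k\<in>{1..<N}. if xs k < x then poly (Q (Suc k) - Q k) x else 0) =
      (\<Sum>k\<in>{1..<i}. poly (Q (Suc k)) x - poly (Q k) x)"
    proof (rule sum.mono_neutral_cong_right)
      show "\<forall>k\<in>{1..<N} - {1..<i}. (if xs k < x then poly (Q (Suc k) - Q k) x else 0) = 0"
      proof
        fix k assume "k \<in> {1..<N} - {1..<i}"
        then have "xs i \<le> xs k" using i by (intro mesh_le[OF mesh]) auto
        with x show "(if xs k < x then poly (Q (Suc k) - Q k) x else 0) = 0" by auto
      qed
      fix k assume k: "k \<in> {1..<i}"
      then have "xs k \<le> xs (i - 1)" using i by (intro mesh_le[OF mesh]) auto
      then show "(if xs k < x then poly (Q (Suc k) - Q k) x else 0) = poly (Q (Suc k)) x - poly (Q k) x"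
        using k x by auto
    qed (use i in auto)
    also have "\<dots> = poly (Q i) x - poly (Q 1) x"
      using i by (intro sum_Suc_diff') auto
    finally show ?thesis by (simp add: T_def)
  qed
  have ds: "(s has_real_derivative s1 x) (at x)" for x
    unfolding s_def s1_def T_def pderiv_diff[symmetric]
    by (intro DERIV_add DERIV_sum DERIV_truncated_poly poly_DERIV)
       (auto simp: match pderiv_diff)
  have cs1: "continuous_on {0..1} s1"
    unfolding s1_def T_def
    by (intro continuous_intros truncated_poly_continuous) (auto simp: match)
  have cs: "continuous_on {0..1} s"
    using ds by (meson DERIV_isCont continuous_at_imp_continuous_on)
  have C1: "s \<in> C_closed 1" and D: "\<And>x. x \<in> {0..1} \<Longrightarrow> D01 s x = s1 x"
    using C_closed_1I[OF cs cs1] ds has_field_derivative_at_within by blast+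
  have piece: "s x = poly (Q i) x" if "i \<in> {1..N}" "x \<in> {xs (i - 1)<..<xs i}" for i x
    unfolding s_def using that by (intro T_eq) auto
  note N = mesh_pos[OF mesh]
  have ends: "T Q 0 = poly (Q 1) 0" "T Q 1 = poly (Q N) 1" for Q :: "nat \<Rightarrow> real poly"
    using T_eq[of 1 0 Q] T_eq[of N 1 Q] mesh_in_unit[OF mesh, of 1] mesh_less[OF mesh, of "N - 1" N] N mesh
    by (auto simp: mesh_def)
  obtain s2 where "spline_triple p N xs Q s (D01 s) s2"
    using spline_triple_exists[OF C1 mesh, of Q p] deg piece by blast
  then show ?thesis
    using that[of s "D01 s" s2] D ends by (simp add: s_def s1_def)
qed

lemma deriv_chain_subinterval:
  assumes "deriv_chain a b m G" "a \<le> a'" "b' \<le> b"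
  shows "deriv_chain a' b' m G"
proof -
  have sub: "{a'..b'} \<subseteq> {a..b}" using assms by auto
  then show ?thesis using assms(1) unfolding deriv_chain_def
    by (meson DERIV_subset continuous_on_subset subsetD)
qed

section \<open>Interpolation and correction of the layer parts\<close>

definition interpolates :: "nat \<Rightarrow> nat \<Rightarrow> (nat \<Rightarrow> real) \<Rightarrow> (nat \<Rightarrow> real \<Rightarrow> real) \<Rightarrow> (nat \<Rightarrow> real poly) \<Rightarrow> bool" where
  "interpolates p N xs G Q \<longleftrightarrow> (\<forall>i\<in>{1..N}. local_interpolant p (xs (i - 1)) (xs i) G (Q i))"

lemma interpolates_exists:
  assumes mesh: "mesh N xs" and p: "p \<ge> 3" and G: "deriv_chain 0 1 (p + 1) G"
  shows "\<exists>Q. interpolates p N xs G Q"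
proof -
  have "\<forall>i\<in>{1..N}. \<exists>q. local_interpolant p (xs (i - 1)) (xs i) G q"
  proof
    fix i assume i: "i \<in> {1..N}"
    have "xs (i - 1) < xs i" using i by (intro mesh_less[OF mesh]) auto
    moreover have "deriv_chain (xs (i - 1)) (xs i) (p + 1) G"
      using i mesh_in_unit[OF mesh] by (intro deriv_chain_subinterval[OF G]) auto
    ultimately show "\<exists>q. local_interpolant p (xs (i - 1)) (xs i) G q"
      using hermite_moment_interpolant[OF _ p] by blast
  qed
  from bchoice[OF this] show ?thesis unfolding interpolates_def by blast
qed

lemma bounded_meas_poly [simp]: "poly P \<in> bounded_meas"
  by (intro bounded_meas_continuous continuous_intros)

lemma bounded_meas_square: "f \<in> bounded_meas \<Longrightarrow> (\<lambda>x. (f x)\<^sup>2) \<in> bounded_meas"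
  unfolding power2_eq_square by (rule bounded_meas_mult)

lemma integral_square_nonneg:
  assumes "f \<in> bounded_meas" "0 \<le> a" "b \<le> 1"
  shows "integral {a..b} (\<lambda>x. (f x)\<^sup>2) \<ge> 0"
  by (intro integral_nonneg bounded_meas_integrable_on bounded_meas_square assms) auto

lemma sum_split_twice:
  fixes g :: "nat \<Rightarrow> real"
  assumes "m \<le> n" "n \<le> N"
  shows "(\<Sum>i\<in>{1..N}. g i) = (\<Sum>i\<in>{1..m}. g i) + (\<Sum>i\<in>{Suc m..n}. g i) + (\<Sum>i\<in>{Suc n..N}. g i)"
proof -
  have "{1..N} = ({1..m} \<union> {Suc m..n}) \<union> {Suc n..N}" using assms by auto
  moreover have "sum g (({1..m} \<union> {Suc m..n}) \<union> {Suc n..N}) = sum g ({1..m} \<union> {Suc m..n}) + sum g {Suc n..N}"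
    using assms by (intro sum.union_disjoint) auto
  moreover have "sum g ({1..m} \<union> {Suc m..n}) = sum g {1..m} + sum g {Suc m..n}"
    by (intro sum.union_disjoint) auto
  ultimately show ?thesis by simp
qed

lemma deriv_chain_bounded_meas: "deriv_chain 0 1 m G \<Longrightarrow> k \<le> m \<Longrightarrow> G k \<in> bounded_meas"
  by (simp add: deriv_chain_def bounded_meas_continuous)

lemma spline_triple_bounded_meas:
  assumes "spline_triple p N xs C c c1 c2"
  shows "c \<in> bounded_meas" "c1 \<in> bounded_meas" "c2 \<in> bounded_meas"
  using assms pw_C2_bounded_meas unfolding spline_triple_def by blast+

lemma interpolates_orthogonal:
  assumes mesh: "mesh N xs" and Q: "interpolates p N xs G Q"
    and C: "spline_triple p N xs C c c1 c2" and i: "i \<in> {1..N}"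
  shows "integral {xs (i - 1)..xs i} (\<lambda>x. (G 2 x - poly (pderiv (pderiv (Q i))) x) * c2 x) = 0"
proof -
  have "integral {xs (i - 1)..xs i} (\<lambda>x. (G 2 x - poly (pderiv (pderiv (Q i))) x) * c2 x) =
    integral {xs (i - 1)..xs i} (\<lambda>x. (G 2 x - poly (pderiv (pderiv (Q i))) x) * poly (pderiv (pderiv (C i))) x)"
    using C i by (intro integral_cong_open) (simp add: spline_triple_def)
  also have "\<dots> = 0"
  proof -
    have "degree (pderiv (pderiv (C i))) \<le> p - 2"
    proof -
      have "degree (C i) \<le> p" using C i by (simp add: spline_triple_def)
      then show ?thesis by (simp add: degree_pderiv)
    qed
    then show ?thesis using Q i unfolding interpolates_def local_interpolant_def by blast
  qed
  finally show ?thesis .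
qed

text \<open>The interpolant minus a spline with pieces \<open>T\<close>. Since the uncorrected error has a second derivative orthogonal to those of all
splines, only the correction is left in that pairing.\<close>

lemma corrected_interpolant:
  fixes T :: "nat \<Rightarrow> real poly"
  assumes mesh: "mesh N xs" and p: "p \<ge> 3" and G: "deriv_chain 0 1 (p + 1) G"
    and Q: "interpolates p N xs G Q" and degT: "\<And>i. i \<in> {1..N} \<Longrightarrow> degree (T i) \<le> p"
    and matchT: "\<And>i. 1 \<le> i \<Longrightarrow> i < N \<Longrightarrow> poly (T i) (xs i) = poly (T (Suc i)) (xs i)"
      "\<And>i. 1 \<le> i \<Longrightarrow> i < N \<Longrightarrow> poly (pderiv (T i)) (xs i) = poly (pderiv (T (Suc i))) (xs i)"
    and endsT: "poly (T 1) 0 = 0" "poly (pderiv (T 1)) 0 = 0" "poly (T N) 1 = 0" "poly (pderiv (T N)) 1 = 0"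
  obtains U U1 U2 where "spline_triple p N xs (\<lambda>i. Q i - T i) U U1 U2"
    "\<And>\<xi>. \<xi> \<in> {0, 1} \<Longrightarrow> U \<xi> = G 0 \<xi> \<and> U1 \<xi> = G 1 \<xi>"
    "\<And>C c c1 c2. spline_triple p N xs C c c1 c2 \<Longrightarrow> L2_inner (\<lambda>x. G 2 x - U2 x) c2 =
       (\<Sum>i\<in>{1..N}. integral {xs (i - 1)..xs i} (\<lambda>x. poly (pderiv (pderiv (T i))) x * c2 x))"
    "\<And>i. i \<in> {1..N} \<Longrightarrow> integral {xs (i - 1)..xs i} (\<lambda>x. (G 0 x - U x)\<^sup>2) =
       integral {xs (i - 1)..xs i} (\<lambda>x. (G 0 x - poly (Q i) x + poly (T i) x)\<^sup>2)"
proof -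
  have Qi: "degree (Q i) \<le> p" "poly (Q i) (xs (i - 1)) = G 0 (xs (i - 1))" "poly (Q i) (xs i) = G 0 (xs i)"
    "poly (pderiv (Q i)) (xs (i - 1)) = G 1 (xs (i - 1))" "poly (pderiv (Q i)) (xs i) = G 1 (xs i)"
    if "i \<in> {1..N}" for i
    using Q that unfolding interpolates_def local_interpolant_def by auto
  have Qnext: "poly (Q (Suc i)) (xs i) = G 0 (xs i)" "poly (pderiv (Q (Suc i))) (xs i) = G 1 (xs i)"
    if "i < N" for i
    using Qi[of "Suc i"] that by auto
  obtain U U1 U2 where U: "spline_triple p N xs (\<lambda>i. Q i - T i) U U1 U2"
    "U 0 = poly (Q 1 - T 1) 0" "U1 0 = poly (pderiv (Q 1 - T 1)) 0"
    "U 1 = poly (Q N - T N) 1" "U1 1 = poly (pderiv (Q N - T N)) 1"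
  proof (rule glue_polys[OF mesh, of "\<lambda>i. Q i - T i" p])
    show "degree (Q i - T i) \<le> p" if "i \<in> {1..N}" for i
      using Qi(1) degT that by (intro degree_diff_le) auto
  qed (auto simp: pderiv_diff matchT Qi Qnext)
  note N = mesh_pos[OF mesh]
  have x0: "xs 0 = 0" "xs N = 1" using mesh by (auto simp: mesh_def)
  have ends: "U \<xi> = G 0 \<xi> \<and> U1 \<xi> = G 1 \<xi>" if "\<xi> \<in> {0, 1}" for \<xi>
    using that U(2-5) endsT Qi[of N] Qnext[of 0] N x0 by (auto simp: pderiv_diff)
  have G2: "G 2 \<in> bounded_meas" using deriv_chain_bounded_meas[OF G] p by simp
  note U2 = spline_triple_bounded_meas(3)[OF U(1)]
  have orth: "L2_inner (\<lambda>x. G 2 x - U2 x) c2 =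
       (\<Sum>i\<in>{1..N}. integral {xs (i - 1)..xs i} (\<lambda>x. poly (pderiv (pderiv (T i))) x * c2 x))"
    if C: "spline_triple p N xs C c c1 c2" for C c c1 c2
  proof -
    note c2 = spline_triple_bounded_meas(3)[OF C]
    have "L2_inner (\<lambda>x. G 2 x - U2 x) c2 = integral {xs 0..xs N} (\<lambda>x. (G 2 x - U2 x) * c2 x)"
      unfolding x0 by (intro L2_inner_eq_integral bounded_meas_diff G2 U2 c2)
    also have "\<dots> = (\<Sum>i\<in>{Suc 0..N}. integral {xs (i - 1)..xs i} (\<lambda>x. (G 2 x - U2 x) * c2 x))"
      by (intro integral_mesh_sum[OF mesh] bounded_meas_mult bounded_meas_diff G2 U2 c2) auto
    also have "\<dots> = (\<Sum>i\<in>{Suc 0..N}. integral {xs (i - 1)..xs i} (\<lambda>x. poly (pderiv (pderiv (T i))) x * c2 x))"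
    proof (rule sum.cong[OF refl])
      fix i assume "i \<in> {Suc 0..N}"
      then have i: "i \<in> {1..N}" by simp
      let ?K = "{xs (i - 1)..xs i}"
      have K: "0 \<le> xs (i - 1)" "xs i \<le> 1" using i mesh_in_unit[OF mesh] by auto
      have "integral ?K (\<lambda>x. (G 2 x - U2 x) * c2 x) =
        integral ?K (\<lambda>x. (G 2 x - poly (pderiv (pderiv (Q i))) x) * c2 x + poly (pderiv (pderiv (T i))) x * c2 x)"
        using U(1) i by (intro integral_cong_open) (simp add: spline_triple_def pderiv_diff, simp add: algebra_simps)
      also have "\<dots> = integral ?K (\<lambda>x. (G 2 x - poly (pderiv (pderiv (Q i))) x) * c2 x)
          + integral ?K (\<lambda>x. poly (pderiv (pderiv (T i))) x * c2 x)"
        by (intro Henstock_Kurzweil_Integration.integral_add bounded_meas_integrable_on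
            bounded_meas_mult bounded_meas_diff G2 c2 bounded_meas_poly K)
      finally show "integral ?K (\<lambda>x. (G 2 x - U2 x) * c2 x) = integral ?K (\<lambda>x. poly (pderiv (pderiv (T i))) x * c2 x)"
        using interpolates_orthogonal[OF mesh Q C i] by simp
    qed
    finally show ?thesis by simp
  qed
  have sq: "integral {xs (i - 1)..xs i} (\<lambda>x. (G 0 x - U x)\<^sup>2) =
       integral {xs (i - 1)..xs i} (\<lambda>x. (G 0 x - poly (Q i) x + poly (T i) x)\<^sup>2)"
    if "i \<in> {1..N}" for i
    using U(1) that by (intro integral_cong_open) (simp add: spline_triple_def diff_diff_eq2 diff_add_eq)
  show ?thesis by (rule that[OF U(1)], erule ends, erule orth, erule sq)
qed

text \<open>The correction is \<open>d0\<close> up to node \<open>m\<close>, the interpolant itself up to node \<open>n\<close>, and \<open>d1\<close> afterwards; the corrected spline is zero on the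
middle block. In the pairing of second derivatives the interpolant may be replaced by the function on the middle block, again by
orthogonality; thus the coarse elements contribute the small second derivative of the layer part itself.\<close>

lemma layer_adapted_spline:
  assumes mesh: "mesh N xs" and p: "p \<ge> 3" and G: "deriv_chain 0 1 (p + 1) G"
    and mn: "1 \<le> m" "m < n" "n < N"
    and deg: "degree d0 \<le> 3" "degree d1 \<le> 3"
    and d0: "poly d0 0 = 0" "poly (pderiv d0) 0 = 0" "poly d0 (xs m) = G 0 (xs m)" "poly (pderiv d0) (xs m) = G 1 (xs m)"
    and d1: "poly d1 1 = 0" "poly (pderiv d1) 1 = 0" "poly d1 (xs n) = G 0 (xs n)" "poly (pderiv d1) (xs n) = G 1 (xs n)"
    and h: "\<And>i. i \<in> {1..m} \<union> {Suc n..N} \<Longrightarrow> xs i - xs (i - 1) \<le> h"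
  obtains Q U U1 U2 where "spline_triple p N xs Q U U1 U2"
    "\<And>\<xi>. \<xi> \<in> {0, 1} \<Longrightarrow> U \<xi> = G 0 \<xi> \<and> U1 \<xi> = G 1 \<xi>"
    "\<And>C c c1 c2. spline_triple p N xs C c c1 c2 \<Longrightarrow> L2_inner (\<lambda>x. G 2 x - U2 x) c2 =
       integral {0..xs m} (\<lambda>x. poly (pderiv (pderiv d0)) x * c2 x) + integral {xs m..xs n} (\<lambda>x. G 2 x * c2 x)
       + integral {xs n..1} (\<lambda>x. poly (pderiv (pderiv d1)) x * c2 x)"
    "L2_inner (\<lambda>x. G 0 x - U x) (\<lambda>x. G 0 x - U x) \<le> 2 * (h ^ (p + 1))\<^sup>2 * integral {0..1} (\<lambda>x. (G (p + 1) x)\<^sup>2)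
       + 2 * integral {0..xs m} (\<lambda>x. (poly d0 x)\<^sup>2) + 2 * integral {xs n..1} (\<lambda>x. (poly d1 x)\<^sup>2)
       + integral {xs m..xs n} (\<lambda>x. (G 0 x)\<^sup>2)"
proof -
  obtain Q where Q: "interpolates p N xs G Q" using interpolates_exists[OF mesh p G] by blast
  have Qi: "degree (Q i) \<le> p" "poly (Q i) (xs i) = G 0 (xs i)" "poly (pderiv (Q i)) (xs i) = G 1 (xs i)"
    "integral {xs (i - 1)..xs i} (\<lambda>x. (G 0 x - poly (Q i) x)\<^sup>2) \<le>
      ((xs i - xs (i - 1)) ^ (p + 1))\<^sup>2 * integral {xs (i - 1)..xs i} (\<lambda>x. (G (p + 1) x)\<^sup>2)"
    if "i \<in> {1..N}" for i
    using Q that unfolding interpolates_def local_interpolant_def by auto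
  have Qnext: "poly (Q (Suc i)) (xs i) = G 0 (xs i)" "poly (pderiv (Q (Suc i))) (xs i) = G 1 (xs i)"
    if "i < N" for i
    using Q that unfolding interpolates_def local_interpolant_def by (auto dest!: bspec[of _ _ "Suc i"])
  define T where "T = (\<lambda>i. if i \<le> m then d0 else if i \<le> n then Q i else d1)"
  have x0: "xs 0 = 0" "xs N = 1" using mesh by (auto simp: mesh_def)
  have bm: "G k \<in> bounded_meas" if "k \<le> p + 1" for k using deriv_chain_bounded_meas[OF G that] .
  have bm0: "G 0 \<in> bounded_meas" "G 2 \<in> bounded_meas" "G (p + 1) \<in> bounded_meas" using bm p by auto
  obtain U U1 U2 where U: "spline_triple p N xs (\<lambda>i. Q i - T i) U U1 U2"
    "\<And>\<xi>. \<xi> \<in> {0, 1} \<Longrightarrow> U \<xi> = G 0 \<xi> \<and> U1 \<xi> = G 1 \<xi>"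
    "\<And>C c c1 c2. spline_triple p N xs C c c1 c2 \<Longrightarrow> L2_inner (\<lambda>x. G 2 x - U2 x) c2 =
       (\<Sum>i\<in>{1..N}. integral {xs (i - 1)..xs i} (\<lambda>x. poly (pderiv (pderiv (T i))) x * c2 x))"
    "\<And>i. i \<in> {1..N} \<Longrightarrow> integral {xs (i - 1)..xs i} (\<lambda>x. (G 0 x - U x)\<^sup>2) =
       integral {xs (i - 1)..xs i} (\<lambda>x. (G 0 x - poly (Q i) x + poly (T i) x)\<^sup>2)"
  proof (rule corrected_interpolant[OF mesh p G Q, of T])
    show "degree (T i) \<le> p" if "i \<in> {1..N}" for i
      using that Qi(1) deg p by (auto simp: T_def)
    fix i assume i: "1 \<le> i" "i < N"
    consider "i < m" | "i = m" | "m < i" "i < n" | "i = n" | "n < i" by linarith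
    then show "poly (T i) (xs i) = poly (T (Suc i)) (xs i)"
      by cases (use i mn d0 d1 Qi[of i] Qnext[of i] in \<open>auto simp: T_def\<close>)
    consider "i < m" | "i = m" | "m < i" "i < n" | "i = n" | "n < i" by linarith
    then show "poly (pderiv (T i)) (xs i) = poly (pderiv (T (Suc i))) (xs i)"
      by cases (use i mn d0 d1 Qi[of i] Qnext[of i] in \<open>auto simp: T_def\<close>)
  qed (use mn d0 d1 in \<open>auto simp: T_def\<close>)
  have blocks: "integral {0..xs m} f = (\<Sum>i\<in>{1..m}. integral {xs (i - 1)..xs i} f)"
    "integral {xs m..xs n} f = (\<Sum>i\<in>{Suc m..n}. integral {xs (i - 1)..xs i} f)"
    "integral {xs n..1} f = (\<Sum>i\<in>{Suc n..N}. integral {xs (i - 1)..xs i} f)"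
    "integral {0..1} f = (\<Sum>i\<in>{1..N}. integral {xs (i - 1)..xs i} f)"
    if "f \<in> bounded_meas" for f
    using integral_mesh_sum[OF mesh that, of 0 m] integral_mesh_sum[OF mesh that, of m n]
      integral_mesh_sum[OF mesh that, of n N] integral_mesh_sum[OF mesh that, of 0 N] mn x0 by auto
  have K: "0 \<le> xs (i - 1)" "xs i \<le> 1" if "i \<in> {1..N}" for i
    using that mesh_in_unit[OF mesh] by auto
  have orth: "L2_inner (\<lambda>x. G 2 x - U2 x) c2 =
       integral {0..xs m} (\<lambda>x. poly (pderiv (pderiv d0)) x * c2 x) + integral {xs m..xs n} (\<lambda>x. G 2 x * c2 x)
       + integral {xs n..1} (\<lambda>x. poly (pderiv (pderiv d1)) x * c2 x)"
    if C: "spline_triple p N xs C c c1 c2" for C c c1 c2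
  proof -
    note c2 = spline_triple_bounded_meas(3)[OF C]
    let ?I = "\<lambda>i f. integral {xs (i - 1)..xs i} (\<lambda>x. f x * c2 x)"
    have mid: "?I i (poly (pderiv (pderiv (Q i)))) = ?I i (G 2)" if i: "i \<in> {1..N}" for i
    proof -
      have "integral {xs (i - 1)..xs i} (\<lambda>x. (G 2 x - poly (pderiv (pderiv (Q i))) x) * c2 x) =
        ?I i (G 2) - ?I i (poly (pderiv (pderiv (Q i))))"
        unfolding left_diff_distrib
        by (intro Henstock_Kurzweil_Integration.integral_diff bounded_meas_integrable_on
            bounded_meas_mult bm0 c2 bounded_meas_poly K i)
      then show ?thesis using interpolates_orthogonal[OF mesh Q C i] by simp
    qed
    have "L2_inner (\<lambda>x. G 2 x - U2 x) c2 = (\<Sum>i\<in>{1..m}. ?I i (poly (pderiv (pderiv (T i)))))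
       + (\<Sum>i\<in>{Suc m..n}. ?I i (poly (pderiv (pderiv (T i))))) + (\<Sum>i\<in>{Suc n..N}. ?I i (poly (pderiv (pderiv (T i)))))"
      unfolding U(3)[OF C] using mn by (intro sum_split_twice) auto
    also have "(\<Sum>i\<in>{1..m}. ?I i (poly (pderiv (pderiv (T i))))) = integral {0..xs m} (\<lambda>x. poly (pderiv (pderiv d0)) x * c2 x)"
      by (simp add: blocks(1) bounded_meas_mult c2 T_def)
    also have "(\<Sum>i\<in>{Suc m..n}. ?I i (poly (pderiv (pderiv (T i))))) = integral {xs m..xs n} (\<lambda>x. G 2 x * c2 x)"
      unfolding blocks(2)[OF bounded_meas_mult[OF bm0(2) c2]]
      using mn mid by (intro sum.cong) (auto simp: T_def)
    also have "(\<Sum>i\<in>{Suc n..N}. ?I i (poly (pderiv (pderiv (T i))))) = integral {xs n..1} (\<lambda>x. poly (pderiv (pderiv d1)) x * c2 x)"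
      unfolding blocks(3)[OF bounded_meas_mult[OF bounded_meas_poly c2]]
      using mn by (intro sum.cong) (auto simp: T_def)
    finally show ?thesis .
  qed
  have aU: "(\<lambda>x. G 0 x - U x) \<in> bounded_meas"
    by (intro bounded_meas_diff bm0 spline_triple_bounded_meas(1)[OF U(1)])
  let ?J = "\<lambda>i f. integral {xs (i - 1)..xs i} (\<lambda>x. (f x)\<^sup>2)"
  have fine: "?J i (\<lambda>x. G 0 x - U x) \<le> 2 * (h ^ (p + 1))\<^sup>2 * ?J i (G (p + 1)) + 2 * ?J i (poly d)"
    if i: "i \<in> {1..m} \<union> {Suc n..N}" and d: "T i = d" for i d
  proof -
    have iN: "i \<in> {1..N}" using i mn by auto
    have "?J i (\<lambda>x. G 0 x - U x) = integral {xs (i - 1)..xs i} (\<lambda>x. (G 0 x - poly (Q i) x + poly d x)\<^sup>2)"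
      using U(4)[OF iN] d by simp
    also have "\<dots> \<le> integral {xs (i - 1)..xs i} (\<lambda>x. 2 * (G 0 x - poly (Q i) x)\<^sup>2 + 2 * (poly d x)\<^sup>2)"
    proof (rule integral_le)
      show "(\<lambda>x. (G 0 x - poly (Q i) x + poly d x)\<^sup>2) integrable_on {xs (i - 1)..xs i}"
        by (intro bounded_meas_integrable_on bounded_meas_square bounded_meas_add bounded_meas_diff bm0 bounded_meas_poly K iN)
      show "(\<lambda>x. 2 * (G 0 x - poly (Q i) x)\<^sup>2 + 2 * (poly d x)\<^sup>2) integrable_on {xs (i - 1)..xs i}"
        by (intro bounded_meas_integrable_on bounded_meas_add bounded_meas_cmult bounded_meas_square bounded_meas_diff bm0 bounded_meas_poly K iN)
      show "(G 0 x - poly (Q i) x + poly d x)\<^sup>2 \<le> 2 * (G 0 x - poly (Q i) x)\<^sup>2 + 2 * (poly d x)\<^sup>2" for x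
        using zero_le_power2[of "(G 0 x - poly (Q i) x) - poly d x"] by (simp add: power2_eq_square algebra_simps)
    qed
    also have "\<dots> = 2 * ?J i (\<lambda>x. G 0 x - poly (Q i) x) + 2 * ?J i (poly d)"
      by (intro integral_unique has_integral_add has_integral_mult_right integrable_integral
          bounded_meas_integrable_on bounded_meas_square bounded_meas_diff bm0 bounded_meas_poly K iN)
    also have "?J i (\<lambda>x. G 0 x - poly (Q i) x) \<le> (h ^ (p + 1))\<^sup>2 * ?J i (G (p + 1))"
    proof (rule order_trans[OF Qi(4)[OF iN]], rule mult_right_mono)
      have "0 \<le> xs i - xs (i - 1)" using mesh_less[OF mesh, of "i - 1" i] iN by auto
      then show "((xs i - xs (i - 1)) ^ (p + 1))\<^sup>2 \<le> (h ^ (p + 1))\<^sup>2"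
        using h[OF i] by (intro power_mono) auto
      show "0 \<le> ?J i (G (p + 1))" by (intro integral_square_nonneg bm0 K iN)
    qed
    finally show ?thesis by simp
  qed
  have "L2_inner (\<lambda>x. G 0 x - U x) (\<lambda>x. G 0 x - U x) = integral {0..1} (\<lambda>x. (G 0 x - U x)\<^sup>2)"
    using aU by (simp add: L2_inner_eq_integral power2_eq_square)
  also have "\<dots> = (\<Sum>i\<in>{1..N}. ?J i (\<lambda>x. G 0 x - U x))"
    by (rule blocks(4)[OF bounded_meas_square[OF aU]])
  also have "\<dots> = (\<Sum>i\<in>{1..m}. ?J i (\<lambda>x. G 0 x - U x)) + (\<Sum>i\<in>{Suc m..n}. ?J i (\<lambda>x. G 0 x - U x))
      + (\<Sum>i\<in>{Suc n..N}. ?J i (\<lambda>x. G 0 x - U x))"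
    using mn by (intro sum_split_twice) auto
  also have "(\<Sum>i\<in>{1..m}. ?J i (\<lambda>x. G 0 x - U x)) \<le>
      (\<Sum>i\<in>{1..m}. 2 * (h ^ (p + 1))\<^sup>2 * ?J i (G (p + 1)) + 2 * ?J i (poly d0))"
    by (intro sum_mono fine) (auto simp: T_def)
  also have "(\<Sum>i\<in>{Suc n..N}. ?J i (\<lambda>x. G 0 x - U x)) \<le>
      (\<Sum>i\<in>{Suc n..N}. 2 * (h ^ (p + 1))\<^sup>2 * ?J i (G (p + 1)) + 2 * ?J i (poly d1))"
    using mn by (intro sum_mono fine) (auto simp: T_def)
  also have "(\<Sum>i\<in>{Suc m..n}. ?J i (\<lambda>x. G 0 x - U x)) = integral {xs m..xs n} (\<lambda>x. (G 0 x)\<^sup>2)"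
    unfolding blocks(2)[OF bounded_meas_square[OF bm0(1)]]
    using U(4) mn by (intro sum.cong) (auto simp: T_def)
  finally have est: "L2_inner (\<lambda>x. G 0 x - U x) (\<lambda>x. G 0 x - U x) \<le>
     2 * (h ^ (p + 1))\<^sup>2 * (integral {0..xs m} (\<lambda>x. (G (p + 1) x)\<^sup>2) + integral {xs n..1} (\<lambda>x. (G (p + 1) x)\<^sup>2))
       + 2 * integral {0..xs m} (\<lambda>x. (poly d0 x)\<^sup>2) + 2 * integral {xs n..1} (\<lambda>x. (poly d1 x)\<^sup>2)
       + integral {xs m..xs n} (\<lambda>x. (G 0 x)\<^sup>2)"
    unfolding blocks(1)[OF bounded_meas_square[OF bm0(3)]] blocks(3)[OF bounded_meas_square[OF bm0(3)]]
      blocks(1)[OF bounded_meas_square[OF bounded_meas_poly]] blocks(3)[OF bounded_meas_square[OF bounded_meas_poly]]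
    by (simp add: sum.distrib sum_distrib_left algebra_simps)
  have "integral {0..xs m} (\<lambda>x. (G (p + 1) x)\<^sup>2) + integral {xs n..1} (\<lambda>x. (G (p + 1) x)\<^sup>2)
      \<le> integral {0..1} (\<lambda>x. (G (p + 1) x)\<^sup>2)"
  proof -
    have "integral {0..1} (\<lambda>x. (G (p + 1) x)\<^sup>2) = integral {0..xs m} (\<lambda>x. (G (p + 1) x)\<^sup>2)
      + integral {xs m..xs n} (\<lambda>x. (G (p + 1) x)\<^sup>2) + integral {xs n..1} (\<lambda>x. (G (p + 1) x)\<^sup>2)"
      unfolding blocks[OF bounded_meas_square[OF bm0(3)]] using mn by (intro sum_split_twice) auto
    moreover have "integral {xs m..xs n} (\<lambda>x. (G (p + 1) x)\<^sup>2) \<ge> 0"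
      using mn mesh_in_unit[OF mesh] by (intro integral_square_nonneg bm0) auto
    ultimately show ?thesis by linarith
  qed
  then have "2 * (h ^ (p + 1))\<^sup>2 * (integral {0..xs m} (\<lambda>x. (G (p + 1) x)\<^sup>2) + integral {xs n..1} (\<lambda>x. (G (p + 1) x)\<^sup>2))
    \<le> 2 * (h ^ (p + 1))\<^sup>2 * integral {0..1} (\<lambda>x. (G (p + 1) x)\<^sup>2)"
    by (intro mult_left_mono) auto
  with est have final: "L2_inner (\<lambda>x. G 0 x - U x) (\<lambda>x. G 0 x - U x) \<le> 2 * (h ^ (p + 1))\<^sup>2 * integral {0..1} (\<lambda>x. (G (p + 1) x)\<^sup>2)
       + 2 * integral {0..xs m} (\<lambda>x. (poly d0 x)\<^sup>2) + 2 * integral {xs n..1} (\<lambda>x. (poly d1 x)\<^sup>2)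
       + integral {xs m..xs n} (\<lambda>x. (G 0 x)\<^sup>2)" by linarith
  show ?thesis by (rule that[OF U(1)], erule U(2), erule orth, rule final)
qed

text \<open>The Hermite cubic with zero data at \<open>e\<close> and data \<open>A\<close>, \<open>B\<close> at \<open>g\<close>. Either end may be the left one, which serves both layers.\<close>

lemma cubic_end_correction:
  fixes e g A B :: real
  assumes "e \<noteq> g"
  obtains d where "degree d \<le> 3" "poly d e = 0" "poly (pderiv d) e = 0" "poly d g = A" "poly (pderiv d) g = B"
    "\<And>x. min e g \<le> x \<Longrightarrow> x \<le> max e g \<Longrightarrow> \<bar>poly d x\<bar> \<le> \<bar>A\<bar> + \<bar>g - e\<bar> * \<bar>B\<bar> \<and>
      \<bar>poly (pderiv (pderiv d)) x\<bar> \<le> (6 * \<bar>A\<bar> + 4 * \<bar>g - e\<bar> * \<bar>B\<bar>) / (g - e)\<^sup>2"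
proof -
  define h where "h = g - e"
  have h: "h \<noteq> 0" using assms by (simp add: h_def)
  define t where "t = (\<lambda>x. (x - e) / h)"
  define l where "l = [:- e / h, 1 / h:]"
  have l: "poly l x = t x" "pderiv l = [:1 / h:]" "degree l \<le> 1" for x
    by (simp_all add: l_def t_def pderiv_pCons diff_divide_distrib)
  define d where "d = pcompose [:0, 0, 3 * A - B * h, B * h - 2 * A:] l"
  have dx: "poly d x = A * ((t x)\<^sup>2 * (3 - 2 * t x)) + B * h * ((t x)\<^sup>2 * (t x - 1))" for x
    by (simp add: d_def poly_pcompose l power2_eq_square algebra_simps)
  have d1x: "poly (pderiv d) x = (1 / h) * (A * (6 * t x - 6 * (t x)\<^sup>2) + B * h * (3 * (t x)\<^sup>2 - 2 * t x))" for x
    using h by (simp add: d_def pderiv_pcompose pderiv_pCons poly_pcompose l power2_eq_square field_simps)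
  have d2x: "poly (pderiv (pderiv d)) x = (1 / h)\<^sup>2 * (A * (6 - 12 * t x) + B * h * (6 * t x - 2))" for x
    using h by (simp add: d_def pderiv_pcompose pderiv_mult pderiv_smult pderiv_pCons poly_pcompose l power2_eq_square field_simps)
  show ?thesis
  proof (rule that[of d])
    have "degree d \<le> 3 * 1" unfolding d_def degree_pcompose using l(3) by (intro mult_le_mono) (auto intro: order_trans[OF degree_pCons_le])
    then show "degree d \<le> 3" by simp
    have te: "t e = 0" "t g = 1" using h by (auto simp: t_def h_def)
    show "poly d e = 0" "poly (pderiv d) e = 0" "poly d g = A" "poly (pderiv d) g = B"
      using h by (simp_all add: dx d1x te)
    fix x assume x: "min e g \<le> x" "x \<le> max e g"
    have t0: "0 \<le> t x" "t x \<le> 1"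
      using x h by (auto simp: t_def h_def divide_simps min_def max_def split: if_splits)
    define y where "y = t x"
    have y: "0 \<le> y" "y \<le> 1" using t0 by (auto simp: y_def)
    have b1: "\<bar>y\<^sup>2 * (3 - 2 * y)\<bar> \<le> 1"
    proof -
      have "1 - y\<^sup>2 * (3 - 2 * y) = (1 - y)\<^sup>2 * (1 + 2 * y)" by (simp add: power2_eq_square algebra_simps)
      moreover have "(1 - y)\<^sup>2 * (1 + 2 * y) \<ge> 0" "y\<^sup>2 * (3 - 2 * y) \<ge> 0" using y by auto
      ultimately show ?thesis by linarith
    qed
    have b2: "\<bar>y\<^sup>2 * (y - 1)\<bar> \<le> 1"
      unfolding abs_mult using y by (intro mult_le_one) (auto simp: power_le_one)
    have b3: "\<bar>6 - 12 * y\<bar> \<le> 6" "\<bar>6 * y - 2\<bar> \<le> 4" using y by auto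
    have "\<bar>poly d x\<bar> \<le> \<bar>A * (y\<^sup>2 * (3 - 2 * y))\<bar> + \<bar>B * h * (y\<^sup>2 * (y - 1))\<bar>"
      unfolding dx y_def by (rule abs_triangle_ineq)
    also have "\<dots> \<le> \<bar>A\<bar> * 1 + \<bar>B * h\<bar> * 1"
      unfolding abs_mult[of A] abs_mult[of "B * h"] using b1 b2 by (intro add_mono mult_left_mono) auto
    finally have 1: "\<bar>poly d x\<bar> \<le> \<bar>A\<bar> + \<bar>g - e\<bar> * \<bar>B\<bar>" by (simp add: h_def abs_mult mult.commute)
    have "\<bar>A * (6 - 12 * y) + B * h * (6 * y - 2)\<bar> \<le> \<bar>A * (6 - 12 * y)\<bar> + \<bar>B * h * (6 * y - 2)\<bar>"
      by (rule abs_triangle_ineq)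
    also have "\<dots> \<le> \<bar>A\<bar> * 6 + \<bar>B * h\<bar> * 4"
      unfolding abs_mult[of A] abs_mult[of "B * h"] using b3 by (intro add_mono mult_left_mono) auto
    finally have "(1 / h)\<^sup>2 * \<bar>A * (6 - 12 * y) + B * h * (6 * y - 2)\<bar> \<le> (1 / h)\<^sup>2 * (\<bar>A\<bar> * 6 + \<bar>B * h\<bar> * 4)"
      by (intro mult_left_mono) auto
    then have 2: "\<bar>poly (pderiv (pderiv d)) x\<bar> \<le> (6 * \<bar>A\<bar> + 4 * \<bar>g - e\<bar> * \<bar>B\<bar>) / (g - e)\<^sup>2"
      by (simp add: d2x y_def abs_mult h_def power_divide mult_ac)
    show "\<bar>poly d x\<bar> \<le> \<bar>A\<bar> + \<bar>g - e\<bar> * \<bar>B\<bar> \<and>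
      \<bar>poly (pderiv (pderiv d)) x\<bar> \<le> (6 * \<bar>A\<bar> + 4 * \<bar>g - e\<bar> * \<bar>B\<bar>) / (g - e)\<^sup>2" using 1 2 by simp
  qed
qed

section \<open>The Shishkin mesh and the boundary layers\<close>

text \<open>At the two transition points neighbouring formulas agree, so each of them holds on a closed block of indices.\<close>

lemma shishkin_eq:
  fixes \<sigma> eps :: real and M i :: nat
  assumes N: "N = 4 * M" "M > 0" and \<tau>: "\<tau> = \<sigma> * eps * ln (real N)"
  shows "i \<le> M \<Longrightarrow> shishkin \<sigma> eps N i = real i * (\<tau> / real M)"
    and "M \<le> i \<Longrightarrow> i \<le> 3 * M \<Longrightarrow> shishkin \<sigma> eps N i = \<tau> + (real i - real M) * ((1 - 2 * \<tau>) / (2 * real M))"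
    and "3 * M \<le> i \<Longrightarrow> shishkin \<sigma> eps N i = (1 - \<tau>) + (real i - 3 * real M) * (\<tau> / real M)"
proof -
  have "N div 4 = M" "real N / 4 = real M" using N by auto
  then have eq: "shishkin \<sigma> eps N i = (if i \<le> M then real i * (\<tau> / real M)
      else if i \<le> 3 * M then \<tau> + (real i - real M) * ((1 - 2 * \<tau>) / (2 * real M))
      else (1 - \<tau>) + (real i - 3 * real M) * (\<tau> / real M))"
    unfolding shishkin_def Let_def \<tau> by simp
  show "i \<le> M \<Longrightarrow> shishkin \<sigma> eps N i = real i * (\<tau> / real M)" by (simp add: eq)
  show "M \<le> i \<Longrightarrow> i \<le> 3 * M \<Longrightarrow> shishkin \<sigma> eps N i = \<tau> + (real i - real M) * ((1 - 2 * \<tau>) / (2 * real M))"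
    unfolding eq using N(2) by (cases "i = M") simp_all
  show "3 * M \<le> i \<Longrightarrow> shishkin \<sigma> eps N i = (1 - \<tau>) + (real i - 3 * real M) * (\<tau> / real M)"
    unfolding eq using N(2) by (cases "i = 3 * M") simp_all
qed

lemma shishkin_mesh:
  fixes \<sigma> eps :: real
  assumes N: "N = 4 * M" "M > 0" and \<tau>: "\<tau> = \<sigma> * eps * ln (real N)" "0 < \<tau>" "\<tau> \<le> 1 / 4"
  shows "mesh N (shishkin \<sigma> eps N)" "shishkin \<sigma> eps N M = \<tau>" "shishkin \<sigma> eps N (3 * M) = 1 - \<tau>"
    "\<And>i. i \<in> {1..M} \<union> {Suc (3 * M)..N} \<Longrightarrow> shishkin \<sigma> eps N i - shishkin \<sigma> eps N (i - 1) = \<tau> / real M"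
    "\<And>i. i \<in> {Suc M..3 * M} \<Longrightarrow> shishkin \<sigma> eps N i - shishkin \<sigma> eps N (i - 1) = (1 - 2 * \<tau>) / (2 * real M)"
proof -
  let ?x = "shishkin \<sigma> eps N"
  note eq = shishkin_eq[OF N \<tau>(1)]
  show *: "?x i - ?x (i - 1) = \<tau> / real M" if "i \<in> {1..M} \<union> {Suc (3 * M)..N}" for i
  proof (cases "i \<le> M")
    case True
    then have "?x i = real i * (\<tau> / real M)" "?x (i - 1) = real (i - 1) * (\<tau> / real M)"
      using eq(1)[of i] eq(1)[of "i - 1"] by simp_all
    moreover have "real (i - 1) = real i - 1" using that by (auto simp: of_nat_diff)
    ultimately show ?thesis by (simp add: left_diff_distrib diff_divide_distrib)
  next
    case False
    then have "3 * M \<le> i" "3 * M \<le> i - 1" using that by auto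
    then have "?x i = (1 - \<tau>) + (real i - 3 * real M) * (\<tau> / real M)"
      "?x (i - 1) = (1 - \<tau>) + (real (i - 1) - 3 * real M) * (\<tau> / real M)"
      using eq(3)[of i] eq(3)[of "i - 1"] by simp_all
    moreover have "real (i - 1) = real i - 1" using that by (auto simp: of_nat_diff)
    ultimately show ?thesis by (simp add: left_diff_distrib diff_divide_distrib)
  qed
  show **: "?x i - ?x (i - 1) = (1 - 2 * \<tau>) / (2 * real M)" if "i \<in> {Suc M..3 * M}" for i
  proof -
    have "M \<le> i" "i \<le> 3 * M" "M \<le> i - 1" "i - 1 \<le> 3 * M" using that by auto
    then have "?x i = \<tau> + (real i - real M) * ((1 - 2 * \<tau>) / (2 * real M))"
      "?x (i - 1) = \<tau> + (real (i - 1) - real M) * ((1 - 2 * \<tau>) / (2 * real M))"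
      using eq(2)[of i] eq(2)[of "i - 1"] by simp_all
    moreover have "real (i - 1) = real i - 1" using that by (auto simp: of_nat_diff)
    ultimately show ?thesis by (simp add: left_diff_distrib diff_divide_distrib)
  qed
  show "?x M = \<tau>" using eq(1)[of M] N by simp
  show "?x (3 * M) = 1 - \<tau>" using eq(3)[of "3 * M"] by simp
  have "?x 0 = 0" using eq(1)[of 0] by simp
  moreover have "?x N = 1" using eq(3)[of N] N by (simp add: field_simps)
  moreover have "?x i < ?x (Suc i)" if "i < N" for i
  proof -
    have "?x (Suc i) - ?x i > 0"
    proof (cases "M \<le> i \<and> i < 3 * M")
      case True
      then have "Suc i \<in> {Suc M..3 * M}" by simp
      from **[OF this] show ?thesis using \<tau> N by simp
    next
      case False
      then have "Suc i \<in> {1..M} \<union> {Suc (3 * M)..N}" using that by auto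
      from *[OF this] show ?thesis using \<tau> N by simp
    qed
    then show ?thesis by simp
  qed
  ultimately show "mesh N ?x" by (simp add: mesh_def)
qed

definition layer_weight :: "real \<Rightarrow> real \<Rightarrow> real" where
  "layer_weight eps x = exp (- x / eps) + exp (- (1 - x) / eps)"

lemma layer_weight_nonneg: "layer_weight eps x \<ge> 0"
  by (simp add: layer_weight_def add_nonneg_nonneg)

lemma layer_weight_continuous: "eps > 0 \<Longrightarrow> continuous_on A (layer_weight eps)"
  unfolding layer_weight_def by (intro continuous_intros) auto

lemma integral_layer_weight_square:
  assumes eps: "eps > 0" and a: "0 \<le> a" "a \<le> 1 / 2"
  shows "integral {a..1 - a} (\<lambda>x. (layer_weight eps x)\<^sup>2) \<le> 2 * eps * (exp (- a / eps))\<^sup>2"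
proof -
  let ?f = "\<lambda>x. 2 * exp (- 2 * x / eps) + 2 * exp (- 2 * (1 - x) / eps)"
  let ?F = "\<lambda>x. - eps * exp (- 2 * x / eps) + eps * exp (- 2 * (1 - x) / eps)"
  have sq: "(exp y)\<^sup>2 = exp (2 * y)" for y :: real by (simp add: exp_double)
  have "integral {a..1 - a} (\<lambda>x. (layer_weight eps x)\<^sup>2) \<le> integral {a..1 - a} ?f"
  proof (rule integral_le)
    show "(\<lambda>x. (layer_weight eps x)\<^sup>2) integrable_on {a..1 - a}"
      using eps by (intro integrable_continuous_real continuous_intros layer_weight_continuous)
    show "?f integrable_on {a..1 - a}"
      using eps by (intro integrable_continuous_real continuous_intros) auto
    fix x
    have "(u + v)\<^sup>2 \<le> 2 * u\<^sup>2 + 2 * v\<^sup>2" for u v :: real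
      using zero_le_power2[of "u - v"] by (simp add: power2_eq_square algebra_simps)
    from this[of "exp (- x / eps)" "exp (- (1 - x) / eps)"]
    show "(layer_weight eps x)\<^sup>2 \<le> ?f x" by (simp add: layer_weight_def sq)
  qed
  also have "\<dots> = ?F (1 - a) - ?F a"
    using eps a by (intro integral_unique fundamental_theorem_of_calculus)
      (auto simp: has_real_derivative_iff_has_vector_derivative[symmetric] intro!: derivative_eq_intros)
  also have "\<dots> \<le> 2 * eps * exp (- 2 * a / eps)" using eps by simp
  also have "exp (- 2 * a / eps) = (exp (- a / eps))\<^sup>2" by (simp add: sq)
  finally show ?thesis .
qed

lemma integral_square_le_norm:
  assumes f: "f \<in> bounded_meas" and ab: "0 \<le> a" "b \<le> 1"
  shows "integral {a..b} (\<lambda>x. (f x)\<^sup>2) \<le> (L2_norm f)\<^sup>2"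
proof -
  have "integral {a..b} (\<lambda>x. (f x)\<^sup>2) \<le> integral {0..1} (\<lambda>x. (f x)\<^sup>2)"
    using ab by (intro integral_subset_le bounded_meas_integrable_on bounded_meas_square f) auto
  also have "\<dots> = (L2_norm f)\<^sup>2"
    unfolding L2_norm_square L2_inner_eq_integral[OF f f] by (simp only: power2_eq_square)
  finally show ?thesis .
qed

lemma block_Cauchy_Schwarz:
  assumes f: "f \<in> bounded_meas" and g: "g \<in> bounded_meas" and ab: "0 \<le> a" "b \<le> 1"
    and k: "integral {a..b} (\<lambda>x. (f x)\<^sup>2) \<le> k\<^sup>2" "k \<ge> 0"
    and l: "integral {a..b} (\<lambda>x. (g x)\<^sup>2) \<le> l\<^sup>2" "l \<ge> 0"
  shows "\<bar>integral {a..b} (\<lambda>x. f x * g x)\<bar> \<le> k * l"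
proof (rule power2_le_imp_le)
  have "(integral {a..b} (\<lambda>x. f x * g x))\<^sup>2 \<le> integral {a..b} (\<lambda>x. (f x)\<^sup>2) * integral {a..b} (\<lambda>x. (g x)\<^sup>2)"
    by (intro integral_Cauchy_Schwarz bounded_meas_integrable_on bounded_meas_mult bounded_meas_square f g ab)
  also have "\<dots> \<le> k\<^sup>2 * l\<^sup>2"
    using k l by (intro mult_mono integral_square_nonneg g ab) auto
  finally show "\<bar>integral {a..b} (\<lambda>x. f x * g x)\<bar>\<^sup>2 \<le> (k * l)\<^sup>2" by (simp add: power_mult_distrib)
qed (use k l in simp)

lemma integral_square_le_const:
  assumes "f \<in> bounded_meas" "0 \<le> a" "a \<le> b" "b \<le> 1" and D: "\<And>x. x \<in> {a..b} \<Longrightarrow> \<bar>f x\<bar> \<le> D"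
  shows "integral {a..b} (\<lambda>x. (f x)\<^sup>2) \<le> (b - a) * D\<^sup>2"
proof -
  have "integral {a..b} (\<lambda>x. (f x)\<^sup>2) \<le> integral {a..b} (\<lambda>x. D\<^sup>2)"
  proof (rule integral_le)
    show "(f x)\<^sup>2 \<le> D\<^sup>2" if "x \<in> {a..b}" for x
      using D[OF that] by (rule abs_le_square_iff[THEN iffD1, OF order_trans, OF _ abs_ge_self])
  qed (use assms in \<open>auto intro!: bounded_meas_integrable_on bounded_meas_square\<close>)
  then show ?thesis using assms(3) by simp
qed

lemma exp_transition_point:
  fixes \<sigma> :: real
  assumes "\<sigma> \<ge> real p + 1" "N \<ge> (1::nat)"
  shows "exp (- (\<sigma> * ln (real N))) \<le> 1 / real N ^ (p + 1)"
proof -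
  have "exp (- (\<sigma> * ln (real N))) \<le> exp (- (real (p + 1) * ln (real N)))"
    using assms by (auto intro!: mult_right_mono)
  also have "\<dots> = 1 / real N ^ (p + 1)"
    using assms(2) by (simp only: exp_minus exp_of_nat_mult) (simp add: divide_inverse)
  finally show ?thesis .
qed

text \<open>The quantity \<open>L = \<tau>/eps\<close> is the width of the fine regions in units of the layer width. At the transition points the layer
functions carry the factor \<open>exp (- L)\<close>, which is at most \<open>N\<close> to the power \<open>-(p + 1)\<close>. The slope there is larger by \<open>1/eps\<close>, but
the correcting cubics live on the length \<open>L eps\<close>: they cost a factor \<open>L\<close> in size, while the \<open>L\<^sub>2\<close> norm of their second derivatives
is at most of the order of that of the layer.\<close>

lemma layer_part_approximation:
  fixes \<sigma> eps Cw :: real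
  assumes p: "p \<ge> 3" and \<sigma>: "\<sigma> \<ge> real p + 1" and eps: "0 < eps"
    and N: "N = 4 * M" "M > 0" and \<tau>: "\<sigma> * eps * ln (real N) \<le> 1 / 4"
    and L: "L = \<sigma> * ln (real N)" "L \<ge> 1"
    and G: "deriv_chain 0 1 (p + 1) G" and Cw: "Cw \<ge> 0"
    and bound: "\<And>k x. k \<le> p + 1 \<Longrightarrow> x \<in> {0..1} \<Longrightarrow> \<bar>G k x\<bar> \<le> Cw / eps ^ k * layer_weight eps x"
  obtains Q U U1 U2 where "spline_triple p N (shishkin \<sigma> eps N) Q U U1 U2"
    "\<And>\<xi>. \<xi> \<in> {0, 1} \<Longrightarrow> U \<xi> = G 0 \<xi> \<and> U1 \<xi> = G 1 \<xi>"
    "\<And>C c c1 c2. spline_triple p N (shishkin \<sigma> eps N) C c c1 c2 \<Longrightarrow>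
       \<bar>L2_inner (\<lambda>x. G 2 x - U2 x) c2\<bar> \<le> 42 * Cw / real N ^ (p + 1) / (eps * sqrt eps) * L2_norm c2"
    "L2_norm (\<lambda>x. G 0 x - U x) \<le> 9 * 4 ^ (p + 1) * Cw * sqrt eps * (L ^ (p + 1) / real N ^ (p + 1))"
proof -
  let ?xs = "shishkin \<sigma> eps N"
  define \<tau>' where "\<tau>' = \<sigma> * eps * ln (real N)"
  have \<tau>L: "\<tau>' = L * eps" by (simp add: \<tau>'_def L)
  have t: "0 < \<tau>'" "\<tau>' \<le> 1 / 4"
  proof -
    have "0 < L * eps" using L(2) eps by simp
    then show "0 < \<tau>'" by (simp only: \<tau>L)
  qed (use \<tau> in \<open>simp add: \<tau>'_def\<close>)
  note sm = shishkin_mesh[OF N \<tau>'_def t]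
  define S where "S = exp (- L)"
  define \<Theta> where "\<Theta> = 1 / real N ^ (p + 1)"
  have S: "0 < S" "S \<le> \<Theta>"
    using exp_transition_point[OF \<sigma>, of N] N by (auto simp: S_def \<Theta>_def L)
  have \<Theta>: "\<Theta> > 0" using N by (simp add: \<Theta>_def)
  have tS: "exp (- \<tau>' / eps) = S" using eps by (simp add: \<tau>L S_def)
  have w: "layer_weight eps \<tau>' \<le> 2 * S" "layer_weight eps (1 - \<tau>') \<le> 2 * S"
  proof -
    have "- (1 - \<tau>') / eps \<le> - \<tau>' / eps" using eps t by (intro divide_right_mono) auto
    then have "exp (- (1 - \<tau>') / eps) \<le> S" unfolding tS[symmetric] by simp
    then show "layer_weight eps \<tau>' \<le> 2 * S" "layer_weight eps (1 - \<tau>') \<le> 2 * S"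
      using tS by (simp_all add: layer_weight_def)
  qed
  have endbound: "\<bar>G 0 y\<bar> \<le> 2 * Cw * S" "\<tau>' * \<bar>G 1 y\<bar> \<le> 2 * Cw * S * L" if "y \<in> {\<tau>', 1 - \<tau>'}" for y
  proof -
    have y: "y \<in> {0..1}" "layer_weight eps y \<le> 2 * S" using that t w by auto
    have "\<bar>G 0 y\<bar> \<le> Cw * layer_weight eps y" using bound[of 0 y] y by simp
    also have "\<dots> \<le> Cw * (2 * S)" using y Cw by (intro mult_left_mono)
    finally show "\<bar>G 0 y\<bar> \<le> 2 * Cw * S" by simp
    have "\<bar>G 1 y\<bar> \<le> Cw / eps * layer_weight eps y" using bound[of 1 y] y by simp
    also have "\<dots> \<le> Cw / eps * (2 * S)" using y Cw eps by (intro mult_left_mono) auto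
    finally have "\<tau>' * \<bar>G 1 y\<bar> \<le> \<tau>' * (Cw / eps * (2 * S))" using t by (intro mult_left_mono) auto
    then show "\<tau>' * \<bar>G 1 y\<bar> \<le> 2 * Cw * S * L" using eps by (simp add: \<tau>L mult_ac)
  qed
  define D where "D = 4 * Cw * S * L"
  define D2 where "D2 = 20 * Cw * S * L / \<tau>'\<^sup>2"
  have D0: "D \<ge> 0" "D2 \<ge> 0" using Cw S L by (auto simp: D_def D2_def)
  have CSL: "Cw * S \<le> Cw * S * L" using mult_left_mono[OF L(2), of "Cw * S"] Cw S by simp
  have dbound: "\<bar>G 0 y\<bar> + \<tau>' * \<bar>G 1 y\<bar> \<le> D" "(6 * \<bar>G 0 y\<bar> + 4 * \<tau>' * \<bar>G 1 y\<bar>) / \<tau>'\<^sup>2 \<le> D2"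
    if "y \<in> {\<tau>', 1 - \<tau>'}" for y
  proof -
    note e = endbound[OF that]
    show "\<bar>G 0 y\<bar> + \<tau>' * \<bar>G 1 y\<bar> \<le> D" using e CSL by (simp add: D_def)
    have "6 * \<bar>G 0 y\<bar> + 4 * \<tau>' * \<bar>G 1 y\<bar> \<le> 20 * Cw * S * L" using e CSL by simp
    then show "(6 * \<bar>G 0 y\<bar> + 4 * \<tau>' * \<bar>G 1 y\<bar>) / \<tau>'\<^sup>2 \<le> D2"
      unfolding D2_def by (intro divide_right_mono) auto
  qed
  obtain d0 where d0: "degree d0 \<le> 3" "poly d0 0 = 0" "poly (pderiv d0) 0 = 0"
    "poly d0 \<tau>' = G 0 \<tau>'" "poly (pderiv d0) \<tau>' = G 1 \<tau>'"
    "\<And>x. x \<in> {0..\<tau>'} \<Longrightarrow> \<bar>poly d0 x\<bar> \<le> D" "\<And>x. x \<in> {0..\<tau>'} \<Longrightarrow> \<bar>poly (pderiv (pderiv d0)) x\<bar> \<le> D2"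
  proof (rule cubic_end_correction[of 0 \<tau>' "G 0 \<tau>'" "G 1 \<tau>'"])
    fix d :: "real poly"
    assume d: "degree d \<le> 3" "poly d 0 = 0" "poly (pderiv d) 0 = 0" "poly d \<tau>' = G 0 \<tau>'"
      "poly (pderiv d) \<tau>' = G 1 \<tau>'" and b: "\<And>x. min 0 \<tau>' \<le> x \<Longrightarrow> x \<le> max 0 \<tau>' \<Longrightarrow>
       \<bar>poly d x\<bar> \<le> \<bar>G 0 \<tau>'\<bar> + \<bar>\<tau>' - 0\<bar> * \<bar>G 1 \<tau>'\<bar> \<and>
       \<bar>poly (pderiv (pderiv d)) x\<bar> \<le> (6 * \<bar>G 0 \<tau>'\<bar> + 4 * \<bar>\<tau>' - 0\<bar> * \<bar>G 1 \<tau>'\<bar>) / (\<tau>' - 0)\<^sup>2"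
    show thesis
      using that[OF d] b dbound[of \<tau>'] t by (smt (verit) atLeastAtMost_iff insertI1 max_def min_def)
  qed (use t in auto)
  obtain d1 where d1: "degree d1 \<le> 3" "poly d1 1 = 0" "poly (pderiv d1) 1 = 0"
    "poly d1 (1 - \<tau>') = G 0 (1 - \<tau>')" "poly (pderiv d1) (1 - \<tau>') = G 1 (1 - \<tau>')"
    "\<And>x. x \<in> {1 - \<tau>'..1} \<Longrightarrow> \<bar>poly d1 x\<bar> \<le> D" "\<And>x. x \<in> {1 - \<tau>'..1} \<Longrightarrow> \<bar>poly (pderiv (pderiv d1)) x\<bar> \<le> D2"
  proof (rule cubic_end_correction[of 1 "1 - \<tau>'" "G 0 (1 - \<tau>')" "G 1 (1 - \<tau>')"])
    fix d :: "real poly"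
    assume d: "degree d \<le> 3" "poly d 1 = 0" "poly (pderiv d) 1 = 0" "poly d (1 - \<tau>') = G 0 (1 - \<tau>')"
      "poly (pderiv d) (1 - \<tau>') = G 1 (1 - \<tau>')" and b: "\<And>x. min 1 (1 - \<tau>') \<le> x \<Longrightarrow> x \<le> max 1 (1 - \<tau>') \<Longrightarrow>
       \<bar>poly d x\<bar> \<le> \<bar>G 0 (1 - \<tau>')\<bar> + \<bar>1 - \<tau>' - 1\<bar> * \<bar>G 1 (1 - \<tau>')\<bar> \<and>
       \<bar>poly (pderiv (pderiv d)) x\<bar> \<le> (6 * \<bar>G 0 (1 - \<tau>')\<bar> + 4 * \<bar>1 - \<tau>' - 1\<bar> * \<bar>G 1 (1 - \<tau>')\<bar>) / (1 - \<tau>' - 1)\<^sup>2"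
    have "\<bar>1 - \<tau>' - 1\<bar> = \<tau>'" "(1 - \<tau>' - 1)\<^sup>2 = \<tau>'\<^sup>2" "min 1 (1 - \<tau>') = 1 - \<tau>'" "max 1 (1 - \<tau>') = 1"
      using t by auto
    with b have "\<And>x. 1 - \<tau>' \<le> x \<Longrightarrow> x \<le> 1 \<Longrightarrow>
       \<bar>poly d x\<bar> \<le> \<bar>G 0 (1 - \<tau>')\<bar> + \<tau>' * \<bar>G 1 (1 - \<tau>')\<bar> \<and>
       \<bar>poly (pderiv (pderiv d)) x\<bar> \<le> (6 * \<bar>G 0 (1 - \<tau>')\<bar> + 4 * \<tau>' * \<bar>G 1 (1 - \<tau>')\<bar>) / \<tau>'\<^sup>2"
      by simp
    then show thesis
      using that[OF d] dbound[of "1 - \<tau>'"] by (meson atLeastAtMost_iff insertI1 insertI2 order_trans)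
  qed (use t in auto)
  define h where "h = \<tau>' / real M"
  have MM: "1 \<le> M" "M < 3 * M" "3 * M < N" using N by auto
  obtain Q U U1 U2 where U: "spline_triple p N ?xs Q U U1 U2"
    "\<And>\<xi>. \<xi> \<in> {0, 1} \<Longrightarrow> U \<xi> = G 0 \<xi> \<and> U1 \<xi> = G 1 \<xi>"
    "\<And>C c c1 c2. spline_triple p N ?xs C c c1 c2 \<Longrightarrow> L2_inner (\<lambda>x. G 2 x - U2 x) c2 =
       integral {0..\<tau>'} (\<lambda>x. poly (pderiv (pderiv d0)) x * c2 x) + integral {\<tau>'..1 - \<tau>'} (\<lambda>x. G 2 x * c2 x)
       + integral {1 - \<tau>'..1} (\<lambda>x. poly (pderiv (pderiv d1)) x * c2 x)"
    "L2_inner (\<lambda>x. G 0 x - U x) (\<lambda>x. G 0 x - U x) \<le> 2 * (h ^ (p + 1))\<^sup>2 * integral {0..1} (\<lambda>x. (G (p + 1) x)\<^sup>2)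
       + 2 * integral {0..\<tau>'} (\<lambda>x. (poly d0 x)\<^sup>2) + 2 * integral {1 - \<tau>'..1} (\<lambda>x. (poly d1 x)\<^sup>2)
       + integral {\<tau>'..1 - \<tau>'} (\<lambda>x. (G 0 x)\<^sup>2)"
    using layer_adapted_spline[OF sm(1) p G MM d0(1) d1(1) d0(2,3) d0(4,5)[folded sm(2)] d1(2,3) d1(4,5)[folded sm(3)], of h]
    unfolding sm(2,3) using eq_refl[OF sm(4), folded h_def] by blast
  have bm: "G k \<in> bounded_meas" if "k \<le> p + 1" for k using deriv_chain_bounded_meas[OF G that] .
  have G2: "G 2 \<in> bounded_meas" using bm p by auto
  have wint: "integral {a..1 - a} (\<lambda>x. (G k x)\<^sup>2) \<le> (Cw / eps ^ k)\<^sup>2 * (2 * eps * (exp (- a / eps))\<^sup>2)"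
    if k: "k \<le> p + 1" and a: "0 \<le> a" "a \<le> 1 / 2" for k a
  proof -
    have "integral {a..1 - a} (\<lambda>x. (G k x)\<^sup>2) \<le> integral {a..1 - a} (\<lambda>x. (Cw / eps ^ k)\<^sup>2 * (layer_weight eps x)\<^sup>2)"
    proof (rule integral_le)
      show "(\<lambda>x. (G k x)\<^sup>2) integrable_on {a..1 - a}"
        using a by (intro bounded_meas_integrable_on bounded_meas_square bm k) auto
      show "(\<lambda>x. (Cw / eps ^ k)\<^sup>2 * (layer_weight eps x)\<^sup>2) integrable_on {a..1 - a}"
        using eps by (intro integrable_continuous_real continuous_intros layer_weight_continuous)
      fix x assume "x \<in> {a..1 - a}"
      then have "\<bar>G k x\<bar> \<le> Cw / eps ^ k * layer_weight eps x" using a by (intro bound k) auto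
      then have "(G k x)\<^sup>2 \<le> (Cw / eps ^ k * layer_weight eps x)\<^sup>2"
        by (rule power2_le_iff_abs_le[THEN iffD2, rotated])
           (use Cw eps layer_weight_nonneg[of eps x] in auto)
      then show "(G k x)\<^sup>2 \<le> (Cw / eps ^ k)\<^sup>2 * (layer_weight eps x)\<^sup>2" by (simp only: power_mult_distrib)
    qed
    also have "\<dots> = (Cw / eps ^ k)\<^sup>2 * integral {a..1 - a} (\<lambda>x. (layer_weight eps x)\<^sup>2)" by simp
    also have "\<dots> \<le> (Cw / eps ^ k)\<^sup>2 * (2 * eps * (exp (- a / eps))\<^sup>2)"
      using integral_layer_weight_square[OF eps a] by (intro mult_left_mono) auto
    finally show ?thesis .
  qed
  define q where "q = eps * sqrt eps"
  have q: "q > 0" "q\<^sup>2 = eps ^ 3" using eps by (auto simp: q_def power_mult_distrib power3_eq_cube power2_eq_square)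
  \<comment> \<open>One factor \<open>1/L\<close> is left over here, since the cubic is spread over the length \<open>L eps\<close>.\<close>
  have k20: "\<tau>' * D2\<^sup>2 \<le> (20 * Cw * S / q)\<^sup>2"
  proof -
    have "\<tau>' * D2\<^sup>2 = (20 * Cw * S)\<^sup>2 / (L * eps ^ 3)"
      using L eps by (simp add: D2_def \<tau>L power_divide power_mult_distrib field_simps power2_eq_square power3_eq_cube)
    also have "\<dots> \<le> (20 * Cw * S)\<^sup>2 / (1 * eps ^ 3)"
      using L eps by (intro divide_left_mono mult_right_mono) auto
    also have "\<dots> = (20 * Cw * S / q)\<^sup>2" by (simp add: power_divide q)
    finally show ?thesis .
  qed
  have i0: "integral {0..\<tau>'} (\<lambda>x. (poly (pderiv (pderiv d0)) x)\<^sup>2) \<le> (20 * Cw * S / q)\<^sup>2"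
    using integral_square_le_const[of "poly (pderiv (pderiv d0))" 0 \<tau>' D2] d0(7) t k20 by fastforce
  have i1: "integral {1 - \<tau>'..1} (\<lambda>x. (poly (pderiv (pderiv d1)) x)\<^sup>2) \<le> (20 * Cw * S / q)\<^sup>2"
    using integral_square_le_const[of "poly (pderiv (pderiv d1))" "1 - \<tau>'" 1 D2] d1(7) t k20 by fastforce
  have im: "integral {\<tau>'..1 - \<tau>'} (\<lambda>x. (G 2 x)\<^sup>2) \<le> (2 * Cw * S / q)\<^sup>2"
  proof -
    have "integral {\<tau>'..1 - \<tau>'} (\<lambda>x. (G 2 x)\<^sup>2) \<le> (Cw / eps ^ 2)\<^sup>2 * (2 * eps * (exp (- \<tau>' / eps))\<^sup>2)"
      using p t by (intro wint) auto
    also have "\<dots> = 2 * Cw\<^sup>2 * S\<^sup>2 / eps ^ 3"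
      unfolding tS using eps by (simp add: field_simps power2_eq_square power3_eq_cube)
    also have "\<dots> \<le> 4 * Cw\<^sup>2 * S\<^sup>2 / eps ^ 3"
      using eps by (intro divide_right_mono) auto
    also have "\<dots> = (2 * Cw * S / q)\<^sup>2" by (simp add: power_divide q power_mult_distrib)
    finally show ?thesis .
  qed
  have orth: "\<bar>L2_inner (\<lambda>x. G 2 x - U2 x) c2\<bar> \<le> 42 * Cw / real N ^ (p + 1) / (eps * sqrt eps) * L2_norm c2"
    if C: "spline_triple p N ?xs C c c1 c2" for C c c1 c2
  proof -
    note c2 = spline_triple_bounded_meas(3)[OF C]
    have k: "0 \<le> 20 * Cw * S / q" "0 \<le> 2 * Cw * S / q" using Cw S q by auto
    have "\<bar>integral {0..\<tau>'} (\<lambda>x. poly (pderiv (pderiv d0)) x * c2 x)\<bar> \<le> (20 * Cw * S / q) * L2_norm c2"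
      using t by (intro block_Cauchy_Schwarz i0 k c2 integral_square_le_norm L2_norm_nonneg) auto
    moreover have "\<bar>integral {\<tau>'..1 - \<tau>'} (\<lambda>x. G 2 x * c2 x)\<bar> \<le> (2 * Cw * S / q) * L2_norm c2"
      using t by (intro block_Cauchy_Schwarz im k c2 G2 integral_square_le_norm L2_norm_nonneg) auto
    moreover have "\<bar>integral {1 - \<tau>'..1} (\<lambda>x. poly (pderiv (pderiv d1)) x * c2 x)\<bar> \<le> (20 * Cw * S / q) * L2_norm c2"
      using t by (intro block_Cauchy_Schwarz i1 k c2 integral_square_le_norm L2_norm_nonneg) auto
    ultimately have "\<bar>L2_inner (\<lambda>x. G 2 x - U2 x) c2\<bar> \<le> (20 * Cw * S / q) * L2_norm c2 + (2 * Cw * S / q) * L2_norm c2 + (20 * Cw * S / q) * L2_norm c2"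
      unfolding U(3)[OF C] by linarith
    also have "\<dots> = (42 * Cw / q * L2_norm c2) * S" by (simp add: algebra_simps add_divide_distrib[symmetric])
    also have "\<dots> \<le> (42 * Cw / q * L2_norm c2) * \<Theta>"
      using S Cw q L2_norm_nonneg[of c2] by (intro mult_left_mono) auto
    finally show ?thesis by (simp add: \<Theta>_def q_def mult_ac)
  qed
  define Y where "Y = Cw\<^sup>2 * eps * (L ^ (p + 1) * \<Theta>)\<^sup>2"
  have Y0: "Y \<ge> 0" using eps by (simp add: Y_def)
  have S\<Theta>: "S\<^sup>2 \<le> \<Theta>\<^sup>2" using S by (intro power_mono) auto
  have Lpow: "L ^ j \<le> (L ^ (p + 1))\<^sup>2" if "j \<le> 3" for j
    unfolding power_mult[symmetric] using L(2) p that by (intro power_increasing) auto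
  \<comment> \<open>In units of \<open>eps\<close> the fine mesh width is \<open>4 L / N\<close>, which cancels the powers of \<open>eps\<close> in the derivative bound.\<close>
  have e1: "2 * (h ^ (p + 1))\<^sup>2 * integral {0..1} (\<lambda>x. (G (p + 1) x)\<^sup>2) \<le> 4 * 16 ^ (p + 1) * Y"
  proof -
    have heq: "h = eps * (4 * L * (1 / real N))" using N by (simp add: h_def \<tau>L)
    have "integral {0..1} (\<lambda>x. (G (p + 1) x)\<^sup>2) \<le> (Cw / eps ^ (p + 1))\<^sup>2 * (2 * eps)"
      using wint[of "p + 1" 0] by simp
    then have "2 * (h ^ (p + 1))\<^sup>2 * integral {0..1} (\<lambda>x. (G (p + 1) x)\<^sup>2) \<le> 2 * (h ^ (p + 1))\<^sup>2 * ((Cw / eps ^ (p + 1))\<^sup>2 * (2 * eps))"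
      by (intro mult_left_mono) auto
    also have "\<dots> = 4 * Cw\<^sup>2 * eps * ((h / eps) ^ (p + 1))\<^sup>2"
      by (simp only: power_divide power_mult_distrib) (simp add: field_simps)
    also have "h / eps = 4 * (L * (1 / real N))" using eps by (simp add: heq)
    also have "(4 * (L * (1 / real N))) ^ (p + 1) = 4 ^ (p + 1) * (L ^ (p + 1) * \<Theta>)"
      by (simp only: power_mult_distrib power_one_over \<Theta>_def)
    also have "4 * Cw\<^sup>2 * eps * (4 ^ (p + 1) * (L ^ (p + 1) * \<Theta>))\<^sup>2 = 4 * ((4 ^ (p + 1))\<^sup>2) * Y"
      by (simp only: Y_def power_mult_distrib mult_ac)
    also have "((4::real) ^ (p + 1))\<^sup>2 = 16 ^ (p + 1)"
      by (simp only: power_mult[symmetric] mult.commute[of "p + 1" 2]) (simp only: power_mult, simp)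
    finally show ?thesis .
  qed
  have e2: "\<tau>' * D\<^sup>2 \<le> 16 * Y"
  proof -
    have "\<tau>' * D\<^sup>2 = 16 * (Cw\<^sup>2 * eps) * (L ^ 3 * S\<^sup>2)"
      by (simp add: D_def \<tau>L power2_eq_square power3_eq_cube)
    also have "\<dots> \<le> 16 * (Cw\<^sup>2 * eps) * ((L ^ (p + 1))\<^sup>2 * \<Theta>\<^sup>2)"
      using Lpow[of 3] S\<Theta> eps by (intro mult_left_mono mult_mono) auto
    also have "\<dots> = 16 * Y" by (simp only: Y_def power_mult_distrib mult_ac)
    finally show ?thesis .
  qed
  have e3: "integral {0..\<tau>'} (\<lambda>x. (poly d0 x)\<^sup>2) \<le> 16 * Y"
    using integral_square_le_const[of "poly d0" 0 \<tau>' D] d0(6) t e2 by fastforce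
  have e4: "integral {1 - \<tau>'..1} (\<lambda>x. (poly d1 x)\<^sup>2) \<le> 16 * Y"
    using integral_square_le_const[of "poly d1" "1 - \<tau>'" 1 D] d1(6) t e2 by fastforce
  have e5: "integral {\<tau>'..1 - \<tau>'} (\<lambda>x. (G 0 x)\<^sup>2) \<le> 2 * Y"
  proof -
    have "integral {\<tau>'..1 - \<tau>'} (\<lambda>x. (G 0 x)\<^sup>2) \<le> 2 * (Cw\<^sup>2 * eps) * (L ^ 0 * S\<^sup>2)"
      using wint[of 0 \<tau>', unfolded tS] t by (simp add: mult_ac)
    also have "\<dots> \<le> 2 * (Cw\<^sup>2 * eps) * ((L ^ (p + 1))\<^sup>2 * \<Theta>\<^sup>2)"
      using Lpow[of 0] S\<Theta> eps by (intro mult_left_mono mult_mono) auto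
    also have "\<dots> = 2 * Y" by (simp only: Y_def power_mult_distrib mult_ac)
    finally show ?thesis .
  qed
  have "(L2_norm (\<lambda>x. G 0 x - U x))\<^sup>2 \<le> 4 * 16 ^ (p + 1) * Y + 66 * Y"
    unfolding L2_norm_square using U(4) e1 e3 e4 e5 by linarith
  also have "\<dots> \<le> 81 * 16 ^ (p + 1) * Y"
  proof -
    have "(1::real) \<le> 16 ^ (p + 1)" by (rule one_le_power) simp
    then have "1 * Y \<le> 16 ^ (p + 1) * Y" using Y0 by (intro mult_right_mono) auto
    then show ?thesis using Y0 by linarith
  qed
  also have "\<dots> = (9 * 4 ^ (p + 1) * Cw * sqrt eps * (L ^ (p + 1) * \<Theta>))\<^sup>2"
  proof -
    have "(16::real) ^ (p + 1) = (4 ^ (p + 1))\<^sup>2"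
      by (simp only: power_mult[symmetric] mult.commute[of "p + 1" 2]) (simp only: power_mult, simp)
    moreover have "(sqrt eps)\<^sup>2 = eps" using eps by simp
    ultimately show ?thesis by (simp only: Y_def power_mult_distrib mult_ac) simp
  qed
  finally have "L2_norm (\<lambda>x. G 0 x - U x) \<le> 9 * 4 ^ (p + 1) * Cw * sqrt eps * (L ^ (p + 1) * \<Theta>)"
    by (rule power2_le_imp_le) (use Cw eps L \<Theta> in auto)
  then have est: "L2_norm (\<lambda>x. G 0 x - U x) \<le> 9 * 4 ^ (p + 1) * Cw * sqrt eps * (L ^ (p + 1) / real N ^ (p + 1))"
    by (simp add: \<Theta>_def)
  show ?thesis by (rule that[OF U(1)], erule U(2), erule orth, rule est)
qed

text \<open>The last estimate separates the mesh regions. On the fine regions the error is integrated over the length \<open>\<tau>\<close>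
only, and the resulting \<open>sqrt \<tau>\<close> makes up for the factor \<open>eps powr (-1/2)\<close> that the energy norm charges for \<open>E c2\<close>; on the coarse
elements, whose length is at least \<open>1/N\<close>, the inverse inequality trades \<open>c2\<close> for \<open>c\<close>.\<close>

lemma regular_part_approximation:
  fixes \<sigma> eps Cr Cinv :: real
  assumes p: "p \<ge> 3" and N: "N = 4 * M" "M > 0"
    and \<tau>: "\<tau> = \<sigma> * eps * ln (real N)" "0 < \<tau>" "\<tau> \<le> 1 / 4"
    and G: "deriv_chain 0 1 (p + 1) G" and Cr: "Cr \<ge> 0"
    and bound: "\<And>x. x \<in> {0..1} \<Longrightarrow> \<bar>G (p + 1) x\<bar> \<le> Cr"
    and Ci: "inverse_constant p Cinv"
  obtains Q U U1 U2 where "spline_triple p N (shishkin \<sigma> eps N) Q U U1 U2"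
    "\<And>\<xi>. \<xi> \<in> {0, 1} \<Longrightarrow> U \<xi> = G 0 \<xi> \<and> U1 \<xi> = G 1 \<xi>"
    "\<And>C c c1 c2. spline_triple p N (shishkin \<sigma> eps N) C c c1 c2 \<Longrightarrow> L2_inner (\<lambda>x. G 2 x - U2 x) c2 = 0"
    "L2_norm (\<lambda>x. G 0 x - U x) \<le> 2 ^ (p + 1) * Cr / real N ^ (p + 1)"
    "\<And>C c c1 c2. spline_triple p N (shishkin \<sigma> eps N) C c c1 c2 \<Longrightarrow>
       \<bar>L2_inner (\<lambda>x. G 0 x - U x) c2\<bar> \<le> 2 * (Cr / real N ^ (p + 1)) * sqrt \<tau> * L2_norm c2
         + 2 ^ (p + 1) * Cr / real N ^ (p + 1) * sqrt Cinv * (real N)\<^sup>2 * L2_norm c"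
proof -
  let ?xs = "shishkin \<sigma> eps N"
  have Cinv: "Cinv \<ge> 0" "\<And>(q::real poly) a b. degree q \<le> p \<Longrightarrow> a < b \<Longrightarrow>
      (b - a) ^ 4 * integral {a..b} (\<lambda>x. (poly (pderiv (pderiv q)) x)\<^sup>2) \<le> Cinv * integral {a..b} (\<lambda>x. (poly q x)\<^sup>2)"
    using Ci unfolding inverse_constant_def by blast+
  note sm = shishkin_mesh[OF N \<tau>]
  note mesh = sm(1)
  have x0: "?xs 0 = 0" "?xs N = 1" using mesh by (auto simp: mesh_def)
  have N0: "real N > 0" using N by simp
  obtain Q where Q: "interpolates p N ?xs G Q" using interpolates_exists[OF mesh p G] by blast
  obtain U U1 U2 where U: "spline_triple p N ?xs (\<lambda>i. Q i - 0) U U1 U2"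
    "\<And>\<xi>. \<xi> \<in> {0, 1} \<Longrightarrow> U \<xi> = G 0 \<xi> \<and> U1 \<xi> = G 1 \<xi>"
    "\<And>C c c1 c2. spline_triple p N ?xs C c c1 c2 \<Longrightarrow> L2_inner (\<lambda>x. G 2 x - U2 x) c2 =
       (\<Sum>i\<in>{1..N}. integral {?xs (i - 1)..?xs i} (\<lambda>x. poly (pderiv (pderiv 0)) x * c2 x))"
    "\<And>i. i \<in> {1..N} \<Longrightarrow> integral {?xs (i - 1)..?xs i} (\<lambda>x. (G 0 x - U x)\<^sup>2) =
       integral {?xs (i - 1)..?xs i} (\<lambda>x. (G 0 x - poly (Q i) x + poly 0 x)\<^sup>2)"
    by (rule corrected_interpolant[OF mesh p G Q, of "\<lambda>_. 0"]) simp_all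
  have orth: "L2_inner (\<lambda>x. G 2 x - U2 x) c2 = 0" if "spline_triple p N ?xs C c c1 c2" for C c c1 c2
    unfolding U(3)[OF that] by simp
  have bm: "G 0 \<in> bounded_meas" "G (p + 1) \<in> bounded_meas"
    using deriv_chain_bounded_meas[OF G] by auto
  define a where "a = (\<lambda>x. G 0 x - U x)"
  have a: "a \<in> bounded_meas"
    unfolding a_def by (intro bounded_meas_diff bm spline_triple_bounded_meas(1)[OF U(1)])
  have block: "integral {?xs m..?xs n} (\<lambda>x. (a x)\<^sup>2) \<le> (h ^ (p + 1) * Cr)\<^sup>2 * (?xs n - ?xs m)"
    if mn: "m \<le> n" "n \<le> N" and h: "\<And>i. i \<in> {Suc m..n} \<Longrightarrow> ?xs i - ?xs (i - 1) \<le> h" for m n h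
  proof -
    have "integral {?xs m..?xs n} (\<lambda>x. (a x)\<^sup>2) = (\<Sum>i\<in>{Suc m..n}. integral {?xs (i - 1)..?xs i} (\<lambda>x. (a x)\<^sup>2))"
      by (rule integral_mesh_sum[OF mesh bounded_meas_square[OF a] mn])
    also have "\<dots> \<le> (\<Sum>i\<in>{Suc m..n}. (h ^ (p + 1))\<^sup>2 * integral {?xs (i - 1)..?xs i} (\<lambda>x. (G (p + 1) x)\<^sup>2))"
    proof (rule sum_mono)
      fix i assume i: "i \<in> {Suc m..n}"
      then have iN: "i \<in> {1..N}" using mn by auto
      have K: "0 \<le> ?xs (i - 1)" "?xs i \<le> 1" using iN mesh_in_unit[OF mesh] by auto
      have "integral {?xs (i - 1)..?xs i} (\<lambda>x. (a x)\<^sup>2) = integral {?xs (i - 1)..?xs i} (\<lambda>x. (G 0 x - poly (Q i) x)\<^sup>2)"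
        using U(4)[OF iN] by (simp add: a_def)
      also have "\<dots> \<le> ((?xs i - ?xs (i - 1)) ^ (p + 1))\<^sup>2 * integral {?xs (i - 1)..?xs i} (\<lambda>x. (G (p + 1) x)\<^sup>2)"
        using Q iN unfolding interpolates_def local_interpolant_def by blast
      also have "\<dots> \<le> (h ^ (p + 1))\<^sup>2 * integral {?xs (i - 1)..?xs i} (\<lambda>x. (G (p + 1) x)\<^sup>2)"
      proof (rule mult_right_mono)
        have "0 \<le> ?xs i - ?xs (i - 1)" using mesh_less[OF mesh, of "i - 1" i] iN by auto
        then show "((?xs i - ?xs (i - 1)) ^ (p + 1))\<^sup>2 \<le> (h ^ (p + 1))\<^sup>2"
          using h[OF i] by (intro power_mono) auto
      qed (intro integral_square_nonneg bm K)
      finally show "integral {?xs (i - 1)..?xs i} (\<lambda>x. (a x)\<^sup>2) \<le> (h ^ (p + 1))\<^sup>2 * integral {?xs (i - 1)..?xs i} (\<lambda>x. (G (p + 1) x)\<^sup>2)" .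
    qed
    also have "\<dots> = (h ^ (p + 1))\<^sup>2 * integral {?xs m..?xs n} (\<lambda>x. (G (p + 1) x)\<^sup>2)"
      by (simp only: integral_mesh_sum[OF mesh bounded_meas_square[OF bm(2)] mn] sum_distrib_left)
    also have "\<dots> \<le> (h ^ (p + 1))\<^sup>2 * ((?xs n - ?xs m) * Cr\<^sup>2)"
    proof (intro mult_left_mono integral_square_le_const bm)
      show "0 \<le> ?xs m" "?xs m \<le> ?xs n" "?xs n \<le> 1"
        using mn mesh_in_unit[OF mesh] mesh_le[OF mesh] by auto
      then show "\<bar>G (p + 1) x\<bar> \<le> Cr" if "x \<in> {?xs m..?xs n}" for x using that by (intro bound) auto
    qed simp
    finally show ?thesis by (simp only: power_mult_distrib mult_ac)
  qed
  define \<Theta> where "\<Theta> = 1 / real N ^ (p + 1)"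
  have \<Theta>: "(1 / real N) ^ (p + 1) = \<Theta>" "(2 / real N) ^ (p + 1) = 2 ^ (p + 1) * \<Theta>" "\<Theta> \<ge> 0"
    by (simp_all only: \<Theta>_def power_divide power_one) simp_all
  have hfine: "?xs i - ?xs (i - 1) \<le> 1 / real N" if "i \<in> {1..M} \<union> {Suc (3 * M)..N}" for i
    unfolding sm(4)[OF that] using \<tau> N by (simp add: field_simps)
  have hall: "?xs i - ?xs (i - 1) \<le> 2 / real N" if i: "i \<in> {Suc 0..N}" for i
  proof (cases "i \<in> {Suc M..3 * M}")
    case True
    have "(1 - 2 * \<tau>) / (2 * real M) \<le> 1 / (2 * real M)" using \<tau>(2) by (intro divide_right_mono) auto
    also have "\<dots> = 2 / real N" using N by simp
    finally show ?thesis unfolding sm(5)[OF True] .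
  next
    case False
    then have "i \<in> {1..M} \<union> {Suc (3 * M)..N}" using i by auto
    from hfine[OF this] have "?xs i - ?xs (i - 1) \<le> 1 / real N" .
    also have "\<dots> \<le> 2 / real N" using N0 by (simp add: divide_right_mono)
    finally show ?thesis .
  qed
  have all: "integral {0..1} (\<lambda>x. (a x)\<^sup>2) \<le> (2 ^ (p + 1) * \<Theta> * Cr)\<^sup>2"
    using block[of 0 N "2 / real N", OF _ _ hall] by (simp only: \<Theta> x0) simp
  have "(L2_norm a)\<^sup>2 \<le> (2 ^ (p + 1) * \<Theta> * Cr)\<^sup>2"
    using all unfolding L2_norm_square L2_inner_eq_integral[OF a a] by (simp only: power2_eq_square)
  then have "L2_norm a \<le> 2 ^ (p + 1) * \<Theta> * Cr"
    by (rule power2_le_imp_le) (use \<Theta> Cr in simp)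
  then have est: "L2_norm (\<lambda>x. G 0 x - U x) \<le> 2 ^ (p + 1) * Cr / real N ^ (p + 1)"
    by (simp add: a_def \<Theta>_def)
  have sq: "(\<Theta> * Cr)\<^sup>2 * \<tau> = (\<Theta> * Cr * sqrt \<tau>)\<^sup>2" using \<tau>(2) by (simp add: power_mult_distrib)
  have left: "integral {0..\<tau>} (\<lambda>x. (a x)\<^sup>2) \<le> (\<Theta> * Cr * sqrt \<tau>)\<^sup>2"
    using block[of 0 M "1 / real N"] hfine N unfolding x0 sm(2) \<Theta> sq[symmetric] by simp
  have right: "integral {1 - \<tau>..1} (\<lambda>x. (a x)\<^sup>2) \<le> (\<Theta> * Cr * sqrt \<tau>)\<^sup>2"
    using block[of "3 * M" N "1 / real N"] hfine N unfolding x0 sm(3) \<Theta> sq[symmetric] by simp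
  have mid: "integral {\<tau>..1 - \<tau>} (\<lambda>x. (a x)\<^sup>2) \<le> (2 ^ (p + 1) * \<Theta> * Cr)\<^sup>2"
  proof -
    have "integral {\<tau>..1 - \<tau>} (\<lambda>x. (a x)\<^sup>2) \<le> integral {0..1} (\<lambda>x. (a x)\<^sup>2)"
      using \<tau> by (intro integral_subset_le bounded_meas_integrable_on bounded_meas_square a) auto
    then show ?thesis using all by linarith
  qed
  have mix: "\<bar>L2_inner a c2\<bar> \<le> 2 * (\<Theta> * Cr) * sqrt \<tau> * L2_norm c2
         + 2 ^ (p + 1) * \<Theta> * Cr * sqrt Cinv * (real N)\<^sup>2 * L2_norm c"
    if C: "spline_triple p N ?xs C c c1 c2" for C c c1 c2
  proof -
    note c = spline_triple_bounded_meas[OF C]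
    \<comment> \<open>Coarse elements have at least the length \<open>1/N\<close> because \<open>1 - 2 \<tau> \<ge> 1/2\<close>.\<close>
    have inv: "integral {\<tau>..1 - \<tau>} (\<lambda>x. (c2 x)\<^sup>2) \<le> (sqrt Cinv * (real N)\<^sup>2 * L2_norm c)\<^sup>2"
    proof -
      have M3: "M \<le> 3 * M" "3 * M \<le> N" using N by auto
      have "integral {?xs M..?xs (3 * M)} (\<lambda>x. (c2 x)\<^sup>2) = (\<Sum>i\<in>{Suc M..3 * M}. integral {?xs (i - 1)..?xs i} (\<lambda>x. (c2 x)\<^sup>2))"
        by (rule integral_mesh_sum[OF mesh bounded_meas_square[OF c(3)] M3])
      also have "\<dots> \<le> (\<Sum>i\<in>{Suc M..3 * M}. Cinv * real N ^ 4 * integral {?xs (i - 1)..?xs i} (\<lambda>x. (c x)\<^sup>2))"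
      proof (rule sum_mono)
        fix i assume i: "i \<in> {Suc M..3 * M}"
        then have iN: "i \<in> {1..N}" using M3 by auto
        have K: "0 \<le> ?xs (i - 1)" "?xs i \<le> 1" using iN mesh_in_unit[OF mesh] by auto
        let ?h = "?xs i - ?xs (i - 1)"
        have h: "1 / real N \<le> ?h" unfolding sm(5)[OF i] using \<tau> N by (simp add: field_simps)
        have h0: "?xs (i - 1) < ?xs i" using mesh_less[OF mesh, of "i - 1" i] iN by auto
        have e: "integral {?xs (i - 1)..?xs i} (\<lambda>x. (c2 x)\<^sup>2) = integral {?xs (i - 1)..?xs i} (\<lambda>x. (poly (pderiv (pderiv (C i))) x)\<^sup>2)"
          "integral {?xs (i - 1)..?xs i} (\<lambda>x. (c x)\<^sup>2) = integral {?xs (i - 1)..?xs i} (\<lambda>x. (poly (C i) x)\<^sup>2)"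
          using C iN by (auto intro!: integral_cong_open simp: spline_triple_def)
        have deg: "degree (C i) \<le> p" using C iN by (simp add: spline_triple_def)
        let ?I = "integral {?xs (i - 1)..?xs i} (\<lambda>x. (c2 x)\<^sup>2)"
        have I0: "?I \<ge> 0" by (intro integral_square_nonneg c K)
        have "(1 / real N) ^ 4 * ?I \<le> ?h ^ 4 * ?I"
          using h N0 by (intro mult_right_mono power_mono I0) auto
        also have "\<dots> \<le> Cinv * integral {?xs (i - 1)..?xs i} (\<lambda>x. (c x)\<^sup>2)"
          unfolding e by (rule Cinv(2)[OF deg h0])
        finally have "real N ^ 4 * ((1 / real N) ^ 4 * ?I) \<le> real N ^ 4 * (Cinv * integral {?xs (i - 1)..?xs i} (\<lambda>x. (c x)\<^sup>2))"
          by (rule mult_left_mono) simp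
        moreover have "real N ^ 4 * ((1 / real N) ^ 4 * ?I) = ?I"
          using N0 by (simp add: power_divide)
        ultimately show "?I \<le> Cinv * real N ^ 4 * integral {?xs (i - 1)..?xs i} (\<lambda>x. (c x)\<^sup>2)"
          by (simp only: mult.assoc mult.left_commute[of Cinv])
      qed
      also have "\<dots> = Cinv * real N ^ 4 * integral {?xs M..?xs (3 * M)} (\<lambda>x. (c x)\<^sup>2)"
        by (simp only: integral_mesh_sum[OF mesh bounded_meas_square[OF c(1)] M3] sum_distrib_left)
      also have "\<dots> \<le> Cinv * real N ^ 4 * (L2_norm c)\<^sup>2"
        unfolding sm(2,3) using \<tau> Cinv by (intro mult_left_mono integral_square_le_norm c) auto
      also have "\<dots> = (sqrt Cinv * (real N)\<^sup>2 * L2_norm c)\<^sup>2"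
        using Cinv(1) by (simp add: power_mult_distrib flip: power_mult)
      finally show ?thesis unfolding sm(2,3) .
    qed
    have int: "(\<lambda>x. a x * c2 x) integrable_on {0..1}"
      by (intro bounded_meas_integrable_on bounded_meas_mult a c) auto
    have "L2_inner a c2 = integral {0..\<tau>} (\<lambda>x. a x * c2 x) + integral {\<tau>..1 - \<tau>} (\<lambda>x. a x * c2 x)
       + integral {1 - \<tau>..1} (\<lambda>x. a x * c2 x)"
    proof -
      have "integral {0..\<tau>} (\<lambda>x. a x * c2 x) + integral {\<tau>..1} (\<lambda>x. a x * c2 x) = integral {0..1} (\<lambda>x. a x * c2 x)"
        using \<tau> by (intro Henstock_Kurzweil_Integration.integral_combine int) auto
      moreover have "integral {\<tau>..1 - \<tau>} (\<lambda>x. a x * c2 x) + integral {1 - \<tau>..1} (\<lambda>x. a x * c2 x) = integral {\<tau>..1} (\<lambda>x. a x * c2 x)"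
        using \<tau> by (intro Henstock_Kurzweil_Integration.integral_combine
            bounded_meas_integrable_on bounded_meas_mult a c) auto
      ultimately show ?thesis by (simp add: L2_inner_eq_integral a c)
    qed
    moreover have "\<bar>integral {0..\<tau>} (\<lambda>x. a x * c2 x)\<bar> \<le> (\<Theta> * Cr * sqrt \<tau>) * L2_norm c2"
      using \<tau> \<Theta> Cr by (intro block_Cauchy_Schwarz left a c integral_square_le_norm L2_norm_nonneg) auto
    moreover have "\<bar>integral {1 - \<tau>..1} (\<lambda>x. a x * c2 x)\<bar> \<le> (\<Theta> * Cr * sqrt \<tau>) * L2_norm c2"
      using \<tau> \<Theta> Cr by (intro block_Cauchy_Schwarz right a c integral_square_le_norm L2_norm_nonneg) auto
    moreover have "\<bar>integral {\<tau>..1 - \<tau>} (\<lambda>x. a x * c2 x)\<bar> \<le> (2 ^ (p + 1) * \<Theta> * Cr) * (sqrt Cinv * (real N)\<^sup>2 * L2_norm c)"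
      using \<tau> \<Theta> Cr Cinv L2_norm_nonneg[of c] by (intro block_Cauchy_Schwarz mid inv a c) auto
    ultimately show ?thesis by (simp add: mult_ac)
  qed
  show ?thesis
    by (rule that[OF U(1)], erule U(2), erule orth, rule est)
       (drule mix, simp add: a_def \<Theta>_def)
qed

lemma shishkin_approximation:
  fixes \<sigma> eps Cr Cw Cinv :: real
  assumes p: "p \<ge> 3" and \<sigma>: "\<sigma> \<ge> real p + 1" and eps: "0 < eps"
    and N: "N = 4 * M" "M > 0" and \<tau>: "\<sigma> * eps * ln (real N) \<le> 1 / 4"
    and L: "L = \<sigma> * ln (real N)" "L \<ge> 1"
    and R: "deriv_chain 0 1 (p + 1) R" and Cr: "Cr \<ge> 0"
    and Rbound: "\<And>x. x \<in> {0..1} \<Longrightarrow> \<bar>R (p + 1) x\<bar> \<le> Cr"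
    and W: "deriv_chain 0 1 (p + 1) W" and Cw: "Cw \<ge> 0"
    and Wbound: "\<And>k x. k \<le> p + 1 \<Longrightarrow> x \<in> {0..1} \<Longrightarrow> \<bar>W k x\<bar> \<le> Cw / eps ^ k * layer_weight eps x"
    and Ci: "inverse_constant p Cinv"
  obtains Q U U1 U2 where "spline_triple p N (shishkin \<sigma> eps N) Q U U1 U2"
    "\<And>\<xi>. \<xi> \<in> {0, 1} \<Longrightarrow> U \<xi> = R 0 \<xi> + W 0 \<xi> \<and> U1 \<xi> = R 1 \<xi> + W 1 \<xi>"
    "\<And>C c c1 c2. spline_triple p N (shishkin \<sigma> eps N) C c c1 c2 \<Longrightarrow>
       \<bar>L2_inner (\<lambda>x. (R 2 x + W 2 x) - U2 x) c2\<bar> \<le> 42 * Cw / real N ^ (p + 1) / (eps * sqrt eps) * L2_norm c2"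
    "L2_norm (\<lambda>x. (R 0 x + W 0 x) - U x) \<le> (2 ^ (p + 1) * Cr + 9 * 4 ^ (p + 1) * Cw * sqrt eps * L ^ (p + 1)) / real N ^ (p + 1)"
    "\<And>C c c1 c2. spline_triple p N (shishkin \<sigma> eps N) C c c1 c2 \<Longrightarrow>
       \<bar>L2_inner (\<lambda>x. (R 0 x + W 0 x) - U x) c2\<bar> \<le>
         (2 * Cr * sqrt (L * eps) + 9 * 4 ^ (p + 1) * Cw * sqrt eps * L ^ (p + 1)) / real N ^ (p + 1) * L2_norm c2
         + 2 ^ (p + 1) * Cr / real N ^ (p + 1) * sqrt Cinv * (real N)\<^sup>2 * L2_norm c"
proof -
  let ?xs = "shishkin \<sigma> eps N"
  define t where "t = \<sigma> * eps * ln (real N)"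
  have tL: "t = L * eps" by (simp add: t_def L)
  have t0: "0 < t" "t \<le> 1 / 4"
  proof -
    have "0 < L * eps" using L(2) eps by simp
    then show "0 < t" by (simp only: tL)
  qed (use \<tau> in \<open>simp add: t_def\<close>)
  obtain QR UR UR1 UR2 where UR: "spline_triple p N ?xs QR UR UR1 UR2"
    "\<And>\<xi>. \<xi> \<in> {0, 1} \<Longrightarrow> UR \<xi> = R 0 \<xi> \<and> UR1 \<xi> = R 1 \<xi>"
    "\<And>C c c1 c2. spline_triple p N ?xs C c c1 c2 \<Longrightarrow> L2_inner (\<lambda>x. R 2 x - UR2 x) c2 = 0"
    "L2_norm (\<lambda>x. R 0 x - UR x) \<le> 2 ^ (p + 1) * Cr / real N ^ (p + 1)"
    "\<And>C c c1 c2. spline_triple p N ?xs C c c1 c2 \<Longrightarrow>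
       \<bar>L2_inner (\<lambda>x. R 0 x - UR x) c2\<bar> \<le> 2 * (Cr / real N ^ (p + 1)) * sqrt t * L2_norm c2
         + 2 ^ (p + 1) * Cr / real N ^ (p + 1) * sqrt Cinv * (real N)\<^sup>2 * L2_norm c"
    using regular_part_approximation[OF p N t_def t0 R Cr Rbound Ci] by blast
  obtain QW UW UW1 UW2 where UW: "spline_triple p N ?xs QW UW UW1 UW2"
    "\<And>\<xi>. \<xi> \<in> {0, 1} \<Longrightarrow> UW \<xi> = W 0 \<xi> \<and> UW1 \<xi> = W 1 \<xi>"
    "\<And>C c c1 c2. spline_triple p N ?xs C c c1 c2 \<Longrightarrow>
       \<bar>L2_inner (\<lambda>x. W 2 x - UW2 x) c2\<bar> \<le> 42 * Cw / real N ^ (p + 1) / (eps * sqrt eps) * L2_norm c2"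
    "L2_norm (\<lambda>x. W 0 x - UW x) \<le> 9 * 4 ^ (p + 1) * Cw * sqrt eps * (L ^ (p + 1) / real N ^ (p + 1))"
    using layer_part_approximation[OF p \<sigma> eps N \<tau> L W Cw Wbound] by blast
  have "2 \<le> p + 1" using p by simp
  then have bm: "R 0 \<in> bounded_meas" "R 2 \<in> bounded_meas" "W 0 \<in> bounded_meas" "W 2 \<in> bounded_meas"
    using deriv_chain_bounded_meas[OF R] deriv_chain_bounded_meas[OF W] by auto
  note bs = spline_triple_bounded_meas[OF UR(1)] spline_triple_bounded_meas[OF UW(1)]
  have split0: "(\<lambda>x. (R 0 x + W 0 x) - (UR x + UW x)) = (\<lambda>x. (R 0 x - UR x) + (W 0 x - UW x))"
    and split2: "(\<lambda>x. (R 2 x + W 2 x) - (UR2 x + UW2 x)) = (\<lambda>x. (R 2 x - UR2 x) + (W 2 x - UW2 x))"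
    by auto
  have lay: "\<bar>L2_inner (\<lambda>x. W 0 x - UW x) g\<bar> \<le> 9 * 4 ^ (p + 1) * Cw * sqrt eps * (L ^ (p + 1) / real N ^ (p + 1)) * L2_norm g"
    if "g \<in> bounded_meas" for g
    using L2_Cauchy_Schwarz[OF bounded_meas_diff[OF bm(3) bs(4)] that] mult_right_mono[OF UW(4) L2_norm_nonneg[of g]]
    by linarith
  show ?thesis
  proof (rule that[OF spline_triple_add[OF UR(1) UW(1)]])
    show "UR \<xi> + UW \<xi> = R 0 \<xi> + W 0 \<xi> \<and> UR1 \<xi> + UW1 \<xi> = R 1 \<xi> + W 1 \<xi>" if "\<xi> \<in> {0, 1}" for \<xi>
      using UR(2)[OF that] UW(2)[OF that] by simp
    show "\<bar>L2_inner (\<lambda>x. (R 2 x + W 2 x) - (UR2 x + UW2 x)) c2\<bar> \<le> 42 * Cw / real N ^ (p + 1) / (eps * sqrt eps) * L2_norm c2"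
      if C: "spline_triple p N ?xs C c c1 c2" for C c c1 c2
    proof -
      have "L2_inner (\<lambda>x. (R 2 x + W 2 x) - (UR2 x + UW2 x)) c2 = L2_inner (\<lambda>x. R 2 x - UR2 x) c2 + L2_inner (\<lambda>x. W 2 x - UW2 x) c2"
        unfolding split2 by (intro L2_inner_add_left bounded_meas_diff bm bs spline_triple_bounded_meas(3)[OF C])
      then show ?thesis using UR(3)[OF C] UW(3)[OF C] by simp
    qed
    have "L2_norm (\<lambda>x. (R 0 x + W 0 x) - (UR x + UW x)) \<le> L2_norm (\<lambda>x. R 0 x - UR x) + L2_norm (\<lambda>x. W 0 x - UW x)"
      unfolding split0 by (intro L2_norm_triangle bounded_meas_diff bm bs)
    also have "\<dots> \<le> 2 ^ (p + 1) * Cr / real N ^ (p + 1) + 9 * 4 ^ (p + 1) * Cw * sqrt eps * (L ^ (p + 1) / real N ^ (p + 1))"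
      by (intro add_mono UR UW)
    finally show "L2_norm (\<lambda>x. (R 0 x + W 0 x) - (UR x + UW x)) \<le> (2 ^ (p + 1) * Cr + 9 * 4 ^ (p + 1) * Cw * sqrt eps * L ^ (p + 1)) / real N ^ (p + 1)"
      by (simp add: add_divide_distrib)
    show "\<bar>L2_inner (\<lambda>x. (R 0 x + W 0 x) - (UR x + UW x)) c2\<bar> \<le>
         (2 * Cr * sqrt (L * eps) + 9 * 4 ^ (p + 1) * Cw * sqrt eps * L ^ (p + 1)) / real N ^ (p + 1) * L2_norm c2
         + 2 ^ (p + 1) * Cr / real N ^ (p + 1) * sqrt Cinv * (real N)\<^sup>2 * L2_norm c"
      if C: "spline_triple p N ?xs C c c1 c2" for C c c1 c2
    proof -
      note c2 = spline_triple_bounded_meas(3)[OF C]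
      have "L2_inner (\<lambda>x. (R 0 x + W 0 x) - (UR x + UW x)) c2 = L2_inner (\<lambda>x. R 0 x - UR x) c2 + L2_inner (\<lambda>x. W 0 x - UW x) c2"
        unfolding split0 by (intro L2_inner_add_left bounded_meas_diff bm bs c2)
      then have "\<bar>L2_inner (\<lambda>x. (R 0 x + W 0 x) - (UR x + UW x)) c2\<bar> \<le>
         (2 * (Cr / real N ^ (p + 1)) * sqrt t * L2_norm c2 + 2 ^ (p + 1) * Cr / real N ^ (p + 1) * sqrt Cinv * (real N)\<^sup>2 * L2_norm c)
         + 9 * 4 ^ (p + 1) * Cw * sqrt eps * (L ^ (p + 1) / real N ^ (p + 1)) * L2_norm c2"
        using UR(5)[OF C] lay[OF c2] by linarith
      also have "\<dots> = (2 * Cr * sqrt (L * eps) + 9 * 4 ^ (p + 1) * Cw * sqrt eps * L ^ (p + 1)) / real N ^ (p + 1) * L2_norm c2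
         + 2 ^ (p + 1) * Cr / real N ^ (p + 1) * sqrt Cinv * (real N)\<^sup>2 * L2_norm c"
        unfolding tL by (simp add: add_divide_distrib distrib_right)
      finally show ?thesis .
    qed
  qed
qed

section \<open>The energy argument\<close>

text \<open>After integration by parts the quadratic form of the discrete error \<open>(c, d)\<close> has the single cross term
\<open>(4 eps + 4 - 2 lam) E \<langle>d, c2\<rangle>\<close>. For \<open>lam \<ge> 3\<close> and \<open>eps \<le> 1\<close> its coefficient is at most \<open>2 lam - 4\<close> in modulus, so Young's inequality
leaves a fixed multiple of the squares. On the other side, \<open>\<langle>a2, d\<rangle>\<close> and \<open>\<langle>a, d2\<rangle>\<close> coincide by the boundary conditions of \<open>a\<close>,
which is how the factor \<open>4 - lam\<close> arises.\<close>

lemma energy_estimate: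
  assumes eps: "0 < eps" "eps \<le> 1" and lam: "lam \<ge> 3" and E: "E = eps * sqrt eps"
    and pw: "pw_C2 a a1 a2" "pw_C2 b b1 b2" "pw_C2 c c1 c2" "pw_C2 d d1 d2"
    and bc: "\<forall>\<xi>\<in>{0, 1}. a \<xi> = 0 \<and> a1 \<xi> = 0" "\<forall>\<xi>\<in>{0, 1}. c \<xi> = 0 \<and> c1 \<xi> = 0"
    and galerkin: "lam * L2_inner (\<lambda>x. (b x + d x) - E * (a2 x + c2 x)) (\<lambda>x. d x - E * c2 x)
      + L2_inner (\<lambda>x. eps * E * (b2 x + d2 x) + 4 * (a x + c x)) (\<lambda>x. E * d2 x + 4 * c x) = 0"
    and ac: "E * \<bar>L2_inner a2 c2\<bar> \<le> \<rho> * L2_norm c2" and bd: "eps\<^sup>2 * \<bar>L2_inner b2 d2\<bar> \<le> \<rho> * L2_norm d2"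
    and ad: "E * \<bar>L2_inner a d2\<bar> \<le> \<mu> * (eps\<^sup>2 * L2_norm d2 + L2_norm d)"
    and nonneg: "\<rho> \<ge> 0" "\<mu> \<ge> 0"
  shows "L2_norm c \<le> 16 * L2_norm a + (2 * lam + 4) * L2_norm b + 2 * \<bar>lam - 4\<bar> * \<mu> + (lam + 1) * \<rho>"
    "L2_norm d \<le> 16 * L2_norm a + (2 * lam + 4) * L2_norm b + 2 * \<bar>lam - 4\<bar> * \<mu> + (lam + 1) * \<rho>"
proof -
  note bms = pw_C2_bounded_meas[OF pw(1)] pw_C2_bounded_meas[OF pw(2)]
    pw_C2_bounded_meas[OF pw(3)] pw_C2_bounded_meas[OF pw(4)]
  have E0: "E > 0" and Eeps: "eps * E * E = eps ^ 4"
    using eps by (auto simp: E eval_nat_numeral)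
  have g1: "L2_inner a2 d = L2_inner a d2"
    using Green_identity[OF pw(4,1) bc(1)] by (simp add: L2_inner_commute)
  have g2: "L2_inner b2 c = L2_inner b c2" by (rule Green_identity[OF pw(2,3) bc(2)])
  have g3: "L2_inner d2 c = L2_inner d c2" by (rule Green_identity[OF pw(4,3) bc(2)])
  have comm: "L2_inner c2 d = L2_inner d c2" "L2_inner c d2 = L2_inner d c2"
    using g3 by (simp_all add: L2_inner_commute)
  let ?i = L2_inner
  have i1: "?i (\<lambda>x. (b x + d x) - E * (a2 x + c2 x)) (\<lambda>x. d x - E * c2 x) =
    ?i b d - E * ?i b c2 + ?i d d - E * ?i d c2 - E * ?i a d2 - E * ?i d c2 + E * E * ?i a2 c2 + E * E * ?i c2 c2"
    using bms by (simp add: L2_inner_linear bounded_meas_intros bounded_meas_cmult g1 comm algebra_simps)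
  have i2: "?i (\<lambda>x. eps * E * (b2 x + d2 x) + 4 * (a x + c x)) (\<lambda>x. E * d2 x + 4 * c x) =
    eps * E * E * (?i b2 d2 + ?i d2 d2) + 4 * eps * E * (?i b c2 + ?i d c2) + 4 * E * (?i a d2 + ?i d c2)
    + 16 * (?i a c + ?i c c)"
    using bms by (simp add: L2_inner_linear bounded_meas_intros bounded_meas_cmult g2 g3 comm, simp add: algebra_simps)
  define m where "m = (?i d d + E * E * ?i c2 c2) / 2"
  \<comment> \<open>Expand the squared norms of \<open>d - E c2\<close> and \<open>d + E c2\<close>.\<close>
  have young: "\<bar>E * ?i d c2\<bar> \<le> m"
  proof -
    have "?i (\<lambda>x. d x - E * c2 x) (\<lambda>x. d x - E * c2 x) = ?i d d - 2 * (E * ?i d c2) + E * E * ?i c2 c2"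
      "?i (\<lambda>x. d x + E * c2 x) (\<lambda>x. d x + E * c2 x) = ?i d d + 2 * (E * ?i d c2) + E * E * ?i c2 c2"
      using bms by (simp_all add: L2_inner_linear bounded_meas_intros bounded_meas_cmult comm algebra_simps)
    then have "0 \<le> ?i d d - 2 * (E * ?i d c2) + E * E * ?i c2 c2" "0 \<le> ?i d d + 2 * (E * ?i d c2) + E * E * ?i c2 c2"
      by (metis L2_inner_self_nonneg)+
    then show ?thesis by (simp add: m_def abs_le_iff)
  qed
  have m0: "m \<ge> 0" using young by linarith
  have cross: "(4 * eps + 4 - 2 * lam) * (E * ?i d c2) \<ge> - ((2 * lam - 4) * m)"
  proof -
    have "\<bar>(4 * eps + 4 - 2 * lam) * (E * ?i d c2)\<bar> \<le> (2 * lam - 4) * m"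
      unfolding abs_mult[of "4 * eps + 4 - 2 * lam"] using young eps lam by (intro mult_mono) auto
    then show ?thesis by linarith
  qed
  define X where "X = L2_norm d"
  define Y where "Y = E * L2_norm c2"
  define Z where "Z = eps\<^sup>2 * L2_norm d2"
  define W where "W = L2_norm c"
  have XYZW: "X \<ge> 0" "Y \<ge> 0" "Z \<ge> 0" "W \<ge> 0"
    using E0 by (simp_all add: X_def Y_def Z_def W_def L2_norm_nonneg)
  \<comment> \<open>The energy norm of the discrete error.\<close>
  define n where "n = sqrt (X\<^sup>2 + Y\<^sup>2 + Z\<^sup>2 + W\<^sup>2)"
  have n2: "n\<^sup>2 = X\<^sup>2 + Y\<^sup>2 + Z\<^sup>2 + W\<^sup>2" by (simp add: n_def)
  have le: "X \<le> n" "Y \<le> n" "Z \<le> n" "W \<le> n"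
    unfolding n_def by (intro real_le_rsqrt; simp)+
  have n0: "n \<ge> 0" by (simp add: n_def)
  have n2': "n\<^sup>2 = ?i d d + E * E * ?i c2 c2 + eps ^ 4 * ?i d2 d2 + ?i c c"
    by (simp add: n2 X_def Y_def Z_def W_def power_mult_distrib L2_norm_square power2_eq_square[of E] flip: power_mult)
  have sum0: "lam * (?i b d - E * ?i b c2 + ?i d d - E * ?i d c2 - E * ?i a d2 - E * ?i d c2 + E * E * ?i a2 c2 + E * E * ?i c2 c2)
     + (eps ^ 4 * (?i b2 d2 + ?i d2 d2) + 4 * eps * E * (?i b c2 + ?i d c2) + 4 * E * (?i a d2 + ?i d c2)
    + 16 * (?i a c + ?i c c)) = 0"
    using galerkin unfolding i1 i2 Eeps .
  define K where "K = - (lam * ?i b d + (4 * eps - lam) * (E * ?i b c2) + (4 - lam) * (E * ?i a d2)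
      + lam * (E * E * ?i a2 c2) + eps ^ 4 * ?i b2 d2 + 16 * ?i a c)"
  have low: "n\<^sup>2 \<le> K"
  proof -
    have "lam * (?i d d + E * E * ?i c2 c2) + (4 * eps + 4 - 2 * lam) * (E * ?i d c2) + eps ^ 4 * ?i d2 d2 + 16 * ?i c c = K"
      using sum0 unfolding K_def by (simp add: algebra_simps)
    moreover have "lam * (?i d d + E * E * ?i c2 c2) = 2 * lam * m" by (simp add: m_def)
    moreover have "?i d d + E * E * ?i c2 c2 = 2 * m" by (simp add: m_def)
    moreover have "eps ^ 4 * ?i d2 d2 \<ge> 0" "?i c c \<ge> 0"
      by (simp_all add: L2_inner_self_nonneg)
    moreover have "2 * lam * m - (2 * lam - 4) * m = 4 * m" by (simp add: algebra_simps)
    ultimately show ?thesis using cross m0 unfolding n2' by linarith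
  qed
  \<comment> \<open>The factor by which \<open>n\<close> bounds the right-hand side \<open>K\<close>.\<close>
  define B where "B = 16 * L2_norm a + (2 * lam + 4) * L2_norm b + 2 * \<bar>lam - 4\<bar> * \<mu> + (lam + 1) * \<rho>"
  note CS = L2_Cauchy_Schwarz
  have na: "L2_norm a \<ge> 0" and nb: "L2_norm b \<ge> 0" by (rule L2_norm_nonneg)+
  have t1: "\<bar>lam * ?i b d\<bar> \<le> lam * L2_norm b * n"
  proof -
    have "\<bar>?i b d\<bar> \<le> L2_norm b * X" unfolding X_def using bms by (intro CS)
    also have "\<dots> \<le> L2_norm b * n" by (intro mult_left_mono le nb)
    finally show ?thesis using lam by (simp add: abs_mult mult.assoc)
  qed
  have t2: "\<bar>(4 * eps - lam) * (E * ?i b c2)\<bar> \<le> (4 + lam) * (L2_norm b * n)"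
    unfolding abs_mult[of "4 * eps - lam"]
  proof (rule mult_mono)
    have "\<bar>E * ?i b c2\<bar> = E * \<bar>?i b c2\<bar>" using E0 by (simp add: abs_mult)
    also have "\<dots> \<le> E * (L2_norm b * L2_norm c2)" using bms E0 by (intro mult_left_mono CS) auto
    also have "\<dots> = L2_norm b * Y" by (simp add: Y_def)
    also have "\<dots> \<le> L2_norm b * n" by (intro mult_left_mono le nb)
    finally show "\<bar>E * ?i b c2\<bar> \<le> L2_norm b * n" .
  qed (use lam eps in auto)
  have t3: "\<bar>(4 - lam) * (E * ?i a d2)\<bar> \<le> \<bar>lam - 4\<bar> * (\<mu> * (2 * n))"
    unfolding abs_mult[of "4 - lam"] abs_minus_commute[of 4]
  proof (rule mult_left_mono)
    have "\<bar>E * ?i a d2\<bar> = E * \<bar>?i a d2\<bar>" using E0 by (simp add: abs_mult)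
    also have "\<dots> \<le> \<mu> * (Z + X)" using ad by (simp add: Z_def X_def)
    also have "\<dots> \<le> \<mu> * (2 * n)" using le nonneg by (intro mult_left_mono) auto
    finally show "\<bar>E * ?i a d2\<bar> \<le> \<mu> * (2 * n)" .
  qed simp
  have t4: "\<bar>lam * (E * E * ?i a2 c2)\<bar> \<le> lam * (\<rho> * n)"
  proof -
    have "\<bar>E * E * ?i a2 c2\<bar> = E * (E * \<bar>?i a2 c2\<bar>)" using E0 by (simp add: abs_mult)
    also have "\<dots> \<le> E * (\<rho> * L2_norm c2)" using E0 by (intro mult_left_mono ac) auto
    also have "\<dots> = \<rho> * Y" by (simp add: Y_def)
    also have "\<dots> \<le> \<rho> * n" by (intro mult_left_mono le nonneg)
    finally show ?thesis using lam by (simp add: abs_mult)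
  qed
  have t5: "\<bar>eps ^ 4 * ?i b2 d2\<bar> \<le> \<rho> * n"
  proof -
    have "\<bar>eps ^ 4 * ?i b2 d2\<bar> = eps\<^sup>2 * (eps\<^sup>2 * \<bar>?i b2 d2\<bar>)" by (simp add: abs_mult eval_nat_numeral)
    also have "\<dots> \<le> eps\<^sup>2 * (\<rho> * L2_norm d2)" by (intro mult_left_mono bd) auto
    also have "\<dots> = \<rho> * Z" by (simp add: Z_def)
    also have "\<dots> \<le> \<rho> * n" by (intro mult_left_mono le nonneg)
    finally show ?thesis .
  qed
  have t6: "\<bar>16 * ?i a c\<bar> \<le> 16 * (L2_norm a * n)"
  proof -
    have "\<bar>?i a c\<bar> \<le> L2_norm a * W" unfolding W_def using bms by (intro CS)
    also have "\<dots> \<le> L2_norm a * n" by (intro mult_left_mono le na)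
    finally show ?thesis by simp
  qed
  have "n * n \<le> B * n"
  proof -
    have "n * n \<le> lam * L2_norm b * n + (4 + lam) * (L2_norm b * n) + \<bar>lam - 4\<bar> * (\<mu> * (2 * n))
       + lam * (\<rho> * n) + \<rho> * n + 16 * (L2_norm a * n)"
      using low t1 t2 t3 t4 t5 t6 unfolding K_def power2_eq_square by linarith
    also have "\<dots> = B * n" by (simp add: B_def algebra_simps)
    finally show ?thesis .
  qed
  moreover have "B \<ge> 0" using na nb lam nonneg by (simp add: B_def)
  ultimately have "n \<le> B"
    using n0 by (cases "n = 0") (auto simp: mult_le_cancel_right)
  then show "L2_norm c \<le> 16 * L2_norm a + (2 * lam + 4) * L2_norm b + 2 * \<bar>lam - 4\<bar> * \<mu> + (lam + 1) * \<rho>"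
    "L2_norm d \<le> 16 * L2_norm a + (2 * lam + 4) * L2_norm b + 2 * \<bar>lam - 4\<bar> * \<mu> + (lam + 1) * \<rho>"
    using le unfolding B_def X_def W_def by linarith+
qed

section \<open>Galerkin orthogonality and the error bound\<close>

lemma L2_cmult: "f \<in> L2 \<Longrightarrow> (\<lambda>x. k * f x) \<in> L2"
  by (auto simp: L2_def power_mult_distrib)

lemma L2_add:
  assumes "f \<in> L2" "g \<in> L2"
  shows "(\<lambda>x. f x + g x) \<in> L2"
  using L2_diff[OF assms(1) L2_cmult[OF assms(2), of "-1"]] by simp

lemma weak_deriv_in_L2: "has_weak_deriv k w g \<Longrightarrow> weak_deriv k w \<in> L2"
  unfolding weak_deriv_def by (metis has_weak_deriv_def someI)

lemma spline_pair_in_Vh: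
  assumes C: "spline_triple p N xs Qc c c1 c2" and D: "spline_triple p N xs Qd d d1 d2"
    and bc: "\<forall>\<xi>\<in>{0, 1}. c \<xi> = 0 \<and> c1 \<xi> = 0"
  shows "(c, d) \<in> Vh p N xs"
proof -
  have pw: "pw_C2 c c1 c2" "pw_C2 d d1 d2" using C D by (auto simp: spline_triple_def)
  have "c \<in> Sobolev2_0"
    unfolding Sobolev2_0_def using pw_C2_Sobolev2[OF pw(1)] spline_triple_C_closed[OF C] bc
    by (auto intro!: bexI[of _ c])
  then show ?thesis
    using pw_C2_Sobolev2[OF pw(2)] spline_triple_space[OF C] spline_triple_space[OF D]
    by (simp add: Vh_def V_def)
qed

lemma powr_three_halves:
  assumes "(0::real) < eps"
  shows "eps powr (3 / 2) = eps * sqrt eps" "eps powr (5 / 2) = eps * (eps * sqrt eps)" "eps powr (- 1 / 2) = 1 / sqrt eps"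
proof -
  have "eps powr (3 / 2) = eps powr (1 + 1 / 2)" by simp
  also have "\<dots> = eps * sqrt eps" using assms by (subst powr_add) (simp add: powr_half_sqrt)
  finally show 1: "eps powr (3 / 2) = eps * sqrt eps" .
  have "eps powr (5 / 2) = eps powr (1 + 3 / 2)" by simp
  also have "\<dots> = eps * (eps * sqrt eps)" using assms 1 by (subst powr_add) simp
  finally show "eps powr (5 / 2) = eps * (eps * sqrt eps)" .
  have "eps powr (- 1 / 2) = eps powr (- (1 / 2))" by simp
  also have "\<dots> = 1 / sqrt eps" using assms by (subst powr_minus) (simp add: powr_half_sqrt inverse_eq_divide)
  finally show "eps powr (- 1 / 2) = 1 / sqrt eps" .
qed

text \<open>Consistency of the variational equation with \<open>u\<close> and \<open>v = E u''\<close>: the first slot vanishes by the definition of \<open>v\<close>, and the second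
slot is the differential equation. Weak derivatives are replaced by classical ones almost everywhere.\<close>

lemma galerkin_orthogonality:
  assumes eps: "0 < eps" and E: "E = eps * sqrt eps" and f: "f \<in> L2"
    and G: "deriv_chain 0 1 m G" "4 \<le> m" and u: "\<And>x. x \<in> {0..1} \<Longrightarrow> u x = G 0 x"
    and bvp: "bvp_solution eps f u" and fe: "fe_solution p N xs lam eps f (uh, vh)"
    and UH: "spline_triple p N xs Qu uh uh1 uh2" and VH: "spline_triple p N xs Qv vh vh1 vh2"
    and C: "spline_triple p N xs Qc c c1 c2" and D: "spline_triple p N xs Qd d d1 d2"
    and bc: "\<forall>\<xi>\<in>{0, 1}. c \<xi> = 0 \<and> c1 \<xi> = 0"
  shows "lam * L2_inner (\<lambda>x. (E * G 2 x - vh x) - E * (G 2 x - uh2 x)) (\<lambda>x. d x - E * c2 x)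
      + L2_inner (\<lambda>x. eps * E * (E * G 4 x - vh2 x) + 4 * (G 0 x - uh x)) (\<lambda>x. E * d2 x + 4 * c x) = 0"
proof -
  have bmG: "G 0 \<in> bounded_meas" "G 2 \<in> bounded_meas" "G 4 \<in> bounded_meas"
    using deriv_chain_bounded_meas[OF G(1)] G(2) by auto
  note bm = spline_triple_bounded_meas[OF UH] spline_triple_bounded_meas[OF VH]
    spline_triple_bounded_meas[OF C] spline_triple_bounded_meas[OF D]
  have pw: "pw_C2 uh uh1 uh2" "pw_C2 vh vh1 vh2" "pw_C2 c c1 c2" "pw_C2 d d1 d2"
    using UH VH C D by (auto simp: spline_triple_def)
  note wd = pw[THEN pw_C2_weak_deriv2]
  note ae = wd[THEN weak_deriv_AE_eq]
  note wL2 = wd[THEN weak_deriv_in_L2]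
  note pows = powr_three_halves[OF eps]
  note L2i = L2_add L2_diff L2_cmult wL2 bm[THEN bounded_meas_L2] bmG[THEN bounded_meas_L2] f
  have z: "(c, d) \<in> Vh p N xs" by (rule spline_pair_in_Vh[OF C D bc])
  have fe': "bilin lam eps (uh, vh) (c, d) = load eps f (c, d)"
    using fe z by (simp add: fe_solution_def)
  have b1: "L2_inner (\<lambda>x. vh x - E * weak_deriv 2 uh x) (\<lambda>x. d x - E * weak_deriv 2 c x)
    = L2_inner (\<lambda>x. vh x - E * uh2 x) (\<lambda>x. d x - E * c2 x)"
  proof (rule L2_inner_cong_AE)
    show "AE x in lebesgue_on Omega. vh x - E * weak_deriv 2 uh x = vh x - E * uh2 x"
      using ae(1) by eventually_elim simp
    show "AE x in lebesgue_on Omega. d x - E * weak_deriv 2 c x = d x - E * c2 x"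
      using ae(3) by eventually_elim simp
  qed (intro disjI1 L2i)+
  have b2: "L2_inner (\<lambda>x. eps * E * weak_deriv 2 vh x + 4 * uh x) (\<lambda>x. E * weak_deriv 2 d x + 4 * c x)
    = L2_inner (\<lambda>x. eps * E * vh2 x + 4 * uh x) (\<lambda>x. E * d2 x + 4 * c x)"
  proof (rule L2_inner_cong_AE)
    show "AE x in lebesgue_on Omega. eps * E * weak_deriv 2 vh x + 4 * uh x = eps * E * vh2 x + 4 * uh x"
      using ae(2) by eventually_elim simp
    show "AE x in lebesgue_on Omega. E * weak_deriv 2 d x + 4 * c x = E * d2 x + 4 * c x"
      using ae(4) by eventually_elim simp
  qed (intro disjI1 L2i)+
  have wu: "has_weak_deriv 4 u (G 4)"
    by (rule has_weak_deriv_cong[OF deriv_chain_weak_deriv4[OF G]]) (use u in simp)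
  have b3: "L2_inner f (\<lambda>x. E * weak_deriv 2 d x + 4 * c x)
    = L2_inner (\<lambda>x. eps * E * (E * G 4 x) + 4 * G 0 x) (\<lambda>x. E * d2 x + 4 * c x)"
  proof (rule L2_inner_cong_AE)
    have e4: "eps ^ 4 = eps * E * E" using eps by (simp add: E eval_nat_numeral)
    have "AE x in lebesgue_on Omega. eps ^ 4 * weak_deriv 4 u x + 4 * u x = f x"
      using bvp by (simp add: bvp_solution_def)
    moreover have "AE x in lebesgue_on Omega. u x = G 0 x"
      by (rule AE_I2) (use u in auto)
    moreover note weak_deriv_AE_eq[OF wu]
    ultimately show "AE x in lebesgue_on Omega. f x = eps * E * (E * G 4 x) + 4 * G 0 x"
      by eventually_elim (simp add: e4)
    show "AE x in lebesgue_on Omega. E * weak_deriv 2 d x + 4 * c x = E * d2 x + 4 * c x"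
      using ae(4) by eventually_elim simp
  qed (intro disjI1 L2i)+
  have eq: "lam * L2_inner (\<lambda>x. vh x - E * uh2 x) (\<lambda>x. d x - E * c2 x)
     + L2_inner (\<lambda>x. eps * E * vh2 x + 4 * uh x) (\<lambda>x. E * d2 x + 4 * c x)
     = L2_inner (\<lambda>x. eps * E * (E * G 4 x) + 4 * G 0 x) (\<lambda>x. E * d2 x + 4 * c x)"
    using fe' unfolding bilin_def load_def case_prod_conv pows(2) unfolding pows E[symmetric] b1 b2 b3 .
  have "L2_inner (\<lambda>x. (E * G 2 x - vh x) - E * (G 2 x - uh2 x)) (\<lambda>x. d x - E * c2 x) =
    - L2_inner (\<lambda>x. vh x - E * uh2 x) (\<lambda>x. d x - E * c2 x)"
    using L2_inner_cmult_left[of "-1" "\<lambda>x. vh x - E * uh2 x" "\<lambda>x. d x - E * c2 x"]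
    by (simp add: right_diff_distrib)
  moreover have "L2_inner (\<lambda>x. eps * E * (E * G 4 x - vh2 x) + 4 * (G 0 x - uh x)) (\<lambda>x. E * d2 x + 4 * c x) =
     L2_inner (\<lambda>x. eps * E * (E * G 4 x) + 4 * G 0 x) (\<lambda>x. E * d2 x + 4 * c x)
     - L2_inner (\<lambda>x. eps * E * vh2 x + 4 * uh x) (\<lambda>x. E * d2 x + 4 * c x)"
  proof -
    have "(\<lambda>x. eps * E * (E * G 4 x - vh2 x) + 4 * (G 0 x - uh x)) =
      (\<lambda>x. (eps * E * (E * G 4 x) + 4 * G 0 x) - (eps * E * vh2 x + 4 * uh x))"
      by (auto simp: algebra_simps)
    then show ?thesis
      by (simp only:) (intro L2_inner_diff_left bounded_meas_add bounded_meas_cmult bm bmG)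
  qed
  ultimately show ?thesis using eq by simp
qed

lemma deriv_chain_add:
  assumes "deriv_chain a b m F" "deriv_chain a b m G"
  shows "deriv_chain a b m (\<lambda>k x. F k x + G k x)"
  using assms unfolding deriv_chain_def by (auto intro!: DERIV_add continuous_intros)

lemma deriv_chain_shift_scale:
  assumes "deriv_chain a b m F" "j + n \<le> m"
  shows "deriv_chain a b n (\<lambda>k x. r * F (k + j) x)"
  using assms unfolding deriv_chain_def by (auto intro!: DERIV_cmult continuous_intros)

lemma deriv_chain_mono: "deriv_chain a b m F \<Longrightarrow> n \<le> m \<Longrightarrow> deriv_chain a b n F"
  unfolding deriv_chain_def by auto

lemma spline_Vh_boundary:
  assumes "(uh, vh) \<in> Vh p N xs" "\<xi> \<in> {0, 1}"
  shows "uh \<xi> = 0" "D01 uh \<xi> = 0"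
proof -
  have "uh \<in> C_closed 1" "uh \<in> Sobolev2_0"
    using assms(1) by (auto simp: Vh_def V_def spline_space_def)
  moreover have "deriv_chain 0 1 1 (\<lambda>k. (D01 ^^ k) uh)" by (rule C_closed_deriv_chain) fact
  then have "continuous_on {0..1} uh" "\<And>x. x \<in> {0..1} \<Longrightarrow> (uh has_real_derivative D01 uh x) (at x within {0..1})"
    by (auto simp: deriv_chain_def dest: spec[of _ 0])
  ultimately show "uh \<xi> = 0" "D01 uh \<xi> = 0"
    using Sobolev2_0_boundary[of uh "D01 uh" \<xi>] assms(2) by blast+
qed

text \<open>The two layer parts are treated as one function with a weight that decays from both ends.\<close>

lemma layer_decomposition_chains:
  assumes "layer_decomposition m C0 eps f u"
  obtains R W where "deriv_chain 0 1 m R" "deriv_chain 0 1 m W"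
    "\<And>x. x \<in> {0..1} \<Longrightarrow> u x = R 0 x + W 0 x"
    "\<And>k x. x \<in> {0..1} \<Longrightarrow> k \<le> m \<Longrightarrow> \<bar>R k x\<bar> \<le> C0"
    "\<And>k x. x \<in> {0..1} \<Longrightarrow> k \<le> m \<Longrightarrow> \<bar>W k x\<bar> \<le> C0 / eps ^ k * layer_weight eps x"
proof -
  obtain ureg ubl0 ubl1 where U: "ureg \<in> C_closed m" "ubl0 \<in> C_closed m" "ubl1 \<in> C_closed m"
    "\<And>x. x \<in> {0..1} \<Longrightarrow> u x = ubl0 x + ureg x + ubl1 x"
    "\<And>x k. x \<in> {0..1} \<Longrightarrow> k \<le> m \<Longrightarrow> \<bar>(D01 ^^ k) ureg x\<bar> \<le> C0 \<and>
      \<bar>(D01 ^^ k) ubl0 x\<bar> \<le> C0 * eps powi (- int k) * exp (- x / eps) \<and>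
      \<bar>(D01 ^^ k) ubl1 x\<bar> \<le> C0 * eps powi (- int k) * exp (- (1 - x) / eps)"
    using assms unfolding layer_decomposition_def by blast
  let ?R = "\<lambda>k. (D01 ^^ k) ureg"
  let ?W = "\<lambda>k x. (D01 ^^ k) ubl0 x + (D01 ^^ k) ubl1 x"
  show ?thesis
  proof (rule that[of ?R ?W])
    show "deriv_chain 0 1 m ?R" by (rule C_closed_deriv_chain[OF U(1)])
    show "deriv_chain 0 1 m ?W" by (intro deriv_chain_add C_closed_deriv_chain U)
    show "u x = ?R 0 x + ?W 0 x" if "x \<in> {0..1}" for x using U(4)[OF that] by simp
    show "\<bar>?R k x\<bar> \<le> C0" if "x \<in> {0..1}" "k \<le> m" for k x using U(5)[OF that] by simp
    show "\<bar>?W k x\<bar> \<le> C0 / eps ^ k * layer_weight eps x" if "x \<in> {0..1}" "k \<le> m" for k x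
    proof -
      have "\<bar>?W k x\<bar> \<le> \<bar>(D01 ^^ k) ubl0 x\<bar> + \<bar>(D01 ^^ k) ubl1 x\<bar>" by (rule abs_triangle_ineq)
      also have "\<dots> \<le> C0 * eps powi (- int k) * exp (- x / eps) + C0 * eps powi (- int k) * exp (- (1 - x) / eps)"
        using U(5)[OF that] by (intro add_mono) auto
      also have "\<dots> = C0 / eps ^ k * layer_weight eps x"
        by (simp add: layer_weight_def power_int_minus divide_inverse distrib_left)
      finally show ?thesis .
    qed
  qed
qed

lemma bvp_solution_boundary:
  assumes "bvp_solution eps f u" and G: "deriv_chain 0 1 m G" "1 \<le> m"
    and uG: "\<And>x. x \<in> {0..1} \<Longrightarrow> u x = G 0 x" and \<xi>: "\<xi> \<in> {0, 1}"
  shows "G 0 \<xi> = 0" "G 1 \<xi> = 0"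
proof -
  have c0: "continuous_on {0..1} (G 0)"
    and d0: "\<And>x. x \<in> {0..1} \<Longrightarrow> (G 0 has_real_derivative G 1 x) (at x within {0..1})"
    using G by (auto simp: deriv_chain_def)
  have cu: "continuous_on {0..1} u" by (rule continuous_on_eq[OF c0]) (simp add: uG)
  have du: "(u has_real_derivative G 1 x) (at x within {0..1})" if "x \<in> {0..1}" for x
    by (rule has_field_derivative_transform_within[OF d0[OF that] zero_less_one that]) (simp add: uG)
  have "u \<in> Sobolev2_0" using assms(1) by (simp add: bvp_solution_def)
  from Sobolev2_0_boundary[OF this cu du \<xi>] have "u \<xi> = 0" "G 1 \<xi> = 0" by auto
  moreover have "\<xi> \<in> {0..1}" using \<xi> by auto
  ultimately show "G 0 \<xi> = 0" "G 1 \<xi> = 0" using uG by auto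
qed

text \<open>The auxiliary variable inherits a decomposition: multiplication by \<open>E\<close> and two differentiations turn the regular
bound \<open>C0\<close> into \<open>E C0 \<le> C0\<close> and the layer bound \<open>C0\<close> into \<open>C0 / sqrt eps\<close>. The factor \<open>sqrt eps\<close> in the approximation of the layer
parts makes up for the latter.\<close>

lemma discretisation_error:
  fixes \<sigma> eps C0 Cinv lam :: real
  assumes p: "p \<ge> 3" and \<sigma>: "\<sigma> \<ge> real p + 1" and lam: "lam \<ge> 3" and C0: "C0 > 0" and eps: "0 < eps" "eps \<le> 1"
    and N: "N = 4 * M" "M > 0" and \<tau>: "\<sigma> * eps * ln (real N) \<le> 1 / 4"
    and L: "L = \<sigma> * ln (real N)" "L \<ge> 1"
    and f: "f \<in> L2" and bvp: "bvp_solution eps f u" and layers: "layer_decomposition (p + 3) C0 eps f u"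
    and fe: "fe_solution p N (shishkin \<sigma> eps N) lam eps f (uh, vh)"
    and Ci: "inverse_constant p Cinv"
    and P: "P = C0 * ((4 * lam + 42) * (10 * 4 ^ (p + 1)) + 84 * (lam + 1) + 44 * \<bar>lam - 4\<bar> * 4 ^ (p + 1))"
    and K: "K = C0 * (4 * 2 ^ (p + 1) * (1 + sqrt Cinv))"
  shows "L2_norm (\<lambda>x. u x - uh x) + L2_norm (\<lambda>x. eps powr (3/2) * weak_deriv 2 u x - vh x)
    \<le> (P * L ^ (p + 1) + K * (\<bar>lam - 4\<bar> * min (eps powr (3/2) * real N ^ 2) (eps powr (- 1/2)))) / real N ^ (p + 1)"
proof -
  let ?xs = "shishkin \<sigma> eps N"
  have Cinv: "Cinv \<ge> 0" using Ci by (simp add: inverse_constant_def)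
  define s where "s = sqrt eps"
  define E where "E = eps * sqrt eps"
  have s: "0 < s" "s \<le> 1" "s * s = eps" using eps by (auto simp: s_def)
  have Es: "E = eps * s" by (simp add: E_def s_def)
  have E0: "0 < E" "E \<le> 1" using eps s by (auto simp: Es mult_le_one)
  have Eeps: "E * s = eps\<^sup>2" using s by (simp add: Es power2_eq_square)
  note pows = powr_three_halves[OF eps(1), folded E_def]
  have t0: "0 < \<sigma> * eps * ln (real N)"
  proof -
    have "0 < L * eps" using L(2) eps by simp
    then show ?thesis by (simp add: L mult_ac)
  qed
  note mesh = shishkin_mesh(1)[OF N refl t0 \<tau>]
  obtain R W where chR: "deriv_chain 0 1 (p + 3) R" and chW: "deriv_chain 0 1 (p + 3) W"
    and uRW: "\<And>x. x \<in> {0..1} \<Longrightarrow> u x = R 0 x + W 0 x"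
    and Rb: "\<And>k x. x \<in> {0..1} \<Longrightarrow> k \<le> p + 3 \<Longrightarrow> \<bar>R k x\<bar> \<le> C0"
    and Wb: "\<And>k x. x \<in> {0..1} \<Longrightarrow> k \<le> p + 3 \<Longrightarrow> \<bar>W k x\<bar> \<le> C0 / eps ^ k * layer_weight eps x"
    using layer_decomposition_chains[OF layers] by blast
  define G where "G = (\<lambda>k x. R k x + W k x)"
  have chG: "deriv_chain 0 1 (p + 3) G" unfolding G_def by (intro deriv_chain_add chR chW)
  have uG: "u x = G 0 x" if "x \<in> {0..1}" for x using uRW[OF that] by (simp add: G_def)
  obtain QU A A1 A2 where A: "spline_triple p N ?xs QU A A1 A2"
    "\<And>\<xi>. \<xi> \<in> {0, 1} \<Longrightarrow> A \<xi> = R 0 \<xi> + W 0 \<xi> \<and> A1 \<xi> = R 1 \<xi> + W 1 \<xi>"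
    "\<And>C c c1 c2. spline_triple p N ?xs C c c1 c2 \<Longrightarrow>
       \<bar>L2_inner (\<lambda>x. (R 2 x + W 2 x) - A2 x) c2\<bar> \<le> 42 * C0 / real N ^ (p + 1) / (eps * sqrt eps) * L2_norm c2"
    "L2_norm (\<lambda>x. (R 0 x + W 0 x) - A x) \<le> (2 ^ (p + 1) * C0 + 9 * 4 ^ (p + 1) * C0 * sqrt eps * L ^ (p + 1)) / real N ^ (p + 1)"
    "\<And>C c c1 c2. spline_triple p N ?xs C c c1 c2 \<Longrightarrow>
       \<bar>L2_inner (\<lambda>x. (R 0 x + W 0 x) - A x) c2\<bar> \<le>
         (2 * C0 * sqrt (L * eps) + 9 * 4 ^ (p + 1) * C0 * sqrt eps * L ^ (p + 1)) / real N ^ (p + 1) * L2_norm c2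
         + 2 ^ (p + 1) * C0 / real N ^ (p + 1) * sqrt Cinv * (real N)\<^sup>2 * L2_norm c"
  proof -
    have c: "deriv_chain 0 1 (p + 1) R" "deriv_chain 0 1 (p + 1) W"
      using deriv_chain_mono[OF chR] deriv_chain_mono[OF chW] by auto
    have b: "\<And>x. x \<in> {0..1} \<Longrightarrow> \<bar>R (p + 1) x\<bar> \<le> C0"
      "\<And>k x. k \<le> p + 1 \<Longrightarrow> x \<in> {0..1} \<Longrightarrow> \<bar>W k x\<bar> \<le> C0 / eps ^ k * layer_weight eps x"
      by (rule Rb Wb; simp)+
    from shishkin_approximation[OF p \<sigma> eps(1) N \<tau> L c(1) less_imp_le[OF C0] b(1) c(2) less_imp_le[OF C0] b(2) Ci]
    show ?thesis using that by blast
  qed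
  define Rv where "Rv = (\<lambda>k x. E * R (k + 2) x)"
  define Wv where "Wv = (\<lambda>k x. E * W (k + 2) x)"
  obtain QV B B1 B2 where B: "spline_triple p N ?xs QV B B1 B2"
    "\<And>\<xi>. \<xi> \<in> {0, 1} \<Longrightarrow> B \<xi> = Rv 0 \<xi> + Wv 0 \<xi> \<and> B1 \<xi> = Rv 1 \<xi> + Wv 1 \<xi>"
    "\<And>C c c1 c2. spline_triple p N ?xs C c c1 c2 \<Longrightarrow>
       \<bar>L2_inner (\<lambda>x. (Rv 2 x + Wv 2 x) - B2 x) c2\<bar> \<le> 42 * (C0 / s) / real N ^ (p + 1) / (eps * sqrt eps) * L2_norm c2"
    "L2_norm (\<lambda>x. (Rv 0 x + Wv 0 x) - B x) \<le> (2 ^ (p + 1) * C0 + 9 * 4 ^ (p + 1) * (C0 / s) * sqrt eps * L ^ (p + 1)) / real N ^ (p + 1)"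
    "\<And>C c c1 c2. spline_triple p N ?xs C c c1 c2 \<Longrightarrow>
       \<bar>L2_inner (\<lambda>x. (Rv 0 x + Wv 0 x) - B x) c2\<bar> \<le>
         (2 * C0 * sqrt (L * eps) + 9 * 4 ^ (p + 1) * (C0 / s) * sqrt eps * L ^ (p + 1)) / real N ^ (p + 1) * L2_norm c2
         + 2 ^ (p + 1) * C0 / real N ^ (p + 1) * sqrt Cinv * (real N)\<^sup>2 * L2_norm c"
  proof -
    have c: "deriv_chain 0 1 (p + 1) Rv" "deriv_chain 0 1 (p + 1) Wv"
      unfolding Rv_def Wv_def by (rule deriv_chain_shift_scale[OF chR] deriv_chain_shift_scale[OF chW]; simp)+
    have b1: "\<bar>Rv (p + 1) x\<bar> \<le> C0" if "x \<in> {0..1}" for x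
    proof -
      have "\<bar>Rv (p + 1) x\<bar> = E * \<bar>R (p + 1 + 2) x\<bar>" using E0 by (simp add: Rv_def abs_mult)
      also have "\<dots> \<le> 1 * C0" using E0 by (intro mult_mono Rb that) auto
      finally show ?thesis by simp
    qed
    have b2: "\<bar>Wv k x\<bar> \<le> (C0 / s) / eps ^ k * layer_weight eps x" if "k \<le> p + 1" "x \<in> {0..1}" for k x
    proof -
      have "\<bar>Wv k x\<bar> = E * \<bar>W (k + 2) x\<bar>" using E0 by (simp add: Wv_def abs_mult)
      also have "\<dots> \<le> E * (C0 / eps ^ (k + 2) * layer_weight eps x)" using E0 that by (intro mult_left_mono Wb) auto
      also have "\<dots> = (C0 / s) / eps ^ k * layer_weight eps x"
      proof -
        have e: "E / eps ^ (k + 2) = (1 / s) / eps ^ k"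
          using s eps unfolding Es by (simp add: power_add power2_eq_square field_simps)
        have "E * (C0 / eps ^ (k + 2)) = C0 * (E / eps ^ (k + 2))" by simp
        also have "\<dots> = (C0 / s) / eps ^ k" unfolding e by simp
        finally show ?thesis by (simp only: mult.assoc[symmetric])
      qed
      finally show ?thesis .
    qed
    have Cs: "0 \<le> C0 / s" using C0 s by simp
    from shishkin_approximation[OF p \<sigma> eps(1) N \<tau> L c(1) less_imp_le[OF C0] b1 c(2) Cs b2 Ci]
    show ?thesis using that by blast
  qed
  have uV: "uh \<in> spline_space p N ?xs" "vh \<in> spline_space p N ?xs" and V: "(uh, vh) \<in> Vh p N ?xs"
    using fe by (auto simp: fe_solution_def Vh_def)
  obtain Qu uh2 where UH: "spline_triple p N ?xs Qu uh (D01 uh) uh2"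
    using spline_space_triple[OF uV(1) mesh] by blast
  obtain Qv vh2 where VH: "spline_triple p N ?xs Qv vh (D01 vh) vh2"
    using spline_space_triple[OF uV(2) mesh] by blast
  note C = spline_triple_diff[OF A(1) UH]
  note D = spline_triple_diff[OF B(1) VH]
  have "1 \<le> p + 3" by simp
  note bcG = bvp_solution_boundary[OF bvp chG this uG]
  have bcc: "\<forall>\<xi>\<in>{0, 1}. A \<xi> - uh \<xi> = 0 \<and> A1 \<xi> - D01 uh \<xi> = 0"
    using A(2) bcG spline_Vh_boundary[OF V] by (fastforce simp: G_def)
  define a where "a = (\<lambda>x. G 0 x - A x)"
  define a1 where "a1 = (\<lambda>x. G 1 x - A1 x)"
  define a2 where "a2 = (\<lambda>x. G 2 x - A2 x)"
  define b where "b = (\<lambda>x. E * G 2 x - B x)"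
  define b1 where "b1 = (\<lambda>x. E * G 3 x - B1 x)"
  define b2 where "b2 = (\<lambda>x. E * G 4 x - B2 x)"
  define c where "c = (\<lambda>x. A x - uh x)"
  define c1 where "c1 = (\<lambda>x. A1 x - D01 uh x)"
  define c2 where "c2 = (\<lambda>x. A2 x - uh2 x)"
  define d where "d = (\<lambda>x. B x - vh x)"
  define d1 where "d1 = (\<lambda>x. B1 x - D01 vh x)"
  define d2 where "d2 = (\<lambda>x. B2 x - vh2 x)"
  note C' = C[folded c_def c1_def c2_def] and D' = D[folded d_def d1_def d2_def]
  have bca: "\<forall>\<xi>\<in>{0, 1}. a \<xi> = 0 \<and> a1 \<xi> = 0" using A(2) by (auto simp: a_def a1_def G_def)
  have bcc': "\<forall>\<xi>\<in>{0, 1}. c \<xi> = 0 \<and> c1 \<xi> = 0" using bcc by (simp add: c_def c1_def)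
  have pwA: "pw_C2 A A1 A2" and pwB: "pw_C2 B B1 B2" using A(1) B(1) by (auto simp: spline_triple_def)
  have pwc: "pw_C2 c c1 c2" and pwd: "pw_C2 d d1 d2" using C' D' by (auto simp: spline_triple_def)
  have pwG0: "pw_C2 (G 0) (G 1) (G 2)"
    using deriv_chain_pw_C2[OF chG, of 0] by (simp add: numeral_2_eq_2)
  have pwG2: "pw_C2 (\<lambda>x. E * G 2 x) (\<lambda>x. E * G 3 x) (\<lambda>x. E * G 4 x)"
  proof -
    have "deriv_chain 0 1 2 (\<lambda>k x. E * G (k + 2) x)" using p by (intro deriv_chain_shift_scale[OF chG]) auto
    from deriv_chain_pw_C2[OF this, of 0] show ?thesis by (simp add: eval_nat_numeral)
  qed
  have pwa: "pw_C2 a a1 a2" unfolding a_def a1_def a2_def by (rule pw_C2_diff[OF pwG0 pwA])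
  have pwb: "pw_C2 b b1 b2" unfolding b_def b1_def b2_def by (rule pw_C2_diff[OF pwG2 pwB])
  have "4 \<le> p + 3" using p by simp
  note gal = galerkin_orthogonality[OF eps(1) E_def f chG this uG bvp fe UH VH C' D' bcc']
  have gal': "lam * L2_inner (\<lambda>x. (b x + d x) - E * (a2 x + c2 x)) (\<lambda>x. d x - E * c2 x)
      + L2_inner (\<lambda>x. eps * E * (b2 x + d2 x) + 4 * (a x + c x)) (\<lambda>x. E * d2 x + 4 * c x) = 0"
    using gal by (simp add: a_def a2_def b_def b2_def c_def[abs_def] c2_def d_def d2_def)
  define \<Theta> where "\<Theta> = 1 / real N ^ (p + 1)"
  define \<Lambda> where "\<Lambda> = L ^ (p + 1)"
  define F where "F = (4::real) ^ (p + 1)"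
  have \<Theta>0: "\<Theta> > 0" using N by (simp add: \<Theta>_def)
  have \<Lambda>1: "\<Lambda> \<ge> 1" "L \<le> \<Lambda>"
  proof -
    show "\<Lambda> \<ge> 1" unfolding \<Lambda>_def by (rule one_le_power[OF L(2)])
    show "L \<le> \<Lambda>" using power_increasing[of 1 "p + 1" L] L(2) by (simp add: \<Lambda>_def)
  qed
  have F: "2 ^ (p + 1) \<le> F" "F > 0" unfolding F_def by (intro power_mono) auto
  define mn where "mn = min (E * real N ^ 2) (1 / s)"
  have mn0: "mn \<ge> 0" using E0 s by (simp add: mn_def)
  define \<mu> where "\<mu> = C0 * \<Theta> * (11 * F * \<Lambda> + 2 ^ (p + 1) * (1 + sqrt Cinv) * mn)"
  define \<rho> where "\<rho> = 42 * C0 * \<Theta>"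
  have \<mu>0: "\<mu> \<ge> 0" and \<rho>0: "\<rho> \<ge> 0"
    using C0 \<Theta>0 F \<Lambda>1 mn0 Cinv by (auto simp: \<mu>_def \<rho>_def)
  have na: "L2_norm a \<le> 10 * F * C0 * \<Lambda> * \<Theta>"
  proof -
    have "L2_norm a \<le> (2 ^ (p + 1) * C0 + 9 * F * C0 * s * \<Lambda>) * \<Theta>"
      using A(4) by (simp add: a_def G_def F_def s_def \<Lambda>_def \<Theta>_def)
    also have "\<dots> \<le> (F * C0 * \<Lambda> + 9 * F * C0 * 1 * \<Lambda>) * \<Theta>"
    proof (intro mult_right_mono add_mono)
      have "2 ^ (p + 1) * C0 * 1 \<le> F * C0 * \<Lambda>" using F \<Lambda>1 C0 by (intro mult_mono) auto
      then show "2 ^ (p + 1) * C0 \<le> F * C0 * \<Lambda>" by simp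
      show "9 * F * C0 * s \<le> 9 * F * C0 * 1" using F C0 s by (intro mult_left_mono) auto
    qed (use \<Lambda>1 \<Theta>0 in auto)
    finally show ?thesis by (simp add: algebra_simps)
  qed
  have nb: "L2_norm b \<le> 10 * F * C0 * \<Lambda> * \<Theta>"
  proof -
    have "L2_norm b \<le> (2 ^ (p + 1) * C0 + 9 * F * C0 * \<Lambda>) * \<Theta>"
    proof -
      have "9 * F * (C0 / s) * s = 9 * F * C0" using s by simp
      then show ?thesis
        using B(4)[folded s_def F_def \<Lambda>_def] by (simp add: b_def G_def Rv_def Wv_def \<Theta>_def distrib_left numeral_2_eq_2)
    qed
    also have "\<dots> \<le> (F * C0 * \<Lambda> + 9 * F * C0 * \<Lambda>) * \<Theta>"
    proof (intro mult_right_mono add_mono order_refl)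
      have "2 ^ (p + 1) * C0 * 1 \<le> F * C0 * \<Lambda>" using F \<Lambda>1 C0 by (intro mult_mono) auto
      then show "2 ^ (p + 1) * C0 \<le> F * C0 * \<Lambda>" by simp
    qed (use \<Theta>0 F C0 \<Lambda>1 in auto)
    finally show ?thesis by (simp add: algebra_simps)
  qed
  have ac: "E * \<bar>L2_inner a2 c2\<bar> \<le> \<rho> * L2_norm c2"
  proof -
    have "\<bar>L2_inner a2 c2\<bar> \<le> 42 * C0 * \<Theta> / E * L2_norm c2"
      using A(3)[OF C'] by (simp add: a2_def G_def \<Theta>_def E_def)
    then have "E * \<bar>L2_inner a2 c2\<bar> \<le> E * (42 * C0 * \<Theta> / E * L2_norm c2)" using E0 by (intro mult_left_mono) auto
    then show ?thesis using E0 by (simp add: \<rho>_def)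
  qed
  have bd: "eps\<^sup>2 * \<bar>L2_inner b2 d2\<bar> \<le> \<rho> * L2_norm d2"
  proof -
    have "\<bar>L2_inner b2 d2\<bar> \<le> 42 * (C0 / s) * \<Theta> / E * L2_norm d2"
      using B(3)[OF D'] by (simp add: b2_def G_def Rv_def Wv_def \<Theta>_def E_def distrib_left)
    also have "\<dots> = 42 * C0 * \<Theta> / eps\<^sup>2 * L2_norm d2" by (simp add: mult.commute flip: Eeps)
    finally have "eps\<^sup>2 * \<bar>L2_inner b2 d2\<bar> \<le> eps\<^sup>2 * (42 * C0 * \<Theta> / eps\<^sup>2 * L2_norm d2)" by (intro mult_left_mono) auto
    then show ?thesis using eps by (simp add: \<rho>_def)
  qed
  \<comment> \<open>The two cases are the two alternatives in the minimum.\<close>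
  have ad: "E * \<bar>L2_inner a d2\<bar> \<le> \<mu> * (eps\<^sup>2 * L2_norm d2 + L2_norm d)"
  proof (cases "E * real N ^ 2 \<le> 1 / s")
    case True
    then have mn: "mn = E * real N ^ 2" by (simp add: mn_def)
    have "\<bar>L2_inner a d2\<bar> \<le> (2 * C0 * sqrt (L * eps) + 9 * F * C0 * s * \<Lambda>) * \<Theta> * L2_norm d2
         + 2 ^ (p + 1) * C0 * \<Theta> * sqrt Cinv * (real N)\<^sup>2 * L2_norm d"
      using A(5)[OF D'] by (simp add: a_def G_def F_def s_def \<Lambda>_def \<Theta>_def)
    then have "E * \<bar>L2_inner a d2\<bar> \<le> E * ((2 * C0 * sqrt (L * eps) + 9 * F * C0 * s * \<Lambda>) * \<Theta> * L2_norm d2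
         + 2 ^ (p + 1) * C0 * \<Theta> * sqrt Cinv * (real N)\<^sup>2 * L2_norm d)" using E0 by (intro mult_left_mono) auto
    also have "\<dots> = C0 * \<Theta> * (2 * sqrt L + 9 * F * \<Lambda>) * (E * s * L2_norm d2)
        + C0 * \<Theta> * (2 ^ (p + 1) * sqrt Cinv * (E * (real N)\<^sup>2)) * L2_norm d"
      by (simp add: real_sqrt_mult s_def algebra_simps)
    also have "\<dots> \<le> \<mu> * (E * s * L2_norm d2) + \<mu> * L2_norm d"
    proof (intro add_mono mult_right_mono)
      have "sqrt L \<le> sqrt (L * L)" using L(2) by (intro real_sqrt_le_mono) simp
      then have "sqrt L \<le> L" using L(2) by simp
      then have sL: "2 * sqrt L \<le> 2 * \<Lambda>" using \<Lambda>1 by simp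
      have "1 \<le> F" using F(1) one_le_power[of "2::real" "p + 1"] by linarith
      then have "1 * \<Lambda> \<le> F * \<Lambda>" using \<Lambda>1 by (intro mult_right_mono) auto
      moreover have "0 \<le> 2 ^ (p + 1) * (1 + sqrt Cinv) * mn" using Cinv mn0 by simp
      ultimately have "2 * sqrt L + 9 * F * \<Lambda> \<le> 11 * F * \<Lambda> + 2 ^ (p + 1) * (1 + sqrt Cinv) * mn"
        using sL by linarith
      then show "C0 * \<Theta> * (2 * sqrt L + 9 * F * \<Lambda>) \<le> \<mu>"
        unfolding \<mu>_def using C0 \<Theta>0 by (intro mult_left_mono) auto
      have "2 ^ (p + 1) * sqrt Cinv * mn \<le> 2 ^ (p + 1) * (1 + sqrt Cinv) * mn"
        using mn0 by (intro mult_right_mono) auto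
      moreover have "0 \<le> 11 * F * \<Lambda>" using F \<Lambda>1 by simp
      ultimately have "2 ^ (p + 1) * sqrt Cinv * mn \<le> 11 * F * \<Lambda> + 2 ^ (p + 1) * (1 + sqrt Cinv) * mn"
        by linarith
      then show "C0 * \<Theta> * (2 ^ (p + 1) * sqrt Cinv * (E * (real N)\<^sup>2)) \<le> \<mu>"
        unfolding \<mu>_def mn using C0 \<Theta>0 by (intro mult_left_mono) auto
    qed (use E0 s L2_norm_nonneg in auto)
    finally show ?thesis by (simp add: Eeps distrib_left)
  next
    case False
    then have mn: "mn = 1 / s" by (simp add: mn_def)
    have "\<bar>L2_inner a d2\<bar> \<le> L2_norm a * L2_norm d2"
      by (intro L2_Cauchy_Schwarz pw_C2_bounded_meas[OF pwa] pw_C2_bounded_meas[OF pwd])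
    also have "\<dots> \<le> (2 ^ (p + 1) * C0 + 9 * F * C0 * s * \<Lambda>) * \<Theta> * L2_norm d2"
      using A(4) by (intro mult_right_mono L2_norm_nonneg) (simp add: a_def G_def F_def s_def \<Lambda>_def \<Theta>_def)
    finally have "E * \<bar>L2_inner a d2\<bar> \<le> E * ((2 ^ (p + 1) * C0 + 9 * F * C0 * s * \<Lambda>) * \<Theta> * L2_norm d2)"
      using E0 by (intro mult_left_mono) auto
    also have "\<dots> = C0 * \<Theta> * (2 ^ (p + 1) * (1 / s) + 9 * F * \<Lambda>) * (E * s * L2_norm d2)"
      using s by (simp add: field_simps)
    also have "\<dots> \<le> \<mu> * (E * s * L2_norm d2)"
    proof (rule mult_right_mono)
      have "2 ^ (p + 1) * 1 * mn \<le> 2 ^ (p + 1) * (1 + sqrt Cinv) * mn"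
        using mn0 Cinv by (intro mult_right_mono mult_left_mono) auto
      moreover have "9 * F * \<Lambda> \<le> 11 * F * \<Lambda>" using F \<Lambda>1 by simp
      ultimately have "2 ^ (p + 1) * mn + 9 * F * \<Lambda> \<le> 11 * F * \<Lambda> + 2 ^ (p + 1) * (1 + sqrt Cinv) * mn" by linarith
      then show "C0 * \<Theta> * (2 ^ (p + 1) * (1 / s) + 9 * F * \<Lambda>) \<le> \<mu>"
        unfolding \<mu>_def mn using C0 \<Theta>0 by (intro mult_left_mono) auto
    qed (use E0 s L2_norm_nonneg in auto)
    also have "\<dots> \<le> \<mu> * (E * s * L2_norm d2 + L2_norm d)"
      using \<mu>0 L2_norm_nonneg by (intro mult_left_mono) auto
    finally show ?thesis by (simp add: Eeps)
  qed
  note en = energy_estimate[OF eps lam E_def pwa pwb pwc pwd bca bcc' gal' ac bd ad \<rho>0 \<mu>0]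
  have bms: "a \<in> bounded_meas" "b \<in> bounded_meas" "c \<in> bounded_meas" "d \<in> bounded_meas"
    using pw_C2_bounded_meas[OF pwa] pw_C2_bounded_meas[OF pwb] pw_C2_bounded_meas[OF pwc] pw_C2_bounded_meas[OF pwd] by auto
  have e1: "L2_norm (\<lambda>x. u x - uh x) \<le> L2_norm a + L2_norm c"
  proof -
    have "L2_norm (\<lambda>x. u x - uh x) = L2_norm (\<lambda>x. a x + c x)"
      unfolding L2_norm_def L2_inner_def
      by (intro arg_cong[where f=sqrt] Bochner_Integration.integral_cong) (auto simp: uG a_def c_def)
    also have "\<dots> \<le> L2_norm a + L2_norm c" by (intro L2_norm_triangle bms)
    finally show ?thesis .
  qed
  have e2: "L2_norm (\<lambda>x. eps powr (3/2) * weak_deriv 2 u x - vh x) \<le> L2_norm b + L2_norm d"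
  proof -
    have wu: "has_weak_deriv 2 u (G 2)"
      by (rule has_weak_deriv_cong[OF pw_C2_weak_deriv2[OF pwG0]]) (simp add: uG)
    have vh: "vh \<in> L2" using spline_triple_bounded_meas(1)[OF VH] by (rule bounded_meas_L2)
    have "L2_inner (\<lambda>x. E * weak_deriv 2 u x - vh x) (\<lambda>x. E * weak_deriv 2 u x - vh x) = L2_inner (\<lambda>x. b x + d x) (\<lambda>x. b x + d x)"
    proof (rule L2_inner_cong_AE)
      show "AE x in lebesgue_on Omega. E * weak_deriv 2 u x - vh x = b x + d x"
        using weak_deriv_AE_eq[OF wu] by eventually_elim (simp add: b_def d_def)
      then show "AE x in lebesgue_on Omega. E * weak_deriv 2 u x - vh x = b x + d x" .
      show "(\<lambda>x. E * weak_deriv 2 u x - vh x) \<in> L2 \<or> (\<lambda>x. E * weak_deriv 2 u x - vh x) \<in> bounded_meas"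
        by (intro disjI1 L2_diff L2_cmult weak_deriv_in_L2[OF wu] vh)
      then show "(\<lambda>x. E * weak_deriv 2 u x - vh x) \<in> L2 \<or> (\<lambda>x. E * weak_deriv 2 u x - vh x) \<in> bounded_meas" .
      show "(\<lambda>x. b x + d x) \<in> L2 \<or> (\<lambda>x. b x + d x) \<in> bounded_meas"
        by (intro disjI2 bounded_meas_add bms)
      then show "(\<lambda>x. b x + d x) \<in> L2 \<or> (\<lambda>x. b x + d x) \<in> bounded_meas" .
    qed
    then have "L2_norm (\<lambda>x. eps powr (3/2) * weak_deriv 2 u x - vh x) = L2_norm (\<lambda>x. b x + d x)"
      by (simp only: pows L2_norm_def)
    also have "\<dots> \<le> L2_norm b + L2_norm d" by (intro L2_norm_triangle bms)
    finally show ?thesis .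
  qed
  define Z where "Z = 10 * F * C0 * \<Lambda> * \<Theta>"
  have X: "16 * L2_norm a + (2 * lam + 4) * L2_norm b + 2 * \<bar>lam - 4\<bar> * \<mu> + (lam + 1) * \<rho>
     \<le> (2 * lam + 20) * Z + 2 * \<bar>lam - 4\<bar> * \<mu> + (lam + 1) * (\<rho> * \<Lambda>)"
  proof -
    have "(2 * lam + 4) * L2_norm b \<le> (2 * lam + 4) * Z" using nb lam by (intro mult_left_mono) (auto simp: Z_def)
    moreover have "(lam + 1) * (\<rho> * 1) \<le> (lam + 1) * (\<rho> * \<Lambda>)" using lam \<rho>0 \<Lambda>1 by (intro mult_left_mono) auto
    moreover have "(2 * lam + 20) * Z = 16 * Z + (2 * lam + 4) * Z" by (simp add: algebra_simps)
    ultimately show ?thesis using na by (simp add: Z_def)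
  qed
  have "L2_norm (\<lambda>x. u x - uh x) + L2_norm (\<lambda>x. eps powr (3/2) * weak_deriv 2 u x - vh x)
     \<le> 2 * Z + 2 * ((2 * lam + 20) * Z + 2 * \<bar>lam - 4\<bar> * \<mu> + (lam + 1) * (\<rho> * \<Lambda>))"
    using add_mono[OF order_trans[OF e1 add_mono[OF na[folded Z_def] order_trans[OF en(1) X]]]
        order_trans[OF e2 add_mono[OF nb[folded Z_def] order_trans[OF en(2) X]]]]
    by (simp only: mult_2 add_ac)
  also have "\<dots> = (P * \<Lambda> + K * (\<bar>lam - 4\<bar> * mn)) * \<Theta>"
    unfolding Z_def \<mu>_def \<rho>_def P K F_def[symmetric] by (simp add: algebra_simps)
  also have "mn = min (eps powr (3/2) * real N ^ 2) (eps powr (- 1/2))"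
    unfolding mn_def pows s_def ..
  finally show ?thesis unfolding \<Lambda>_def \<Theta>_def by simp
qed

theorem theorem9:
  fixes p :: nat and \<sigma> lam C0 :: real
  assumes "p \<ge> 3" and "\<sigma> \<ge> real p + 1" and "lam \<ge> 3" and "C0 > 0"
  shows "\<exists>C>0. \<forall>(eps::real) (N::nat) f u uh vh.
     0 < eps \<and> eps \<le> 1 \<and> N \<ge> 4 \<and> 4 dvd N \<and> \<sigma> * eps * ln (real N) \<le> 1 / 4 \<and>
     f \<in> L2 \<and> bvp_solution eps f u \<and> layer_decomposition (p + 3) C0 eps f u \<and>
     fe_solution p N (shishkin \<sigma> eps N) lam eps f (uh, vh) \<longrightarrow>
       L2_norm (\<lambda>x. u x - uh x) + L2_norm (\<lambda>x. eps powr (3/2) * weak_deriv 2 u x - vh x)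
         \<le> C * (ln (real N) ^ (p + 1)
                + \<bar>lam - 4\<bar> * min (eps powr (3/2) * real N ^ 2) (eps powr (- 1/2)))
             * real N powi (- int (p + 1)) \<and>
       (lam = 4 \<or> eps powr (3/2) \<le> real N powi (- 2) \<longrightarrow>
         L2_norm (\<lambda>x. u x - uh x) + L2_norm (\<lambda>x. eps powr (3/2) * weak_deriv 2 u x - vh x)
           \<le> C * (ln (real N) / real N) ^ (p + 1))"
proof -
  obtain Cinv where Ci: "inverse_constant p Cinv"
    using inverse_inequality[of p] by blast
  then have Cinv: "Cinv \<ge> 0" by (simp add: inverse_constant_def)
  define P where "P = C0 * ((4 * lam + 42) * (10 * 4 ^ (p + 1)) + 84 * (lam + 1) + 44 * \<bar>lam - 4\<bar> * 4 ^ (p + 1))"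
  define K where "K = C0 * (4 * 2 ^ (p + 1) * (1 + sqrt Cinv))"
  define C1 where "C1 = P * \<sigma> ^ (p + 1) + K"
  \<comment> \<open>The additional factor is for the second bound, where the term with \<open>lam - 4\<close> is at most \<open>\<bar>lam - 4\<bar>\<close> times the logarithmic term.\<close>
  define C where "C = C1 * (1 + \<bar>lam - 4\<bar>)"
  have \<sigma>: "\<sigma> > 0" using assms(2) by simp
  have P0: "P > 0" unfolding P_def using assms by (intro mult_pos_pos add_pos_nonneg) auto
  have K0: "K \<ge> 0" unfolding K_def using assms(4) Cinv by simp
  have PC: "P * \<sigma> ^ (p + 1) > 0" using P0 \<sigma> by simp
  then have C1: "C1 > 0" "P * \<sigma> ^ (p + 1) \<le> C1" "K \<le> C1" using K0 by (auto simp: C1_def)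
  have C1C: "C1 \<le> C" unfolding C_def using C1 by (simp add: algebra_simps)
  have main: "L2_norm (\<lambda>x. u x - uh x) + L2_norm (\<lambda>x. eps powr (3/2) * weak_deriv 2 u x - vh x)
         \<le> C * (ln (real N) ^ (p + 1)
                + \<bar>lam - 4\<bar> * min (eps powr (3/2) * real N ^ 2) (eps powr (- 1/2)))
             * real N powi (- int (p + 1)) \<and>
       (lam = 4 \<or> eps powr (3/2) \<le> real N powi (- 2) \<longrightarrow>
         L2_norm (\<lambda>x. u x - uh x) + L2_norm (\<lambda>x. eps powr (3/2) * weak_deriv 2 u x - vh x)
           \<le> C * (ln (real N) / real N) ^ (p + 1))"
    if h: "0 < eps" "eps \<le> 1" "N \<ge> 4" "4 dvd N" "\<sigma> * eps * ln (real N) \<le> 1 / 4"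
      "f \<in> L2" "bvp_solution eps f u" "layer_decomposition (p + 3) C0 eps f u"
      "fe_solution p N (shishkin \<sigma> eps N) lam eps f (uh, vh)" for eps N f u uh vh
  proof -
    obtain M where M: "N = 4 * M" using h(4) by blast
    have M0: "M > 0" using M h(3) by simp
    have ln1: "1 \<le> ln (real N)"
    proof -
      have "exp 1 \<le> (3::real)" using exp_le .
      also have "3 \<le> real N" using h(3) by simp
      finally show ?thesis using h(3) by (simp add: ln_ge_iff)
    qed
    define L where "L = \<sigma> * ln (real N)"
    have L1: "L \<ge> 1"
    proof -
      have "1 * 1 \<le> \<sigma> * ln (real N)" using assms(2) ln1 by (intro mult_mono) auto
      then show ?thesis by (simp add: L_def)
    qed
    define mn where "mn = min (eps powr (3/2) * real N ^ 2) (eps powr (- 1/2))"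
    have mn0: "mn \<ge> 0" by (simp add: mn_def)
    define T where "T = L2_norm (\<lambda>x. u x - uh x) + L2_norm (\<lambda>x. eps powr (3/2) * weak_deriv 2 u x - vh x)"
    have N0: "real N > 0" using h(3) by simp
    have "T \<le> (P * L ^ (p + 1) + K * (\<bar>lam - 4\<bar> * mn)) / real N ^ (p + 1)"
      unfolding T_def mn_def
      by (rule discretisation_error[OF assms h(1,2) M M0 h(5) L_def L1 h(6-9) Ci P_def K_def])
    also have "\<dots> \<le> C1 * (ln (real N) ^ (p + 1) + \<bar>lam - 4\<bar> * mn) / real N ^ (p + 1)"
    proof (rule divide_right_mono)
      have "P * L ^ (p + 1) = P * \<sigma> ^ (p + 1) * ln (real N) ^ (p + 1)" by (simp add: L_def power_mult_distrib)
      also have "\<dots> \<le> C1 * ln (real N) ^ (p + 1)" using C1 ln1 by (intro mult_right_mono) auto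
      finally have "P * L ^ (p + 1) \<le> C1 * ln (real N) ^ (p + 1)" .
      moreover have "K * (\<bar>lam - 4\<bar> * mn) \<le> C1 * (\<bar>lam - 4\<bar> * mn)" using C1 mn0 by (intro mult_right_mono) auto
      ultimately show "P * L ^ (p + 1) + K * (\<bar>lam - 4\<bar> * mn) \<le> C1 * (ln (real N) ^ (p + 1) + \<bar>lam - 4\<bar> * mn)"
        unfolding distrib_left by linarith
    qed simp
    finally have T1: "T \<le> C1 * (ln (real N) ^ (p + 1) + \<bar>lam - 4\<bar> * mn) / real N ^ (p + 1)" .
    have "C1 * (ln (real N) ^ (p + 1) + \<bar>lam - 4\<bar> * mn) \<le> C * (ln (real N) ^ (p + 1) + \<bar>lam - 4\<bar> * mn)"
      using C1C ln1 mn0 by (intro mult_right_mono) auto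
    then have "C1 * (ln (real N) ^ (p + 1) + \<bar>lam - 4\<bar> * mn) / real N ^ (p + 1)
        \<le> C * (ln (real N) ^ (p + 1) + \<bar>lam - 4\<bar> * mn) / real N ^ (p + 1)"
      by (rule divide_right_mono) simp
    with T1 have "T \<le> C * (ln (real N) ^ (p + 1) + \<bar>lam - 4\<bar> * mn) / real N ^ (p + 1)" by linarith
    moreover have "real N powi (- int (p + 1)) = 1 / real N ^ (p + 1)"
      by (simp only: power_int_minus power_int_of_nat inverse_eq_divide)
    ultimately have first: "T \<le> C * (ln (real N) ^ (p + 1) + \<bar>lam - 4\<bar> * mn) * real N powi (- int (p + 1))"
      by (simp only: times_divide_eq_right mult_1_right)
    have second: "T \<le> C * (ln (real N) / real N) ^ (p + 1)" if "lam = 4 \<or> eps powr (3/2) \<le> real N powi (- 2)"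
    proof -
      have "\<bar>lam - 4\<bar> * mn \<le> \<bar>lam - 4\<bar> * ln (real N) ^ (p + 1)"
        using that
      proof
        assume "eps powr (3/2) \<le> real N powi (- 2)"
        then have "eps powr (3/2) * real N ^ 2 \<le> real N powi (- 2) * real N ^ 2" by (intro mult_right_mono) auto
        also have "\<dots> = 1" using N0 by (simp add: power_int_minus)
        finally have "mn \<le> 1" by (simp add: mn_def)
        also have "1 \<le> ln (real N) ^ (p + 1)" by (rule one_le_power[OF ln1])
        finally show ?thesis by (intro mult_left_mono) auto
      qed simp
      then have "ln (real N) ^ (p + 1) + \<bar>lam - 4\<bar> * mn \<le> (1 + \<bar>lam - 4\<bar>) * ln (real N) ^ (p + 1)"
        by (simp only: distrib_right mult_1_left add_left_mono)
      then have "C1 * (ln (real N) ^ (p + 1) + \<bar>lam - 4\<bar> * mn) \<le> C1 * ((1 + \<bar>lam - 4\<bar>) * ln (real N) ^ (p + 1))"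
        using C1 by (intro mult_left_mono) auto
      then have "C1 * (ln (real N) ^ (p + 1) + \<bar>lam - 4\<bar> * mn) / real N ^ (p + 1) \<le> C1 * ((1 + \<bar>lam - 4\<bar>) * ln (real N) ^ (p + 1)) / real N ^ (p + 1)"
        by (rule divide_right_mono) simp
      also have "\<dots> = C * (ln (real N) / real N) ^ (p + 1)"
        by (simp only: C_def power_divide times_divide_eq_right mult.assoc)
      finally show ?thesis using T1 by linarith
    qed
    show ?thesis using first second unfolding T_def mn_def by blast
  qed
  have "C > 0" using C1 C1C by linarith
  then show ?thesis using main by blast
qed

end
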